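(* Let $n$ be an odd positive integer and let $r,s$ be integers with $r,s\geq 1$ (so $rs\neq 0$) and $r+s=\frac{n-1}{2}$. Then an $HW(n;r,s;3,7)$ exists if and only if $n\equiv 21\pmod{42}$, except possibly when $n=21$ and $r\in\{2,4,6\}$.
   Context: A 2-factor of a graph $G$ is a spanning 2-regular subgraph; a $C_k$-factor is a 2-factor all of whose components are cycles of length $k$. A 2-factorization of $G$ is a partition of the edge set of $G$ into 2-factors. For odd $n$, an $HW(n;r,s;m,k)$ is a 2-factorization of the complete graph $K_n$ into $r+s=\frac{n-1}{2}$ 2-factors, of which exactly $r$ are $C_m$-factors and exactly $s$ are $C_k$-factors. *)

theory Defs
  imports Main "HOL-Library.Disjoint_Sets" "HOL-Number_Theory.Cong"
begin

text \<open>
  A finite simple graph is given by a vertex set \<open>V\<close> and a set \<open>E\<close> of two-element subsets of \<open>V\<close>.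
  A spanning subgraph of \<open>(V, E)\<close> has the same vertex set, so it is identified with its
  edge set \<open>F \<subseteq> E\<close>.
\<close>

definition complete_edges :: "'a set \<Rightarrow> 'a set set" where
  "complete_edges V = {e. e \<subseteq> V \<and> card e = 2}"

definition vertex_degree :: "'a set set \<Rightarrow> 'a \<Rightarrow> nat" where
  "vertex_degree E v = card {e \<in> E. v \<in> e}"

definition cycle_graph :: "nat \<Rightarrow> 'a set \<Rightarrow> 'a set set \<Rightarrow> bool" where
  "cycle_graph k V E \<longleftrightarrow> 3 \<le> k \<and>
     (\<exists>f. bij_betw f {..<k} V \<and> E = {{f i, f (Suc i mod k)} | i. i < k})"

definition connected_rel :: "'a set \<Rightarrow> 'a set set \<Rightarrow> ('a \<times> 'a) set" where
  "connected_rel V E = {(u, v). u \<in> V \<and> v \<in> V \<and> (u, v) \<in> {(x, y). {x, y} \<in> E}\<^sup>*}"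

definition graph_components :: "'a set \<Rightarrow> 'a set set \<Rightarrow> ('a set \<times> 'a set set) set" where
  "graph_components V E = {(C, {e \<in> E. e \<subseteq> C}) | C. C \<in> V // connected_rel V E}"

definition two_factor :: "'a set \<Rightarrow> 'a set set \<Rightarrow> 'a set set \<Rightarrow> bool" where
  "two_factor V E F \<longleftrightarrow> F \<subseteq> E \<and> (\<forall>v \<in> V. vertex_degree F v = 2)"

definition cycle_factor :: "nat \<Rightarrow> 'a set \<Rightarrow> 'a set set \<Rightarrow> 'a set set \<Rightarrow> bool" where
  "cycle_factor k V E F \<longleftrightarrow>
     two_factor V E F \<and> (\<forall>(C, D) \<in> graph_components V F. cycle_graph k C D)"

definition two_factorization :: "'a set \<Rightarrow> 'a set set \<Rightarrow> 'a set set set \<Rightarrow> bool" where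
  "two_factorization V E P \<longleftrightarrow> partition_on E P \<and> (\<forall>F \<in> P. two_factor V E F)"

text \<open>
  \<open>HW n r s m k P\<close>: the set \<open>P\<close> of 2-factors is an \<open>HW(n;r,s;m,k)\<close> on the vertices
  \<open>0, \<dots>, n - 1\<close>. For \<open>m \<noteq> k\<close> the condition on \<open>card P\<close> forces every member of \<open>P\<close> to be a
  \<open>C\<^sub>m\<close>-factor or a \<open>C\<^sub>k\<close>-factor. The division is exact because \<open>n\<close> is odd.
\<close>

definition HW :: "nat \<Rightarrow> nat \<Rightarrow> nat \<Rightarrow> nat \<Rightarrow> nat \<Rightarrow> nat set set set \<Rightarrow> bool" where
  "HW n r s m k P \<longleftrightarrow>
     odd n \<and> r + s = (n - 1) div 2 \<and>
     two_factorization {..<n} (complete_edges {..<n}) P \<and>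
     card P = r + s \<and>
     card {F \<in> P. cycle_factor m {..<n} (complete_edges {..<n}) F} = r \<and>
     card {F \<in> P. cycle_factor k {..<n} (complete_edges {..<n}) F} = s"

end

(*
  Blow up every point of a Kirkman triple system on 6t + 3 points by 7. One parallel class of triples
  becomes a set of disjoint copies of K_21, to be decomposed into r' triangle factors and 10 - r'
  heptagon factors for r' in {0, 1, 3, 5, 7, 8, 9, 10}; every other parallel class becomes a set of
  disjoint copies of the complete tripartite graph K_{7,7,7}, to be decomposed into e triangle
  factors and 7 - e heptagon factors for e in {0, 1, 3, 5, 7}. These numbers add up to all r with
  1 <= r < (n - 1) / 2 as soon as t >= 1.

  Kirkman triple systems exist for all orders 6t + 3 (Ray-Chaudhuri and Wilson): the block sizes b
  admitting a Kirkman frame of type 2^b (equivalently a system on 2b + 1 points) are closed under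
  pairwise balanced designs. Giving weight 3 to a truncated transversal design with five groups,
  which modulo M is elementary for M coprime to 6, reduces t = 4M + w to M and w <= M. The remaining
  small t come from a product construction, from difference families built on a primitive cube root
  of unity, and from an ad hoc design on 34 points.
*)
theory Submission
  imports Defs "HOL-Library.Numeral_Type" "HOL-Library.Product_Plus"
begin

section \<open>Cycle factors\<close>

text \<open>The even counts 2, 4 and 6 shape the argument. The decompositions of K_{7,7,7} use
  heptagon factors in pairs, so a nonzero number of triangle factors comes out odd, and K_21
  inherits the gap. One further class repairs it, since 2, 4, 6 are 1 plus an odd count; a single
  K_21 has no further class, whence the possible exceptions at n = 21. One class must carry the K_21
  because edges between two copies of the same point lie in no K_{7,7,7}, while the triples of a
  class contain every point exactly once. In the recursion for Kirkman systems all frame sizes have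
  the form 3t + 1. Weight 3 and one extra point preserve it: a group of size M yields 3M + 1 points,
  and blocks of sizes 4 and 5 become designs with blocks of size 4, the frame size of the system on
  9 points. Coprimality to 6 makes the differences of the indices 0, 1, 2, 3 of the first four
  groups invertible modulo M; the fifth group records the slope.\<close>

definition factor :: "nat \<Rightarrow> 'a set \<Rightarrow> 'a set set \<Rightarrow> bool" where
  "factor k V F \<longleftrightarrow> (\<exists>Q c. partition_on V Q \<and> (\<forall>C\<in>Q. cycle_graph k C (c C)) \<and> F = (\<Union>C\<in>Q. c C))"

lemma partition_on_eqI:
  "partition_on V Q \<Longrightarrow> A \<in> Q \<Longrightarrow> B \<in> Q \<Longrightarrow> x \<in> A \<Longrightarrow> x \<in> B \<Longrightarrow> A = B"
  unfolding partition_on_def disjoint_def by auto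

lemma factorI:
  assumes "partition_on V Q" "\<forall>C\<in>Q. cycle_graph k C (c C)" "F = (\<Union>C\<in>Q. c C)"
  shows "factor k V F"
  unfolding factor_def using assms by (intro exI conjI)

lemma cycle_graph_card: "cycle_graph k C D \<Longrightarrow> card C = k"
  unfolding cycle_graph_def by (metis bij_betw_same_card card_lessThan)

lemma cycle_graph_edges:
  assumes "cycle_graph k C D"
  shows "D \<subseteq> complete_edges C"
proof
  fix e assume e: "e \<in> D"
  obtain f where k: "3 \<le> k" and f: "bij_betw f {..<k} C"
    and D: "D = {{f i, f (Suc i mod k)} | i. i < k}"
    using assms unfolding cycle_graph_def by auto
  obtain i where i: "i < k" "e = {f i, f (Suc i mod k)}" using e D by auto
  have s: "Suc i mod k < k" "Suc i mod k \<noteq> i" using k i by (auto simp: mod_Suc)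
  have "f i \<noteq> f (Suc i mod k)"
    using f i s by (metis bij_betw_inv_into_left lessThan_iff)
  then show "e \<in> complete_edges C"
    using i s f unfolding complete_edges_def bij_betw_def by auto
qed

text \<open>The edges at \<open>f i\<close> lead to its cyclic predecessor and successor, and
  \<open>3 \<le> k\<close> keeps these two apart.\<close>

lemma cycle_graph_degree:
  assumes "cycle_graph k C D" "v \<in> C"
  shows "vertex_degree D v = 2"
proof -
  obtain f where k: "3 \<le> k" and f: "bij_betw f {..<k} C"
    and D: "D = {{f i, f (Suc i mod k)} | i. i < k}"
    using assms unfolding cycle_graph_def by auto
  obtain i where i: "i < k" "v = f i" using assms(2) f unfolding bij_betw_def by auto
  have inj: "f a = f b \<longleftrightarrow> a = b" if "a < k" "b < k" for a b
    using f that unfolding bij_betw_def inj_on_def by auto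
  define p where "p = (if i = 0 then k - 1 else i - 1)"
  define n where "n = Suc i mod k"
  have pn: "p < k" "n < k" "p \<noteq> i" "n \<noteq> i" "p \<noteq> n" "Suc p mod k = i"
    using k i by (auto simp: p_def n_def mod_Suc)
  have "{e \<in> D. v \<in> e} = {{f p, f i}, {f i, f n}}"
  proof
    show "{e \<in> D. v \<in> e} \<subseteq> {{f p, f i}, {f i, f n}}"
    proof
      fix e assume "e \<in> {e \<in> D. v \<in> e}"
      then obtain j where j: "j < k" "e = {f j, f (Suc j mod k)}" "f i \<in> e" using D i by auto
      have "Suc j mod k < k" using k by simp
      then have "i = j \<or> i = Suc j mod k" using j i inj by auto
      then show "e \<in> {{f p, f i}, {f i, f n}}"
      proof
        assume "i = j" then show ?thesis using j by (simp add: n_def)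
      next
        assume h: "i = Suc j mod k"
        have "j = p" using h j k unfolding p_def by (auto simp: mod_Suc split: if_splits)
        then show ?thesis using j h by simp
      qed
    qed
    have "{f p, f i} \<in> D" using D pn by (metis (mono_tags, lifting) mem_Collect_eq)
    moreover have "{f i, f n} \<in> D" using D i n_def by blast
    ultimately show "{{f p, f i}, {f i, f n}} \<subseteq> {e \<in> D. v \<in> e}" using i by auto
  qed
  moreover have "{f p, f i} \<noteq> {f i, f n}"
    using inj pn i by (simp add: doubleton_eq_iff)
  ultimately show ?thesis unfolding vertex_degree_def by simp
qed

lemma cycle_graph_connected:
  assumes "cycle_graph k C D" "u \<in> C" "v \<in> C" "D \<subseteq> F"
  shows "(u, v) \<in> {(x, y). {x, y} \<in> F}\<^sup>*"
proof -
  obtain f where k: "3 \<le> k" and f: "bij_betw f {..<k} C"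
    and D: "D = {{f i, f (Suc i mod k)} | i. i < k}"
    using assms unfolding cycle_graph_def by auto
  let ?R = "{(x, y). {x, y} \<in> F}"
  have step: "(f 0, f i) \<in> ?R\<^sup>*" if "i < k" for i
    using that
  proof (induction i)
    case (Suc i)
    have "{f i, f (Suc i mod k)} \<in> D" unfolding D using Suc.prems by (intro CollectI exI[of _ i]) auto
    then have "{f i, f (Suc i mod k)} \<in> F" using assms(4) by auto
    then have "(f i, f (Suc i)) \<in> ?R" using Suc.prems by simp
    then show ?case using Suc by (meson Suc_lessD rtrancl.rtrancl_into_rtrancl)
  qed simp
  have sy: "sym ?R" by (auto simp: sym_def insert_commute)
  have "(u, f 0) \<in> ?R\<^sup>*" "(f 0, v) \<in> ?R\<^sup>*"
    using step f assms(2,3) sym_rtrancl[OF sy] unfolding bij_betw_def sym_def by auto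
  then show ?thesis by (rule rtrancl_trans)
qed

text \<open>No edge of \<open>F\<close> leaves a member of \<open>Q\<close>, and each member is
  connected by its own cycle. This links \<open>factor\<close>, which names its cycles explicitly,
  to components defined by reachability.\<close>

lemma factor_components:
  assumes Q: "partition_on V Q" and c: "\<And>C. C \<in> Q \<Longrightarrow> cycle_graph k C (c C)"
    and F: "F = (\<Union>C\<in>Q. c C)"
  shows "graph_components V F = {(C, c C) | C. C \<in> Q}"
proof -
  have edge: "e \<subseteq> C \<and> card e = 2" if "C \<in> Q" "e \<in> c C" for C e
    using cycle_graph_edges[OF c[OF that(1)]] that unfolding complete_edges_def by auto
  have un: "C = C'" if "C \<in> Q" "C' \<in> Q" "x \<in> C" "x \<in> C'" for C C' x
    using partition_on_eqI[OF Q that] .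
  let ?R = "{(x, y). {x, y} \<in> F}"
  have stay: "y \<in> C" if "(x, y) \<in> ?R\<^sup>*" "x \<in> C" "C \<in> Q" for x y C
    using that(1)
  proof (induction rule: rtrancl_induct)
    case base then show ?case using that by simp
  next
    case (step y z)
    then obtain C' where "C' \<in> Q" "{y, z} \<in> c C'" using F by auto
    then have "y \<in> C'" "z \<in> C'" using edge by blast+
    then show ?case using un step.IH that(3) \<open>C' \<in> Q\<close> by metis
  qed
  have rel: "connected_rel V F `` {x} = C" if "x \<in> C" "C \<in> Q" for x C
  proof -
    have "C \<subseteq> V" using Q that unfolding partition_on_def by auto
    moreover have "(x, y) \<in> ?R\<^sup>*" if "y \<in> C" for y
      by (rule cycle_graph_connected[OF c[OF \<open>C \<in> Q\<close>] \<open>x \<in> C\<close> that]) (use F \<open>C \<in> Q\<close> in auto)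
    ultimately show ?thesis using stay that unfolding connected_rel_def by auto
  qed
  have "V // connected_rel V F = Q"
  proof
    show "V // connected_rel V F \<subseteq> Q"
      using rel Q unfolding quotient_def partition_on_def by auto
    show "Q \<subseteq> V // connected_rel V F"
    proof
      fix C assume C: "C \<in> Q"
      then obtain x where "x \<in> C" using Q unfolding partition_on_def by (metis all_not_in_conv)
      then have "x \<in> V" "C = connected_rel V F `` {x}" using rel C Q unfolding partition_on_def by auto
      then show "C \<in> V // connected_rel V F" unfolding quotient_def by auto
    qed
  qed
  moreover have "{e \<in> F. e \<subseteq> C} = c C" if "C \<in> Q" for C
  proof
    show "{e \<in> F. e \<subseteq> C} \<subseteq> c C"
    proof
      fix e assume "e \<in> {e \<in> F. e \<subseteq> C}"
      then obtain C' where C': "C' \<in> Q" "e \<in> c C'" "e \<subseteq> C" using F by auto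
      then have "e \<subseteq> C'" "e \<noteq> {}" using edge by fastforce+
      then show "e \<in> c C" using un that C' by blast
    qed
    show "c C \<subseteq> {e \<in> F. e \<subseteq> C}" using edge F that by auto
  qed
  ultimately show ?thesis unfolding graph_components_def by auto
qed

lemma factor_edges:
  assumes "factor k V F" shows "F \<subseteq> complete_edges V"
proof -
  obtain Q c where Q: "partition_on V Q" "\<forall>C\<in>Q. cycle_graph k C (c C)" "F = (\<Union>C\<in>Q. c C)"
    using assms unfolding factor_def by auto
  then show ?thesis
    using cycle_graph_edges unfolding complete_edges_def partition_on_def by fastforce
qed

lemma factor_cycle_factor:
  assumes "factor k V F" shows "cycle_factor k V (complete_edges V) F"
proof -
  obtain Q c where Q: "partition_on V Q" and c: "\<And>C. C \<in> Q \<Longrightarrow> cycle_graph k C (c C)"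
    and F: "F = (\<Union>C\<in>Q. c C)"
    using assms unfolding factor_def by auto
  have "vertex_degree F v = 2" if v: "v \<in> V" for v
  proof -
    obtain C where C: "C \<in> Q" "v \<in> C" using Q v unfolding partition_on_def by auto
    have "{e \<in> F. v \<in> e} = {e \<in> c C. v \<in> e}"
    proof -
      have "e \<in> c C" if "C' \<in> Q" "e \<in> c C'" "v \<in> e" for e C'
      proof -
        have "v \<in> C'" using cycle_graph_edges[OF c[OF that(1)]] that unfolding complete_edges_def by auto
        then show ?thesis using partition_on_eqI[OF Q C(1) that(1) C(2)] that(2) by simp
      qed
      then show ?thesis using F C by blast
    qed
    then show ?thesis using cycle_graph_degree[OF c[OF C(1)] C(2)] unfolding vertex_degree_def by simp
  qed
  then show ?thesis
    using factor_edges[OF assms] factor_components[OF Q c F] c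
    unfolding cycle_factor_def two_factor_def by auto
qed

text \<open>Reachability classes partition \<open>V\<close>, and each carries a cycle through
  \<open>k\<close> vertices. The necessity of 3 and 7 dividing the order rests on this.\<close>

lemma cycle_factor_dvd:
  assumes "cycle_factor k V E F" "finite V"
  shows "k dvd card V"
proof -
  let ?r = "connected_rel V F"
  have sy: "sym {(x, y). {x, y} \<in> F}" by (auto simp: sym_def insert_commute)
  have eq: "equiv V ?r"
    unfolding equiv_def refl_on_def sym_def trans_def connected_rel_def
    using sym_rtrancl[OF sy] by (auto simp: sym_def)
  have "card C = k" if "C \<in> V // ?r" for C
  proof -
    have "(C, {e \<in> F. e \<subseteq> C}) \<in> graph_components V F" using that unfolding graph_components_def by auto
    then have "cycle_graph k C {e \<in> F. e \<subseteq> C}" using assms(1) unfolding cycle_factor_def by auto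
    then show ?thesis by (rule cycle_graph_card)
  qed
  then show ?thesis
    using equiv_imp_dvd_card[OF assms(2) eq, of k] by simp
qed

lemma cycle_factor_length_unique:
  assumes "cycle_factor k V E F" "cycle_factor l V E F" "V \<noteq> {}"
  shows "k = l"
proof -
  obtain C where "C \<in> V // connected_rel V F" using assms(3) unfolding quotient_def by auto
  then have "(C, {e \<in> F. e \<subseteq> C}) \<in> graph_components V F" unfolding graph_components_def by auto
  then have "cycle_graph k C {e \<in> F. e \<subseteq> C}" "cycle_graph l C {e \<in> F. e \<subseteq> C}"
    using assms(1,2) unfolding cycle_factor_def by auto
  then show ?thesis using cycle_graph_card by metis
qed

lemma factor_nonempty: "factor k V F \<Longrightarrow> V \<noteq> {} \<Longrightarrow> F \<noteq> {}"
proof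
  assume h: "factor k V F" "V \<noteq> {}" "F = {}"
  then obtain v where "v \<in> V" by auto
  then show False using factor_cycle_factor[OF h(1)] h(3)
    unfolding cycle_factor_def two_factor_def vertex_degree_def by auto
qed

section \<open>Transport of factors along injections and disjoint unions\<close>

lemma cycle_graph_image:
  assumes "cycle_graph k C D" "inj_on g C"
  shows "cycle_graph k (g ` C) ((`) g ` D)"
proof -
  obtain f where k: "3 \<le> k" and f: "bij_betw f {..<k} C"
    and D: "D = {{f i, f (Suc i mod k)} | i. i < k}"
    using assms unfolding cycle_graph_def by auto
  have "bij_betw (g \<circ> f) {..<k} (g ` C)"
    using f assms(2) by (simp add: bij_betw_trans inj_on_imp_bij_betw)
  moreover have "(`) g ` D = {{(g \<circ> f) i, (g \<circ> f) (Suc i mod k)} | i. i < k}"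
    unfolding D by (auto simp: image_iff) (metis image_empty image_insert)
  ultimately show ?thesis using k unfolding cycle_graph_def by blast
qed

lemma factor_image:
  assumes "factor k V F" "inj_on g V"
  shows "factor k (g ` V) ((`) g ` F)"
proof -
  obtain Q c where Q: "partition_on V Q" and c: "\<And>C. C \<in> Q \<Longrightarrow> cycle_graph k C (c C)"
    and F: "F = (\<Union>C\<in>Q. c C)"
    using assms unfolding factor_def by auto
  have sub: "C \<subseteq> V" if "C \<in> Q" for C using Q that unfolding partition_on_def by auto
  \<comment> \<open>The cycle on an image set is found by pulling the set back into
    \<open>V\<close>, where \<open>g\<close> is injective.\<close>
  define c' where "c' C' = (`) g ` (c (V \<inter> g -` C'))" for C'
  have c': "c' (g ` C) = (`) g ` c C" if "C \<in> Q" for C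
  proof -
    have "V \<inter> g -` (g ` C) = C" using sub[OF that] assms(2) unfolding inj_on_def by auto
    then show ?thesis unfolding c'_def by simp
  qed
  have "partition_on (g ` V) ((`) g ` Q)"
  proof -
    have "{} \<notin> (`) g ` Q" using partition_onD3[OF Q] by auto
    then show ?thesis using partition_on_inj_image[OF Q assms(2)] by simp
  qed
  moreover have "\<forall>C\<in>(`) g ` Q. cycle_graph k C (c' C)"
    using c c' cycle_graph_image inj_on_subset[OF assms(2) sub] by fastforce
  moreover have "(`) g ` F = (\<Union>C\<in>(`) g ` Q. c' C)"
    unfolding F using c' by auto
  ultimately show ?thesis by (rule factorI)
qed

lemma factor_disjoint_union:
  assumes Vs: "partition_on V \<V>" and f: "\<And>U. U \<in> \<V> \<Longrightarrow> factor k U (F U)"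
  shows "factor k V (\<Union>U\<in>\<V>. F U)"
proof -
  have "\<forall>U\<in>\<V>. \<exists>Q c. partition_on U Q \<and> (\<forall>C\<in>Q. cycle_graph k C (c C)) \<and> F U = (\<Union>C\<in>Q. c C)"
    using f unfolding factor_def by auto
  then obtain Q c where Q: "\<And>U. U \<in> \<V> \<Longrightarrow> partition_on U (Q U)"
    and c: "\<And>U C. U \<in> \<V> \<Longrightarrow> C \<in> Q U \<Longrightarrow> cycle_graph k C (c U C)"
    and F: "\<And>U. U \<in> \<V> \<Longrightarrow> F U = (\<Union>C\<in>Q U. c U C)"
    by metis
  have un: "U = U'" if "U \<in> \<V>" "U' \<in> \<V>" "C \<in> Q U" "C \<in> Q U'" for U U' C
  proof -
    have "C \<noteq> {}" "C \<subseteq> U" "C \<subseteq> U'" using Q that unfolding partition_on_def by auto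
    then show ?thesis using partition_on_eqI[OF Vs that(1,2)] by auto
  qed
  \<comment> \<open>The description is proper: \<open>C\<close> is nonempty, so it lies in only one
    part \<open>U\<close>.\<close>
  define c' where "c' C = c (THE U. U \<in> \<V> \<and> C \<in> Q U) C" for C
  have c': "c' C = c U C" if "U \<in> \<V>" "C \<in> Q U" for U C
  proof -
    have "(THE U. U \<in> \<V> \<and> C \<in> Q U) = U" by (rule the_equality) (use un that in auto)
    then show ?thesis unfolding c'_def by simp
  qed
  have "partition_on V (\<Union>U\<in>\<V>. Q U)"
    unfolding partition_on_def
  proof (intro conjI)
    show "\<Union> (\<Union>U\<in>\<V>. Q U) = V" using Vs Q unfolding partition_on_def by fastforce
    show "{} \<notin> (\<Union>U\<in>\<V>. Q U)" using Q unfolding partition_on_def by auto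
    show "disjoint (\<Union>U\<in>\<V>. Q U)"
    proof (rule disjointI)
      fix A B assume h: "A \<in> (\<Union>U\<in>\<V>. Q U)" "B \<in> (\<Union>U\<in>\<V>. Q U)" "A \<noteq> B"
      then obtain U U' where U: "U \<in> \<V>" "A \<in> Q U" "U' \<in> \<V>" "B \<in> Q U'" by auto
      show "A \<inter> B = {}"
      proof (cases "U = U'")
        case True then show ?thesis using Q U h unfolding partition_on_def disjoint_def by metis
      next
        case False
        then have "U \<inter> U' = {}" using Vs U unfolding partition_on_def disjoint_def by auto
        moreover have "A \<subseteq> U" "B \<subseteq> U'" using Q U unfolding partition_on_def by auto
        ultimately show ?thesis by auto
      qed
    qed
  qed
  moreover have "\<forall>C\<in>(\<Union>U\<in>\<V>. Q U). cycle_graph k C (c' C)"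
  proof
    fix C assume "C \<in> (\<Union>U\<in>\<V>. Q U)"
    then obtain U where "U \<in> \<V>" "C \<in> Q U" by auto
    then show "cycle_graph k C (c' C)" using c[of U C] c'[of U C] by simp
  qed
  moreover have "(\<Union>U\<in>\<V>. F U) = (\<Union>C\<in>(\<Union>U\<in>\<V>. Q U). c' C)"
  proof -
    have "F U = (\<Union>C\<in>Q U. c' C)" if "U \<in> \<V>" for U
      unfolding F[OF that] by (rule SUP_cong[OF refl]) (rule c'[OF that, symmetric])
    then have "(\<Union>U\<in>\<V>. F U) = (\<Union>U\<in>\<V>. \<Union>C\<in>Q U. c' C)" by (rule SUP_cong[OF refl])
    then show ?thesis by (simp only: UN_UN_flatten)
  qed
  ultimately show ?thesis by (rule factorI)
qed

section \<open>Decompositions into triangle and heptagon factors\<close>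

text \<open>Factors are peeled off one at a time, triangle factors before heptagon factors. Passing
  to \<open>E - F\<close> builds disjointness into the recursion, so decompositions can be combined
  without handling families of edge sets.\<close>

fun hw :: "'a set \<Rightarrow> 'a set set \<Rightarrow> nat \<Rightarrow> nat \<Rightarrow> bool" where
  "hw V E 0 0 \<longleftrightarrow> E = {}"
| "hw V E 0 (Suc s) \<longleftrightarrow> (\<exists>F\<subseteq>E. factor 7 V F \<and> hw V (E - F) 0 s)"
| "hw V E (Suc r) s \<longleftrightarrow> (\<exists>F\<subseteq>E. factor 3 V F \<and> hw V (E - F) r s)"

lemma hw_add_triangles:
  assumes "hw V E r s" "factor 3 V F" "F \<inter> E = {}"
  shows "hw V (F \<union> E) (Suc r) s"
proof -
  have "F \<union> E - F = E" using assms(3) by auto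
  then show ?thesis using assms by auto
qed

text \<open>A heptagon factor is peeled only after all triangle factors, so it has to be carried
  below them; hence the induction on \<open>r\<close>.\<close>

lemma hw_add_heptagons:
  assumes "hw V E r s" "factor 7 V F" "F \<inter> E = {}"
  shows "hw V (F \<union> E) r (Suc s)"
  using assms
proof (induction r arbitrary: E)
  case 0
  then have "F \<union> E - F = E" by auto
  then show ?case using 0 by auto
next
  case (Suc r)
  then obtain G where G: "G \<subseteq> E" "factor 3 V G" "hw V (E - G) r s" by auto
  have "hw V (F \<union> (E - G)) r (Suc s)" using Suc.IH[OF G(3)] Suc.prems by auto
  moreover have "F \<union> E - G = F \<union> (E - G)" using G Suc.prems by auto
  ultimately show ?case using G by auto
qed

lemma hw_union:
  assumes "hw V E r s" "hw V E' r' s'" "E \<inter> E' = {}"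
  shows "hw V (E \<union> E') (r + r') (s + s')"
  using assms
proof (induction V E r s rule: hw.induct)
  case (1 V E)
  then show ?case by simp
next
  case (2 V E s)
  then obtain F where F: "F \<subseteq> E" "factor 7 V F" "hw V (E - F) 0 s" by auto
  then have "hw V ((E - F) \<union> E') (0 + r') (s + s')" using 2 by auto
  then have "hw V (F \<union> ((E - F) \<union> E')) (0 + r') (Suc (s + s'))"
    by (rule hw_add_heptagons) (use F 2 in auto)
  moreover have "F \<union> ((E - F) \<union> E') = E \<union> E'" using F by auto
  ultimately show ?case by simp
next
  case (3 V E r s)
  then obtain F where F: "F \<subseteq> E" "factor 3 V F" "hw V (E - F) r s" by auto
  then have "hw V ((E - F) \<union> E') (r + r') (s + s')" using 3 by auto
  then have "hw V (F \<union> ((E - F) \<union> E')) (Suc (r + r')) (s + s')"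
    by (rule hw_add_triangles) (use F 3 in auto)
  moreover have "F \<union> ((E - F) \<union> E') = E \<union> E'" using F by auto
  ultimately show ?case by simp
qed

lemma hw_edges: "hw V E r s \<Longrightarrow> E \<subseteq> complete_edges V"
proof (induction V E r s rule: hw.induct)
  case (1 V E)
  then show ?case by simp
next
  case (2 V E s)
  then obtain F where F: "F \<subseteq> E" "factor 7 V F" "hw V (E - F) 0 s" by auto
  then show ?case using "2.IH"[OF F(3)] factor_edges[OF F(2)] by blast
next
  case (3 V E r s)
  then obtain F where F: "F \<subseteq> E" "factor 3 V F" "hw V (E - F) r s" by auto
  then show ?case using "3.IH"[OF F(3)] factor_edges[OF F(2)] by blast
qed

lemma hw_image:
  assumes "hw V E r s" "inj_on g V"
  shows "hw (g ` V) ((`) g ` E) r s"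
  using assms
proof (induction V E r s rule: hw.induct)
  case (1 V E)
  then show ?case by simp
next
  case (2 V E s)
  then obtain F where F: "F \<subseteq> E" "factor 7 V F" "hw V (E - F) 0 s" by auto
  have "E \<subseteq> Pow V" using hw_edges[OF "2.prems"(1)] unfolding complete_edges_def by auto
  then have "(`) g ` (E - F) = (`) g ` E - (`) g ` F"
    by (intro inj_on_image_set_diff[OF inj_on_image_Pow[OF "2.prems"(2)]]) (use F(1) in auto)
  then show ?case using F "2.IH"[OF F(3) "2.prems"(2)] factor_image[OF F(2) "2.prems"(2)]
    by (auto intro!: exI[of _ "(`) g ` F"])
next
  case (3 V E r s)
  then obtain F where F: "F \<subseteq> E" "factor 3 V F" "hw V (E - F) r s" by auto
  have "E \<subseteq> Pow V" using hw_edges[OF "3.prems"(1)] unfolding complete_edges_def by auto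
  then have "(`) g ` (E - F) = (`) g ` E - (`) g ` F"
    by (intro inj_on_image_set_diff[OF inj_on_image_Pow[OF "3.prems"(2)]]) (use F(1) in auto)
  then show ?case using F "3.IH"[OF F(3) "3.prems"(2)] factor_image[OF F(2) "3.prems"(2)]
    by (auto intro!: exI[of _ "(`) g ` F"])
qed

lemma complete_edges_disjoint: "U \<inter> U' = {} \<Longrightarrow> complete_edges U \<inter> complete_edges U' = {}"
  unfolding complete_edges_def by (auto simp: card_2_iff)

lemma UN_diff_family:
  assumes "\<And>U U'. U \<in> \<V> \<Longrightarrow> U' \<in> \<V> \<Longrightarrow> U \<noteq> U' \<Longrightarrow> E U \<inter> E U' = {}"
    and "\<And>U. U \<in> \<V> \<Longrightarrow> F U \<subseteq> E U"
  shows "(\<Union>U\<in>\<V>. E U) - (\<Union>U\<in>\<V>. F U) = (\<Union>U\<in>\<V>. E U - F U)"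
  using assms by (auto simp: disjoint_iff) (metis subsetD)

text \<open>Corresponding factors of the parts are glued into one factor of \<open>V\<close>; this
  is why all parts must share the same \<open>r\<close> and \<open>s\<close>.\<close>

lemma hw_disjoint_union:
  assumes "partition_on V \<V>" and "\<And>U. U \<in> \<V> \<Longrightarrow> hw U (E U) r s"
  shows "hw V (\<Union>U\<in>\<V>. E U) r s"
proof -
  have dis: "E U \<inter> E U' = {}" if "U \<in> \<V>" "U' \<in> \<V>" "U \<noteq> U'" "\<And>U. U \<in> \<V> \<Longrightarrow> hw U (E U) r s"
    for U U' and E :: "'a set \<Rightarrow> 'a set set" and r s
  proof -
    have "U \<inter> U' = {}" using assms(1) that unfolding partition_on_def disjoint_def by auto
    then show ?thesis
      using complete_edges_disjoint[of U U'] hw_edges[OF that(4)[OF that(1)]] hw_edges[OF that(4)[OF that(2)]]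
      by blast
  qed
  have base: "hw V (\<Union>U\<in>\<V>. E U) 0 s" if "\<And>U. U \<in> \<V> \<Longrightarrow> hw U (E U) 0 s" for E
    using that
  proof (induction s arbitrary: E)
    case (Suc s)
    then have "\<forall>U\<in>\<V>. \<exists>F\<subseteq>E U. factor 7 U F \<and> hw U (E U - F) 0 s" by simp
    then obtain F where F: "\<And>U. U \<in> \<V> \<Longrightarrow> F U \<subseteq> E U \<and> factor 7 U (F U) \<and> hw U (E U - F U) 0 s" by metis
    have "hw V (\<Union>U\<in>\<V>. E U - F U) 0 s" using Suc.IH[of "\<lambda>U. E U - F U"] F by simp
    moreover have "(\<Union>U\<in>\<V>. E U) - (\<Union>U\<in>\<V>. F U) = (\<Union>U\<in>\<V>. E U - F U)"
      by (rule UN_diff_family) (use dis[of _ _ E, OF _ _ _ Suc.prems] F in auto)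
    moreover have "factor 7 V (\<Union>U\<in>\<V>. F U)" using factor_disjoint_union[OF assms(1)] F by simp
    moreover have "(\<Union>U\<in>\<V>. F U) \<subseteq> (\<Union>U\<in>\<V>. E U)" using F by fastforce
    ultimately show ?case by (simp only: hw.simps) metis
  qed simp
  show ?thesis using assms(2)
  proof (induction r arbitrary: E)
    case (Suc r)
    then have "\<forall>U\<in>\<V>. \<exists>F\<subseteq>E U. factor 3 U F \<and> hw U (E U - F) r s" by simp
    then obtain F where F: "\<And>U. U \<in> \<V> \<Longrightarrow> F U \<subseteq> E U \<and> factor 3 U (F U) \<and> hw U (E U - F U) r s" by metis
    have "hw V (\<Union>U\<in>\<V>. E U - F U) r s" using Suc.IH[of "\<lambda>U. E U - F U"] F by simp
    moreover have "(\<Union>U\<in>\<V>. E U) - (\<Union>U\<in>\<V>. F U) = (\<Union>U\<in>\<V>. E U - F U)"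
      by (rule UN_diff_family) (use dis[of _ _ E, OF _ _ _ Suc.prems] F in auto)
    moreover have "factor 3 V (\<Union>U\<in>\<V>. F U)" using factor_disjoint_union[OF assms(1)] F by simp
    moreover have "(\<Union>U\<in>\<V>. F U) \<subseteq> (\<Union>U\<in>\<V>. E U)" using F by fastforce
    ultimately show ?case by (simp only: hw.simps) metis
  qed (use base in blast)
qed

text \<open>The cardinalities come out right because factors of a nonempty vertex set are nonempty:
  a factor disjoint from all later ones is then different from them.\<close>

lemma hw_families:
  assumes "hw V E r s" "V \<noteq> {}"
  shows "\<exists>A B. finite A \<and> finite B \<and> card A = r \<and> card B = s \<and> partition_on E (A \<union> B) \<and>
    (\<forall>F\<in>A. factor 3 V F) \<and> (\<forall>F\<in>B. factor 7 V F)"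
  using assms
proof (induction V E r s rule: hw.induct)
  case (1 V E)
  then have "partition_on E ({} \<union> {})" by (simp add: partition_on_def)
  then show ?case by (intro exI[of _ "{}"]) auto
next
  case (2 V E s)
  then obtain F where F: "F \<subseteq> E" "factor 7 V F" "hw V (E - F) 0 s" by auto
  then obtain A B where AB: "finite A" "finite B" "card A = 0" "card B = s" "partition_on (E - F) (A \<union> B)"
    "\<forall>F\<in>A. factor 3 V F" "\<forall>F\<in>B. factor 7 V F" using "2.IH" "2.prems"(2) by meson
  have ne: "F \<noteq> {}" using factor_nonempty[OF F(2) "2.prems"(2)] .
  have "\<Union> (A \<union> B) = E - F" using AB(5) unfolding partition_on_def by simp
  then have "F \<notin> A \<union> B" "disjnt F (\<Union> (A \<union> B))" using ne by (auto simp: disjnt_def)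
  then have "partition_on E (A \<union> insert F B)" "card (insert F B) = Suc s"
    using AB partition_on_insert[of F "A \<union> B" E] ne F(1) by auto
  then show ?case using AB F by (intro exI[of _ A] exI[of _ "insert F B"]) auto
next
  case (3 V E r s)
  then obtain F where F: "F \<subseteq> E" "factor 3 V F" "hw V (E - F) r s" by auto
  then obtain A B where AB: "finite A" "finite B" "card A = r" "card B = s" "partition_on (E - F) (A \<union> B)"
    "\<forall>F\<in>A. factor 3 V F" "\<forall>F\<in>B. factor 7 V F" using "3.IH" "3.prems"(2) by meson
  have ne: "F \<noteq> {}" using factor_nonempty[OF F(2) "3.prems"(2)] .
  have "\<Union> (A \<union> B) = E - F" using AB(5) unfolding partition_on_def by simp
  then have "F \<notin> A \<union> B" "disjnt F (\<Union> (A \<union> B))" using ne by (auto simp: disjnt_def)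
  then have "partition_on E (insert F A \<union> B)" "card (insert F A) = Suc r"
    using AB partition_on_insert[of F "A \<union> B" E] ne F(1) by auto
  then show ?case using AB F by (intro exI[of _ "insert F A"] exI[of _ B]) auto
qed

declare hw.simps(2,3) [simp del]

lemma hw_HW:
  assumes "hw {..<n} (complete_edges {..<n}) r s" "odd n" "r + s = (n - 1) div 2"
  shows "\<exists>P. HW n r s 3 7 P"
proof -
  let ?V = "{..<n}" let ?E = "complete_edges ?V"
  have ne: "?V \<noteq> {}" using assms(2) by (cases n) auto
  obtain A B where AB: "finite A" "finite B" "card A = r" "card B = s" "partition_on ?E (A \<union> B)"
    "\<forall>F\<in>A. factor 3 ?V F" "\<forall>F\<in>B. factor 7 ?V F" using hw_families[OF assms(1) ne] by auto
  have A: "cycle_factor 3 ?V ?E F" if "F \<in> A" for F using AB(6) that factor_cycle_factor by blast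
  have B: "cycle_factor 7 ?V ?E F" if "F \<in> B" for F using AB(7) that factor_cycle_factor by blast
  \<comment> \<open>No factor is counted twice, so the two selections in \<open>HW\<close> return
    exactly \<open>A\<close> and \<open>B\<close>.\<close>
  have "\<not> (cycle_factor 3 ?V ?E F \<and> cycle_factor 7 ?V ?E F)" for F
    using cycle_factor_length_unique[of 3 ?V ?E F 7] ne by auto
  then have sets: "{F \<in> A \<union> B. cycle_factor 3 ?V ?E F} = A" "{F \<in> A \<union> B. cycle_factor 7 ?V ?E F} = B"
    "A \<inter> B = {}" using A B by auto
  have "HW n r s 3 7 (A \<union> B)"
    unfolding HW_def two_factorization_def sets(1,2)
    using assms AB A B sets(3) by (auto simp: cycle_factor_def card_Un_disjoint)
  then show ?thesis ..
qed

section \<open>Factors given by lists\<close>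

lemma factor_empty: "factor k {} {}"
  by (rule factorI[where Q="{}" and c="\<lambda>_. {}"]) (auto simp: partition_on_def)

lemma factor_insert:
  assumes "factor k V F" "cycle_graph k C D" "C \<inter> V = {}"
  shows "factor k (C \<union> V) (D \<union> F)"
proof -
  obtain Q c where Q: "partition_on V Q" and c: "\<forall>C\<in>Q. cycle_graph k C (c C)"
    and F: "F = (\<Union>C\<in>Q. c C)"
    using assms unfolding factor_def by auto
  have ne: "C \<noteq> {}" using cycle_graph_card[OF assms(2)] assms(2) unfolding cycle_graph_def by auto
  then have nin: "C \<notin> Q" using Q assms(3) unfolding partition_on_def by auto
  have "disjnt C (\<Union>Q)" "C \<union> V - C = V" using Q assms(3) unfolding partition_on_def disjnt_def by auto
  then have "partition_on (C \<union> V) (insert C Q)" using Q ne by (simp add: partition_on_insert)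
  moreover have "\<forall>X\<in>insert C Q. cycle_graph k X ((c(C := D)) X)" using c assms(2) nin by auto
  moreover have "D \<union> F = (\<Union>X\<in>insert C Q. (c(C := D)) X)" using F nin by auto
  ultimately show ?thesis by (rule factorI)
qed

definition cycle_edges :: "'a list \<Rightarrow> 'a set set" where
  "cycle_edges xs = (\<lambda>(a, b). {a, b}) ` set (zip xs (rotate1 xs))"

lemma cycle_graph_list:
  assumes "distinct xs" "3 \<le> length xs"
  shows "cycle_graph (length xs) (set xs) (cycle_edges xs)"
  unfolding cycle_graph_def
proof (intro conjI exI)
  show "bij_betw ((!) xs) {..<length xs} (set xs)" by (rule bij_betw_nth) (use assms in auto)
  show "cycle_edges xs = {{xs ! i, xs ! (Suc i mod length xs)} | i. i < length xs}"
  proof -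
    have "set (zip xs (rotate1 xs)) = (\<lambda>i. (xs ! i, rotate1 xs ! i)) ` {..<length xs}"
      unfolding set_zip by auto
    then have "cycle_edges xs = (\<lambda>i. {xs ! i, rotate1 xs ! i}) ` {..<length xs}"
      unfolding cycle_edges_def by (simp add: image_image)
    also have "\<dots> = (\<lambda>i. {xs ! i, xs ! (Suc i mod length xs)}) ` {..<length xs}"
      by (intro image_cong refl) (simp add: nth_rotate1)
    finally show ?thesis by (auto simp: image_def)
  qed
qed (use assms in auto)

definition cycles_on :: "nat \<Rightarrow> 'a set \<Rightarrow> 'a list list \<Rightarrow> bool" where
  "cycles_on k V F \<longleftrightarrow> list_all (\<lambda>xs. length xs = k) F \<and> distinct (concat F) \<and> set (concat F) = V"

lemma factor_cycles_on:
  assumes "cycles_on k V F" "3 \<le> k"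
  shows "factor k V (\<Union>xs\<in>set F. cycle_edges xs)"
  using assms(1)
proof (induction F arbitrary: V)
  case Nil
  then show ?case by (simp add: cycles_on_def factor_empty)
next
  case (Cons xs F)
  then have "factor k (set (concat F)) (\<Union>xs\<in>set F. cycle_edges xs)" by (auto simp: cycles_on_def)
  moreover have "cycle_graph k (set xs) (cycle_edges xs)"
    using Cons.prems cycle_graph_list[of xs] assms(2) by (simp add: cycles_on_def)
  moreover have "set xs \<inter> set (concat F) = {}" "V = set xs \<union> set (concat F)"
    using Cons.prems by (auto simp: cycles_on_def)
  ultimately show ?case using factor_insert by fastforce
qed

text \<open>The edge \<open>{a, b}\<close> with \<open>a < b < 21\<close> is encoded as \<open>21 * a + b\<close>, so that the disjointness of
  edge sets becomes distinctness of a list of numerals, which the simplifier decides quickly.\<close>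

definition cycle_codes :: "nat list \<Rightarrow> nat list" where
  "cycle_codes xs = map (\<lambda>(a, b). if a < b then 21 * a + b else 21 * b + a) (zip xs (rotate1 xs))"

definition edge_of_code :: "nat \<Rightarrow> nat set" where
  "edge_of_code c = {c div 21, c mod 21}"

definition factor_codes :: "nat list list \<Rightarrow> nat list" where
  "factor_codes F = concat (map cycle_codes F)"

lemma edge_of_code_less: "b < 21 \<Longrightarrow> edge_of_code (21 * a + b) = {a, b}"
  by (simp add: edge_of_code_def)

lemma edge_of_code_inj: "inj_on edge_of_code {c. c div 21 < c mod 21}"
proof (rule inj_onI)
  fix c d assume h: "c \<in> {c. c div 21 < c mod 21}" "d \<in> {c. c div 21 < c mod 21}"
    "edge_of_code c = edge_of_code d"
  then have "c div 21 = d div 21" "c mod 21 = d mod 21"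
    unfolding edge_of_code_def doubleton_eq_iff by auto
  then show "c = d" by (metis div_mult_mod_eq)
qed

lemma cycle_codes_edges:
  assumes "set xs \<subseteq> {..<21}"
  shows "edge_of_code ` set (cycle_codes xs) = cycle_edges xs"
proof -
  have "edge_of_code (if a < b then 21 * a + b else 21 * b + a) = {a, b}"
    if "(a, b) \<in> set (zip xs (rotate1 xs))" for a b
  proof -
    have "a < 21" "b < 21" using set_zip_leftD[OF that] set_zip_rightD[OF that] assms by auto
    then show ?thesis using edge_of_code_less[of a b] edge_of_code_less[of b a] by auto
  qed
  then show ?thesis unfolding cycle_codes_def cycle_edges_def set_map image_image
    by (intro image_cong) auto
qed

lemma factor_codes_edges:
  assumes "cycles_on k {..<21} F"
  shows "edge_of_code ` set (factor_codes F) = (\<Union>xs\<in>set F. cycle_edges xs)"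
proof -
  have "set xs \<subseteq> {..<21}" if "xs \<in> set F" for xs using assms that by (auto simp: cycles_on_def)
  then show ?thesis unfolding factor_codes_def using cycle_codes_edges by (auto simp: image_UN)
qed

lemma hw_lists:
  assumes "list_all (cycles_on 3 {..<21}) Ts" "list_all (cycles_on 7 {..<21}) Hs"
    and "distinct (concat (map factor_codes (Ts @ Hs)))"
    and "\<forall>c\<in>set (concat (map factor_codes (Ts @ Hs))). c div 21 < c mod 21"
  shows "hw {..<21} (edge_of_code ` set (concat (map factor_codes (Ts @ Hs)))) (length Ts) (length Hs)"
proof -
  have disj: "edge_of_code ` A \<inter> edge_of_code ` B = {}"
    if "A \<inter> B = {}" "\<forall>c\<in>A \<union> B. c div 21 < c mod 21" for A B
    using inj_on_image_Int[OF edge_of_code_inj, of A B] that by auto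
  have H: "hw {..<21} (edge_of_code ` set (concat (map factor_codes Hs))) 0 (length Hs)"
    if "list_all (cycles_on 7 {..<21}) Hs" "distinct (concat (map factor_codes Hs))"
    "\<forall>c\<in>set (concat (map factor_codes Hs)). c div 21 < c mod 21" for Hs
    using that
  proof (induction Hs)
    case (Cons F Hs)
    have "factor 7 {..<21} (edge_of_code ` set (factor_codes F))"
      using factor_cycles_on[of 7 "{..<21}" F] factor_codes_edges[of 7 F] Cons.prems by simp
    moreover have "edge_of_code ` set (factor_codes F) \<inter> edge_of_code ` set (concat (map factor_codes Hs)) = {}"
      by (rule disj) (use Cons.prems in auto)
    ultimately have "hw {..<21} (edge_of_code ` set (factor_codes F) \<union>
      edge_of_code ` set (concat (map factor_codes Hs))) 0 (Suc (length Hs))"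
      using Cons by (intro hw_add_heptagons) auto
    then show ?case by (simp add: image_Un image_UN)
  qed simp
  show ?thesis using assms(1,3,4)
  proof (induction Ts)
    case (Cons F Ts)
    have "factor 3 {..<21} (edge_of_code ` set (factor_codes F))"
      using factor_cycles_on[of 3 "{..<21}" F] factor_codes_edges[of 3 F] Cons.prems by simp
    moreover have "edge_of_code ` set (factor_codes F) \<inter>
        edge_of_code ` set (concat (map factor_codes (Ts @ Hs))) = {}"
      by (rule disj) (use Cons.prems in auto)
    ultimately have "hw {..<21} (edge_of_code ` set (factor_codes F) \<union>
      edge_of_code ` set (concat (map factor_codes (Ts @ Hs)))) (Suc (length Ts)) (length Hs)"
      using Cons by (intro hw_add_triangles) auto
    then show ?case by (simp add: image_Un image_UN)
  qed (use H[of Hs] assms(2) in simp)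
qed

text \<open>Distinct codes that all land in the target graph, in the same number as its edges,
  exhaust it. Thus only membership and a count are evaluated, and coverage of each edge need not be
  searched for.\<close>

lemma hw_lists_eq:
  assumes "list_all (cycles_on 3 {..<21}) Ts" "list_all (cycles_on 7 {..<21}) Hs"
    and "distinct (concat (map factor_codes (Ts @ Hs)))"
    and "list_all (\<lambda>c. c div 21 < c mod 21 \<and> P (c div 21) (c mod 21)) (concat (map factor_codes (Ts @ Hs)))"
    and "length (concat (map factor_codes (Ts @ Hs))) =
      length (concat (map (\<lambda>a. map (\<lambda>b. (a, b)) (filter (P a) [Suc a..<21])) [0..<21]))"
  shows "hw {..<21} {{a, b} | a b. a < b \<and> b < 21 \<and> P a b} (length Ts) (length Hs)"
proof -
  let ?L = "concat (map factor_codes (Ts @ Hs))"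
  let ?M = "concat (map (\<lambda>a. map (\<lambda>b. (a, b)) (filter (P a) [Suc a..<21])) [0..<21])"
  let ?E = "{{a, b} | a b. a < b \<and> b < 21 \<and> P a b}"
  have "edge_of_code c \<in> ?E" if "c \<in> set ?L" for c
    using assms(4) that unfolding list_all_iff edge_of_code_def
    by (intro CollectI exI[of _ "c div 21"] exI[of _ "c mod 21"]) auto
  then have sub: "edge_of_code ` set ?L \<subseteq> ?E" by blast
  have inj: "inj_on edge_of_code (set ?L)"
    by (rule inj_on_subset[OF edge_of_code_inj]) (use assms(4) in \<open>auto simp: list_all_iff\<close>)
  have "?E \<subseteq> (\<lambda>(a, b). {a, b}) ` set ?M" by force
  then have "card ?E \<le> length ?M" "finite ?E"
    using card_length[of ?M] by (meson List.finite_set card_image_le card_mono finite_imageI le_trans, meson List.finite_set finite_imageI finite_subset)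
  moreover have "card (edge_of_code ` set ?L) = length ?M"
    using card_image[OF inj] distinct_card[OF assms(3)] assms(5) by simp
  ultimately have "edge_of_code ` set ?L = ?E" using card_seteq[of ?E "edge_of_code ` set ?L"] sub by simp
  moreover have "hw {..<21} (edge_of_code ` set ?L) (length Ts) (length Hs)"
    by (rule hw_lists) (use assms in \<open>auto simp: list_all_iff\<close>)
  ultimately show ?thesis by simp
qed

section \<open>Decompositions on 21 vertices\<close>

text \<open>The vertex \<open>v < 21\<close> stands for the residue \<open>v mod 7\<close> on the level \<open>v div 7\<close>.\<close>

abbreviation cross_edges :: "nat set set" where
  "cross_edges \<equiv> {{a, b} | a b. a < b \<and> b < 21 \<and> a div 7 \<noteq> b div 7}"

definition shift :: "nat \<Rightarrow> nat \<Rightarrow> nat" where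
  "shift t v = 7 * (v div 7) + (v mod 7 + t) mod 7"

text \<open>One base factor on all 21 vertices yields seven factors.\<close>

definition develop :: "nat list list \<Rightarrow> nat list list list" where
  "develop F = map (\<lambda>t. map (map (shift t)) F) [0..<7]"

text \<open>For a triple with one vertex on each level, the seven translates are disjoint and cover
  everything, so they form a single factor.\<close>

definition orbit :: "nat list \<Rightarrow> nat list list" where
  "orbit T = map (\<lambda>t. map (shift t) T) [0..<7]"

definition level_cycles :: "nat \<Rightarrow> nat \<Rightarrow> nat \<Rightarrow> nat list list" where
  "level_cycles d0 d1 d2 = map (\<lambda>(l, d). map (\<lambda>j. 7 * l + (j * d) mod 7) [0..<7]) [(0, d0), (1, d1), (2, d2)]"

text \<open>Both orientations of the Hamiltonian cycle with step \<open>d\<close> on the residues; an arc \<open>x \<rightarrow> y\<close> stands for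
  the edges from residue \<open>x\<close> on a level to residue \<open>y\<close> on the next one, so the levels along the cycle
  make five steps up and two steps down.\<close>

definition mixed_cycles :: "nat \<Rightarrow> nat list list list" where
  "mixed_cycles d = map (\<lambda>c. map (\<lambda>s. map (\<lambda>j. 7 * ((c * ([0, 1, 2, 0, 1, 2, 1] ! j) + s) mod 3) + (j * d) mod 7)
     [0..<7]) [0, 1, 2]) [1, 2]"

definition inner_heptagons :: "nat list list list" where
  "inner_heptagons = [level_cycles 1 1 1, level_cycles 2 2 2, level_cycles 3 3 3]"

text \<open>Going around a triple through levels 0, 1, 2 and back gives three residue differences
  with sum 0 modulo 7, and its orbit uses up each of them on its pair of levels. The triples for r =
  1, 3, 5 use the differences 0, then 0 and \<plusminus>1, then 0, \<plusminus>1 and \<plusminus>2,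
  once on every pair of levels. For r = 7 the differences are d, d and -2d, each running through all
  residues.\<close>

definition mixed_triangles :: "nat \<Rightarrow> nat list list list" where
  "mixed_triangles r =
    (if r = 1 then [orbit [0, 7, 14]]
     else if r = 3 then map orbit [[0, 7, 15], [0, 8, 14], [0, 13, 20]]
     else if r = 5 then map orbit [[0, 12, 19], [0, 13, 15], [0, 7, 20], [0, 8, 16], [0, 9, 14]]
     else if r = 7 then map (\<lambda>d. orbit [0, 7 + d, 14 + 2 * d mod 7]) [0..<7] else [])"

text \<open>For r = 1, 3, 5 the triangle orbits leave complete pairs \<plusminus>d of differences,
  and \<open>mixed_cycles d\<close> spends two heptagon factors on each; this forces the odd counts.
  The case r = 0 leaves the pattern and develops a base factor of three heptagons.\<close>

definition mixed_heptagons :: "nat \<Rightarrow> nat list list list" where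
  "mixed_heptagons r =
    (if r = 0 then develop [[0, 14, 2, 15, 9, 6, 13], [1, 18, 7, 17, 10, 5, 16], [3, 12, 4, 8, 20, 11, 19]]
     else if r = 1 then concat (map mixed_cycles [1, 2, 3])
     else if r = 3 then concat (map mixed_cycles [2, 3])
     else if r = 5 then mixed_cycles 3 else [])"

text \<open>The base blocks below and those for \<open>r = 0\<close> above were found by computer search, prescribing the
  shift as an automorphism.\<close>

definition triangles8 :: "nat list list list" where
  "triangles8 = develop [[0, 1, 11], [2, 7, 20], [3, 9, 17], [4, 16, 19], [5, 13, 18], [6, 8, 15], [10, 12, 14]]
     @ [orbit [0, 7, 17]]"

definition heptagons8 :: "nat list list list" where
  "heptagons8 = [level_cycles 2 3 2, level_cycles 3 1 1]"

definition triangles9 :: "nat list list list" where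
  "triangles9 = develop [[0, 6, 19], [1, 4, 9], [2, 8, 13], [3, 12, 17], [5, 15, 16], [7, 14, 18], [10, 11, 20]]
     @ map orbit [[0, 10, 16], [0, 7, 15]]"

definition heptagons9 :: "nat list list list" where
  "heptagons9 = [level_cycles 2 3 2]"

definition triangles10 :: "nat list list list" where
  "triangles10 = develop [[0, 7, 14], [1, 2, 4], [8, 9, 11], [15, 16, 18], [6, 12, 17], [5, 10, 20], [3, 13, 19]]
     @ map orbit [[1, 9, 18], [2, 11, 15], [4, 8, 16]]"

text \<open>Sorting to \<open>[0..<21]\<close> expresses distinctness and coverage at once, in a
  form that the simplifier can evaluate.\<close>

lemma cycles_on_21:
  "cycles_on k {..<21::nat} F \<longleftrightarrow> list_all (\<lambda>xs. length xs = k) F \<and> sort (concat F) = [0..<21]"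
proof
  assume h: "cycles_on k {..<21::nat} F"
  then have "distinct (concat F)" "set (concat F) = set [0..<21]" by (auto simp: cycles_on_def)
  then have "sort (concat F) = [0..<21]" by (intro sorted_distinct_set_unique) auto
  then show "list_all (\<lambda>xs. length xs = k) F \<and> sort (concat F) = [0..<21]"
    using h by (simp add: cycles_on_def)
next
  assume h: "list_all (\<lambda>xs. length xs = k) F \<and> sort (concat F) = [0..<21]"
  then have "distinct (concat F)" "set (concat F) = {..<21::nat}"
    by (metis distinct_sort distinct_upt, metis set_sort set_upt atLeast_upt)
  then show "cycles_on k {..<21::nat} F" using h by (simp add: cycles_on_def)
qed

lemmas list_data = shift_def develop_def orbit_def level_cycles_def mixed_cycles_def inner_heptagons_def
  mixed_triangles_def mixed_heptagons_def triangles8_def triangles9_def triangles10_def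
  heptagons8_def heptagons9_def cycle_codes_def factor_codes_def upt_rec

lemma hw_mixed:
  assumes "r \<in> {0, 1, 3, 5, 7}"
  shows "hw {..<21::nat} cross_edges r (7 - r)"
proof -
  have len: "length (mixed_triangles r) = r" "length (mixed_heptagons r) = 7 - r"
    using assms by (auto simp: list_data)
  have h0: "hw {..<21::nat} cross_edges
      (length (mixed_triangles 0)) (length (mixed_heptagons 0))"
    by (rule hw_lists_eq[where P="\<lambda>a b. a div 7 \<noteq> b div 7"]; simp add: list_data cycles_on_21)
  have h1: "hw {..<21::nat} cross_edges
      (length (mixed_triangles 1)) (length (mixed_heptagons 1))"
    by (rule hw_lists_eq[where P="\<lambda>a b. a div 7 \<noteq> b div 7"]; simp add: list_data cycles_on_21)
  have h3: "hw {..<21::nat} cross_edges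
      (length (mixed_triangles 3)) (length (mixed_heptagons 3))"
    by (rule hw_lists_eq[where P="\<lambda>a b. a div 7 \<noteq> b div 7"]; simp add: list_data cycles_on_21)
  have h5: "hw {..<21::nat} cross_edges
      (length (mixed_triangles 5)) (length (mixed_heptagons 5))"
    by (rule hw_lists_eq[where P="\<lambda>a b. a div 7 \<noteq> b div 7"]; simp add: list_data cycles_on_21)
  have h7: "hw {..<21::nat} cross_edges
      (length (mixed_triangles 7)) (length (mixed_heptagons 7))"
    by (rule hw_lists_eq[where P="\<lambda>a b. a div 7 \<noteq> b div 7"]; simp add: list_data cycles_on_21)
  have "hw {..<21::nat} cross_edges
      (length (mixed_triangles r)) (length (mixed_heptagons r))"
    using assms by (elim insertE emptyE) (simp_all only: h0 h1 h3 h5 h7)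
  then show ?thesis by (simp only: len)
qed

text \<open>The conjunct \<open>True\<close> gives the set the shape of \<open>hw_lists_eq\<close>
  with a constantly true \<open>P\<close>.\<close>

lemma complete_edges_nat: "complete_edges {..<n::nat} = {{a, b} | a b :: nat. a < b \<and> b < n \<and> True}"
proof -
  have "\<exists>a b. e = {a, b} \<and> a < b \<and> b < n" if "e \<subseteq> {..<n}" "card e = 2" for e
  proof -
    obtain x y where "e = {x, y}" "x \<noteq> y" using \<open>card e = 2\<close> by (auto simp: card_2_iff)
    then have "e = {min x y, max x y}" "min x y < max x y" by (auto simp: min_def max_def)
    moreover have "max x y < n" using that(1) \<open>e = {x, y}\<close> by auto
    ultimately show ?thesis by blast
  qed
  moreover have "{a, b} \<subseteq> {..<n} \<and> card {a, b} = 2" if "a < b" "b < n" for a b using that by auto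
  ultimately show ?thesis unfolding complete_edges_def by blast
qed

lemma hw_21_special:
  shows "hw {..<21::nat} (complete_edges {..<21::nat}) 8 2" "hw {..<21::nat} (complete_edges {..<21::nat}) 9 1"
    "hw {..<21::nat} (complete_edges {..<21::nat}) 10 0"
proof -
  have len: "length triangles8 = 8" "length heptagons8 = 2" "length triangles9 = 9" "length heptagons9 = 1"
    "length triangles10 = 10" by (simp_all add: list_data)
  have "hw {..<21::nat} (complete_edges {..<21::nat}) (length triangles8) (length heptagons8)"
    unfolding complete_edges_nat by (rule hw_lists_eq; simp add: list_data cycles_on_21)
  then show "hw {..<21::nat} (complete_edges {..<21::nat}) 8 2" by (simp only: len)
  have "hw {..<21::nat} (complete_edges {..<21::nat}) (length triangles9) (length heptagons9)"
    unfolding complete_edges_nat by (rule hw_lists_eq; simp add: list_data cycles_on_21)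
  then show "hw {..<21::nat} (complete_edges {..<21::nat}) 9 1" by (simp only: len)
  have "hw {..<21::nat} (complete_edges {..<21::nat}) (length triangles10) (length ([] :: nat list list list))"
    unfolding complete_edges_nat by (rule hw_lists_eq; simp add: list_data cycles_on_21)
  then show "hw {..<21::nat} (complete_edges {..<21::nat}) 10 0" by (simp only: len list.size)
qed

text \<open>Steps 1, 2, 3 represent the nonzero differences modulo 7 up to sign, and each runs
  through all of a level because 7 is prime.\<close>

lemma hw_inner: "hw {..<21::nat} {{a, b} | a b :: nat. a < b \<and> b < 21 \<and> a div 7 = b div 7} 0 3"
proof -
  have "hw {..<21::nat} {{a, b} | a b :: nat. a < b \<and> b < 21 \<and> a div 7 = b div 7}
      (length ([] :: nat list list list)) (length inner_heptagons)"
    by (rule hw_lists_eq; simp add: list_data cycles_on_21)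
  moreover have "length inner_heptagons = 3" by (simp add: inner_heptagons_def)
  ultimately show ?thesis by simp
qed

text \<open>Counts up to 7 come from the edges between levels, the three inner heptagon factors
  being added; 8, 9 and 10 need triangles that use edges inside the levels and have their own
  lists.\<close>

lemma hw_21:
  assumes "r \<in> {0, 1, 3, 5, 7, 8, 9, 10}"
  shows "hw {..<21::nat} (complete_edges {..<21::nat}) r (10 - r)"
proof -
  consider "r \<in> {0, 1, 3, 5, 7}" | "r \<in> {8, 9, 10}" using assms by blast
  then show ?thesis
  proof cases
    case 1
    let ?E1 = "cross_edges"
    let ?E2 = "{{a, b} | a b :: nat. a < b \<and> b < 21 \<and> a div 7 = b div 7}"
    have "?E1 \<inter> ?E2 = {}" by (auto simp: doubleton_eq_iff)
    then have "hw {..<21::nat} (?E1 \<union> ?E2) (r + 0) ((7 - r) + 3)"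
      by (rule hw_union[OF hw_mixed[OF 1] hw_inner])
    moreover have "?E1 \<union> ?E2 = complete_edges {..<21::nat}" unfolding complete_edges_nat by blast
    moreover have "(7 - r) + 3 = 10 - r" using 1 by auto
    ultimately show ?thesis by simp
  qed (use hw_21_special in auto)
qed

section \<open>Blowing up Kirkman triple systems by 7\<close>

definition triple_partition :: "'a set \<Rightarrow> 'a set set \<Rightarrow> bool" where
  "triple_partition X P \<longleftrightarrow> partition_on X P \<and> (\<forall>T\<in>P. card T = 3)"

text \<open>The index is the number of parallel classes, thus \<open>3 * t + 1\<close> for a system
  on \<open>6 * t + 3\<close> points.\<close>

definition kirkman :: "nat \<Rightarrow> 'a set \<Rightarrow> bool" where
  "kirkman r X \<longleftrightarrow> finite X \<and> card X = 2 * r + 1 \<and>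
    (\<exists>\<P>. finite \<P> \<and> card \<P> \<le> r \<and> (\<forall>P\<in>\<P>. triple_partition X P) \<and>
      (\<forall>x\<in>X. \<forall>y\<in>X. x \<noteq> y \<longrightarrow> (\<exists>P\<in>\<P>. \<exists>T\<in>P. x \<in> T \<and> y \<in> T)))"

text \<open>An overlap of two members would make the union smaller than the sum by at least the size
  of that overlap.\<close>

lemma sum_card_le_card_UN_disjoint:
  assumes "finite I" "\<And>i. i \<in> I \<Longrightarrow> finite (f i)" "(\<Sum>i\<in>I. card (f i)) \<le> card (\<Union>i\<in>I. f i)"
    and "i \<in> I" "j \<in> I" "i \<noteq> j"
  shows "f i \<inter> f j = {}"
proof -
  let ?J = "I - {i, j}"
  have I: "I = insert i (insert j ?J)" using assms(4,5) by auto
  have "(\<Sum>k\<in>I. card (f k)) = card (f i) + (card (f j) + (\<Sum>k\<in>?J. card (f k)))"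
    by (subst I) (use assms in \<open>simp add: sum.insert\<close>)
  moreover have "card (\<Union>k\<in>I. f k) \<le> card (f i \<union> f j) + (\<Sum>k\<in>?J. card (f k))"
  proof -
    have "(\<Union>k\<in>I. f k) = (f i \<union> f j) \<union> (\<Union>k\<in>?J. f k)" using I by auto
    then have "card (\<Union>k\<in>I. f k) \<le> card (f i \<union> f j) + card (\<Union>k\<in>?J. f k)"
      by (simp add: card_Un_le)
    moreover have "card (\<Union>k\<in>?J. f k) \<le> (\<Sum>k\<in>?J. card (f k))"
      using assms(1) by (intro card_UN_le) auto
    ultimately show ?thesis by linarith
  qed
  moreover have "card (f i) + card (f j) = card (f i \<union> f j) + card (f i \<inter> f j)"
    using assms by (intro card_Un_Int) auto
  ultimately have "card (f i \<inter> f j) = 0" using assms(3) by linarith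
  then show ?thesis using assms(2)[OF assms(4)] by simp
qed

lemma card_complete_edges: "finite V \<Longrightarrow> card (complete_edges V) = card V choose 2"
  unfolding complete_edges_def by (rule n_subsets)

lemma finite_complete_edges: "finite V \<Longrightarrow> finite (complete_edges V)"
  unfolding complete_edges_def by (rule finite_subset[of _ "Pow V"]) auto

lemma complete_edgesI: "x \<in> V \<Longrightarrow> y \<in> V \<Longrightarrow> x \<noteq> y \<Longrightarrow> {x, y} \<in> complete_edges V"
  unfolding complete_edges_def by auto

lemma complete_edgesE:
  assumes "e \<in> complete_edges V"
  obtains x y where "x \<in> V" "y \<in> V" "x \<noteq> y" "e = {x, y}"
  using assms unfolding complete_edges_def by (auto simp: card_2_iff)

text \<open>A triangle has as many edges as vertices.\<close>

lemma triple_partition_edges: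
  assumes "triple_partition X P" "finite X"
  shows "card (\<Union>T\<in>P. complete_edges T) = card X" "finite (\<Union>T\<in>P. complete_edges T)"
proof -
  have P: "partition_on X P" and c: "\<And>T. T \<in> P \<Longrightarrow> card T = 3"
    using assms unfolding triple_partition_def by auto
  have fP: "finite P" using finite_elements[OF assms(2) P] .
  have fT: "finite T" if "T \<in> P" for T using c[OF that] card.infinite by fastforce
  have "complete_edges T \<inter> complete_edges T' = {}" if "T \<in> P" "T' \<in> P" "T \<noteq> T'" for T T'
    using P that by (intro complete_edges_disjoint) (auto simp: partition_on_def disjoint_def)
  then have "card (\<Union>T\<in>P. complete_edges T) = (\<Sum>T\<in>P. card (complete_edges T))"
    using fP by (intro card_UN_disjoint) (simp_all add: fT finite_complete_edges)
  also have "\<dots> = (\<Sum>T\<in>P. card T)"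
    using c fT by (intro sum.cong) (simp_all add: card_complete_edges numeral_eq_Suc)
  also have "\<dots> = card X" using product_partition[OF P fT] by simp
  finally show "card (\<Union>T\<in>P. complete_edges T) = card X" .
  show "finite (\<Union>T\<in>P. complete_edges T)" using fP by (simp add: fT finite_complete_edges)
qed

text \<open>The definition only asks that at most \<open>r\<close> classes cover all pairs; counting edges turns this
  into exactly \<open>r\<close> classes covering each pair exactly once.\<close>

lemma kirkman_exact:
  assumes "kirkman r X"
  shows "\<exists>\<P>. finite \<P> \<and> card \<P> = r \<and> (\<forall>P\<in>\<P>. triple_partition X P) \<and>
    (\<forall>x\<in>X. \<forall>y\<in>X. x \<noteq> y \<longrightarrow> (\<exists>P\<in>\<P>. \<exists>T\<in>P. x \<in> T \<and> y \<in> T)) \<and>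
    (\<forall>P\<in>\<P>. \<forall>P'\<in>\<P>. \<forall>T\<in>P. \<forall>T'\<in>P'. \<forall>x\<in>T \<inter> T'. \<forall>y\<in>T \<inter> T'. x \<noteq> y \<longrightarrow> P = P')"
proof -
  obtain \<P> where \<P>: "finite X" "card X = 2 * r + 1" "finite \<P>" "card \<P> \<le> r"
    "\<And>P. P \<in> \<P> \<Longrightarrow> triple_partition X P"
    "\<And>x y. x \<in> X \<Longrightarrow> y \<in> X \<Longrightarrow> x \<noteq> y \<Longrightarrow> \<exists>P\<in>\<P>. \<exists>T\<in>P. x \<in> T \<and> y \<in> T"
    using assms unfolding kirkman_def by metis
  let ?f = "\<lambda>P. \<Union>T\<in>P. complete_edges T"
  have "complete_edges X \<subseteq> (\<Union>P\<in>\<P>. ?f P)"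
  proof
    fix e assume "e \<in> complete_edges X"
    then obtain x y where "x \<in> X" "y \<in> X" "x \<noteq> y" "e = {x, y}" by (rule complete_edgesE)
    moreover from this obtain P T where "P \<in> \<P>" "T \<in> P" "x \<in> T" "y \<in> T" using \<P>(6)[of x y] by blast
    ultimately show "e \<in> (\<Union>P\<in>\<P>. ?f P)" using complete_edgesI[of x T y] by blast
  qed
  then have "card (complete_edges X) \<le> card (\<Union>P\<in>\<P>. ?f P)"
    using \<P>(3,5) triple_partition_edges(2)[OF _ \<P>(1)] by (intro card_mono) auto
  moreover have "card (complete_edges X) = r * (2 * r + 1)"
    using \<P>(1,2) by (simp add: card_complete_edges choose_two)
  moreover have s: "(\<Sum>P\<in>\<P>. card (?f P)) = card \<P> * (2 * r + 1)"
    using triple_partition_edges(1)[OF \<P>(5) \<P>(1)] \<P>(2) by simp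
  moreover have "card (\<Union>P\<in>\<P>. ?f P) \<le> (\<Sum>P\<in>\<P>. card (?f P))" by (rule card_UN_le[OF \<P>(3)])
  ultimately have "r * (2 * r + 1) \<le> card \<P> * (2 * r + 1)"
    and cov: "r * (2 * r + 1) \<le> card (\<Union>P\<in>\<P>. ?f P)" by linarith+
  then have "r \<le> card \<P>" by (simp only: mult_le_cancel2)
  then have cr: "card \<P> = r" using \<P>(4) by simp
  then have sum_le: "(\<Sum>P\<in>\<P>. card (?f P)) \<le> card (\<Union>P\<in>\<P>. ?f P)" using cov s by simp
  have "P = P'" if "P \<in> \<P>" "P' \<in> \<P>" "T \<in> P" "T' \<in> P'" "x \<noteq> y" "x \<in> T" "y \<in> T" "x \<in> T'" "y \<in> T'"
    for P P' T T' x y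
  proof (rule ccontr)
    assume "P \<noteq> P'"
    then have "?f P \<inter> ?f P' = {}"
      by (intro sum_card_le_card_UN_disjoint[OF \<P>(3) _ sum_le that(1,2)]
          triple_partition_edges(2)[OF \<P>(5) \<P>(1)])
    moreover have "{x, y} \<in> ?f P" by (rule UN_I[OF that(3)]) (rule complete_edgesI[OF that(6,7,5)])
    moreover have "{x, y} \<in> ?f P'" by (rule UN_I[OF that(4)]) (rule complete_edgesI[OF that(8,9,5)])
    ultimately show False by blast
  qed
  then show ?thesis
    by (intro exI[of _ \<P>] conjI ballI impI \<P>(3,5,6) cr) (assumption | blast)+
qed

definition blow :: "'a set \<Rightarrow> ('a \<times> nat) set set" where
  "blow T = {{(x, i), (y, j)} | x y i j. x \<in> T \<and> y \<in> T \<and> x \<noteq> y \<and> i < 7 \<and> j < 7}"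

lemma complete_edges_image:
  assumes "inj_on g V"
  shows "(`) g ` complete_edges V = complete_edges (g ` V)"
proof
  show "(`) g ` complete_edges V \<subseteq> complete_edges (g ` V)"
    using assms unfolding complete_edges_def
    by (auto simp: card_image inj_on_subset)
  show "complete_edges (g ` V) \<subseteq> (`) g ` complete_edges V"
  proof
    fix e assume "e \<in> complete_edges (g ` V)"
    then obtain x y where "x \<in> V" "y \<in> V" "g x \<noteq> g y" "e = {g x, g y}" by (auto elim: complete_edgesE)
    then show "e \<in> (`) g ` complete_edges V"
      using complete_edgesI[of x V y] by (intro image_eqI[of _ _ "{x, y}"]) auto
  qed
qed

text \<open>The three levels become the three points of \<open>T\<close> and the residues the seven
  copies, which carries the lists on 21 vertices over to any triple.\<close>

lemma blow_coordinates:
  assumes "card T = 3"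
  obtains g :: "nat \<Rightarrow> 'a \<times> nat" where "inj_on g {..<21}" "g ` {..<21} = T \<times> {..<7}"
    "(`) g ` cross_edges = blow T"
proof -
  have "finite T" using assms card.infinite by fastforce
  then obtain h where h: "bij_betw h {..<3::nat} T"
    using ex_bij_betw_nat_finite[of T] assms by (auto simp: atLeast0LessThan)
  define g where "g v = (h (v div 7), v mod 7)" for v :: nat
  have hinj: "h a = h b \<longleftrightarrow> a = b" if "a < 3" "b < 3" for a b
    using h that unfolding bij_betw_def inj_on_def by auto
  have d: "v div 7 < 3" if "v < 21" for v :: nat using that by auto
  have inj: "inj_on g {..<21}"
  proof (rule inj_onI)
    fix a b assume "a \<in> {..<21::nat}" "b \<in> {..<21::nat}" "g a = g b"
    then have "a div 7 = b div 7" "a mod 7 = b mod 7" using hinj d unfolding g_def by auto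
    then show "a = b" by (metis div_mult_mod_eq)
  qed
  have pt: "\<exists>v<21. v div 7 = l \<and> v mod 7 = i" if "l < 3" "i < 7" for l i :: nat
    using that by (intro exI[of _ "7 * l + i"]) auto
  have hT: "h ` {..<3} = T" using h unfolding bij_betw_def by simp
  have img: "g ` {..<21} = T \<times> {..<7}"
  proof
    show "g ` {..<21} \<subseteq> T \<times> {..<7}" using d hT unfolding g_def by auto
    show "T \<times> {..<7} \<subseteq> g ` {..<21}"
    proof
      fix p assume "p \<in> T \<times> {..<7::nat}"
      then obtain l i where "p = (h l, i)" "l < 3" "i < 7" using hT by auto
      then show "p \<in> g ` {..<21}" using pt[of l i] unfolding g_def by (auto simp: image_iff)
    qed
  qed
  have "(`) g ` cross_edges = blow T"
  proof
    show "(`) g ` cross_edges \<subseteq> blow T"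
    proof
      fix e assume "e \<in> (`) g ` cross_edges"
      then obtain a b where ab: "e = {g a, g b}" "a < b" "b < 21" "a div 7 \<noteq> b div 7" by auto
      then have "h (a div 7) \<noteq> h (b div 7)" "h (a div 7) \<in> T" "h (b div 7) \<in> T"
        using hinj[of "a div 7" "b div 7"] hT d[of a] d[of b] by auto
      then show "e \<in> blow T" using ab(1) unfolding blow_def g_def
        by (intro CollectI exI[of _ "h (a div 7)"] exI[of _ "h (b div 7)"] exI[of _ "a mod 7"] exI[of _ "b mod 7"]) auto
    qed
    show "blow T \<subseteq> (`) g ` cross_edges"
    proof
      fix e assume "e \<in> blow T"
      then obtain x y i j where e: "e = {(x, i), (y, j)}" "x \<in> T" "y \<in> T" "x \<noteq> y" "i < 7" "j < 7"
        unfolding blow_def by auto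
      then obtain l l' where l: "x = h l" "y = h l'" "l < 3" "l' < 3" using hT by auto
      obtain a b where ab: "a < 21" "a div 7 = l" "a mod 7 = i" "b < 21" "b div 7 = l'" "b mod 7 = j"
        using pt[OF l(3) e(5)] pt[OF l(4) e(6)] by auto
      have "l \<noteq> l'" using e l by auto
      then have "a \<noteq> b" using ab by auto
      have e': "e = g ` {a, b}" using e l ab unfolding g_def by auto
      have "{a, b} \<in> cross_edges"
      proof (cases "a < b")
        case True
        then show ?thesis using ab \<open>l \<noteq> l'\<close> by (intro CollectI exI[of _ a] exI[of _ b]) auto
      next
        case False
        then have "b < a" using \<open>a \<noteq> b\<close> by simp
        then show ?thesis using ab \<open>l \<noteq> l'\<close> by (intro CollectI exI[of _ b] exI[of _ a]) auto
      qed
      then show "e \<in> (`) g ` cross_edges" using e' by blast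
    qed
  qed
  then show thesis using that inj img by blast
qed

lemma hw_blow:
  fixes T :: "'a set"
  assumes "card T = 3" "r \<in> {0, 1, 3, 5, 7}"
  shows "hw (T \<times> {..<7}) (blow T) r (7 - r)"
proof -
  obtain g :: "nat \<Rightarrow> 'a \<times> nat" where g: "inj_on g {..<21}" "g ` {..<21} = T \<times> {..<7}"
    "(`) g ` cross_edges = blow T"
    by (rule blow_coordinates[OF assms(1)])
  show ?thesis using hw_image[OF hw_mixed[OF assms(2)] g(1)] unfolding g(2,3) .
qed

lemma hw_fill:
  fixes T :: "'a set"
  assumes "card T = 3" "r \<in> {0, 1, 3, 5, 7, 8, 9, 10}"
  shows "hw (T \<times> {..<7::nat}) (complete_edges (T \<times> {..<7})) r (10 - r)"
proof -
  obtain g :: "nat \<Rightarrow> 'a \<times> nat" where g: "inj_on g {..<21}" "g ` {..<21} = T \<times> {..<7}"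
    "(`) g ` cross_edges = blow T"
    by (rule blow_coordinates[OF assms(1)])
  show ?thesis using hw_image[OF hw_21[OF assms(2)] g(1)] unfolding complete_edges_image[OF g(1)] g(2) .
qed

section \<open>Gluing decompositions over the triples of a class and over several classes\<close>

lemma partition_on_times:
  assumes "partition_on X P" "S \<noteq> {}"
  shows "partition_on (X \<times> S) ((\<lambda>T. T \<times> S) ` P)"
proof (rule partition_onI)
  show "\<Union> ((\<lambda>T. T \<times> S) ` P) = X \<times> S" using partition_onD1[OF assms(1)] by auto
  show "{} \<notin> (\<lambda>T. T \<times> S) ` P"
  proof
    assume "{} \<in> (\<lambda>T. T \<times> S) ` P"
    then obtain T where e: "{} = T \<times> S" and T: "T \<in> P" by (rule imageE)
    from e have "T \<times> S = {}" by (rule sym)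
    then show False using T assms(2) partition_onD3[OF assms(1)] unfolding Sigma_empty_iff by auto
  qed
  show "disjnt p q" if pq: "p \<in> (\<lambda>T. T \<times> S) ` P" "q \<in> (\<lambda>T. T \<times> S) ` P" "p \<noteq> q" for p q
  proof -
    obtain T T' where "T \<in> P" "T' \<in> P" "p = T \<times> S" "q = T' \<times> S" using pq by blast
    moreover from this have "T \<inter> T' = {}" using pq(3) partition_onD2[OF assms(1)] by (auto simp: disjoint_def)
    ultimately show ?thesis by (auto simp: disjnt_def)
  qed
qed

lemma hw_partition_times:
  assumes P: "triple_partition X P" and E: "\<And>T. T \<in> P \<Longrightarrow> hw (T \<times> {..<7::nat}) (E T) r s"
  shows "hw (X \<times> {..<7::nat}) (\<Union>T\<in>P. E T) r s"
proof -
  have ne: "{..<7::nat} \<noteq> {}" by (metis empty_iff lessThan_iff zero_less_numeral)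
  then have fst: "fst ` (T \<times> {..<7::nat}) = T" for T :: "'a set" by (simp add: fst_image_times)
  have "hw (X \<times> {..<7::nat}) (\<Union>U\<in>(\<lambda>T. T \<times> {..<7::nat}) ` P. E (fst ` U)) r s"
  proof (rule hw_disjoint_union)
    show "partition_on (X \<times> {..<7::nat}) ((\<lambda>T. T \<times> {..<7}) ` P)"
      by (rule partition_on_times[OF _ ne]) (use P in \<open>simp add: triple_partition_def\<close>)
    show "hw U (E (fst ` U)) r s" if U: "U \<in> (\<lambda>T. T \<times> {..<7}) ` P" for U
    proof -
      obtain T where T: "U = T \<times> {..<7}" "T \<in> P" using U by (rule imageE)
      show ?thesis unfolding T(1) fst by (rule E[OF T(2)])
    qed
  qed
  then show ?thesis by (simp only: UN_simps(10) fst)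
qed

text \<open>Of the classes, \<open>q\<close> receive 7 triangle factors, one receives
  \<open>e\<close>, and the others none.\<close>

lemma hw_classes:
  assumes "finite \<Q>" "\<And>P. P \<in> \<Q> \<Longrightarrow> triple_partition X P"
    and "\<And>P P'. P \<in> \<Q> \<Longrightarrow> P' \<in> \<Q> \<Longrightarrow> P \<noteq> P' \<Longrightarrow> (\<Union>T\<in>P. blow T) \<inter> (\<Union>T\<in>P'. blow T) = {}"
    and "q < card \<Q>" "e \<in> {0, 1, 3, 5, 7}"
  shows "hw (X \<times> {..<7}) (\<Union>P\<in>\<Q>. \<Union>T\<in>P. blow T) (7 * q + e) (7 * card \<Q> - (7 * q + e))"
  using assms
proof (induction \<Q> arbitrary: q e rule: finite_induct)
  case (insert P \<Q>)
  have P: "hw (X \<times> {..<7}) (\<Union>T\<in>P. blow T) r (7 - r)" if "r \<in> {0, 1, 3, 5, 7}" for r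
    using hw_partition_times[OF insert.prems(1)[of P] hw_blow[OF _ that]] insert.prems(1)[of P]
    unfolding triple_partition_def by simp
  have disj: "(\<Union>T\<in>P. blow T) \<inter> (\<Union>P\<in>\<Q>. \<Union>T\<in>P. blow T) = {}"
    using insert.prems(2)[of P] insert.hyps(2) by blast
  have IH: "hw (X \<times> {..<7}) (\<Union>P\<in>\<Q>. \<Union>T\<in>P. blow T) (7 * q' + e') (7 * card \<Q> - (7 * q' + e'))"
    if "q' < card \<Q>" "e' \<in> {0, 1, 3, 5, 7}" for q' e'
    by (rule insert.IH) (use insert.prems that in auto)
  \<comment> \<open>The class \<open>P\<close> takes \<open>e\<close> if it stands alone, 0 if the
    \<open>q\<close> full classes and the partial one fit into \<open>\<Q>\<close>, and 7 if they do
    not.\<close>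
  consider "\<Q> = {}" | "q < card \<Q>" | "\<Q> \<noteq> {}" "q = card \<Q>"
    using insert.prems(3) insert.hyps by (cases "q < card \<Q>") auto
  then show ?case
  proof cases
    case 1
    then show ?thesis using P[OF insert.prems(4)] insert.prems(3) by simp
  next
    case 2
    have "hw (X \<times> {..<7}) ((\<Union>T\<in>P. blow T) \<union> (\<Union>P\<in>\<Q>. \<Union>T\<in>P. blow T)) (0 + (7 * q + e))
      ((7 - 0) + (7 * card \<Q> - (7 * q + e)))"
      by (rule hw_union[OF P IH disj]) (use 2 insert.prems in auto)
    moreover have "(7 - 0) + (7 * card \<Q> - (7 * q + e)) = 7 * card (insert P \<Q>) - (7 * q + e)"
      using 2 insert.hyps insert.prems(4) by auto
    ultimately show ?thesis by simp
  next
    case 3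
    then have pos: "card \<Q> > 0" using insert.hyps by auto
    have "hw (X \<times> {..<7}) ((\<Union>T\<in>P. blow T) \<union> (\<Union>P\<in>\<Q>. \<Union>T\<in>P. blow T)) (7 + (7 * (q - 1) + e))
      ((7 - 7) + (7 * card \<Q> - (7 * (q - 1) + e)))"
      by (rule hw_union[OF P IH disj]) (use 3 pos insert.prems in auto)
    moreover have "7 + (7 * (q - 1) + e) = 7 * q + e" using 3 pos by simp
    moreover have "(7 - 7) + (7 * card \<Q> - (7 * (q - 1) + e)) = 7 * card (insert P \<Q>) - (7 * q + e)"
      using 3 pos insert.hyps insert.prems(4) by auto
    ultimately have "hw (X \<times> {..<7}) ((\<Union>T\<in>P. blow T) \<union> (\<Union>P\<in>\<Q>. \<Union>T\<in>P. blow T)) (7 * q + e)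
      (7 * card (insert P \<Q>) - (7 * q + e))" by (simp only:)
    then show ?thesis by simp
  qed
qed simp

text \<open>Below \<open>7 * N\<close> the even residues 2, 4, 6 are written as 1 plus an odd
  number, the 1 being supplied by the K_21. The upper bound is what \<open>s \<ge> 1\<close> leaves
  of all \<open>7 * N + 10\<close> factors.\<close>

lemma split_triangle_count:
  fixes N r :: nat
  assumes "1 \<le> r" "r \<le> 7 * N + 9" "N \<ge> 1"
  obtains r' q e where "r' \<in> {0, 1, 3, 5, 7, 8, 9, 10}" "q < N" "e \<in> {0, 1, 3, 5, 7}" "r = r' + (7 * q + e)"
proof (cases "r < 7 * N")
  case True
  define q where "q = r div 7"
  have q: "q < N" "r = 7 * q + r mod 7" using True unfolding q_def by (auto simp: less_mult_imp_div_less)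
  have "r mod 7 \<in> {0, 1, 3, 5} \<or> r mod 7 - 1 \<in> {1, 3, 5} \<and> r mod 7 \<ge> 1"
    using mod_less_divisor[of 7 r] by (simp, presburger)
  then show thesis
  proof
    assume "r mod 7 \<in> {0, 1, 3, 5}"
    then show thesis using that[of 0 q "r mod 7"] q by auto
  next
    assume "r mod 7 - 1 \<in> {1, 3, 5} \<and> r mod 7 \<ge> 1"
    then show thesis using that[of 1 q "r mod 7 - 1"] q by auto
  qed
next
  case False
  define d where "d = r - 7 * N"
  have d: "r = 7 * (N - 1) + 7 + d" "d \<le> 9" using False assms unfolding d_def by auto
  then have "d \<in> {0, 1, 3, 5, 7, 8, 9} \<or> d = 2 \<or> d = 4 \<or> d = 6" by auto
  then show thesis
    \<comment> \<open>With \<open>q = N - 1\<close> the rest is \<open>7 + d\<close>. It is split as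
      \<open>d\<close> and 7, except that 9 = 9 + 0, 11 = 8 + 3 and 13 = 8 + 5 replace the
      splittings with d = 2, 4, 6.\<close>
    using that[of d "N - 1" 7] that[of 9 "N - 1" 0] that[of 8 "N - 1" 3] that[of 8 "N - 1" 5] d assms(3)
    by auto
qed

text \<open>The class \<open>P0\<close> carries the copies of K_21, with 10 factors; the other
  \<open>k - 1\<close> classes carry 7 factors each, in total \<open>7 * k + 3\<close>. Two copies
  of one point meet only in the triple of \<open>P0\<close> through it. The bound
  \<open>k \<ge> 2\<close> provides at least one tripartite class to repair even counts.\<close>

lemma hw_kirkman:
  assumes "kirkman k X" "k \<ge> 2" "r \<ge> 1" "s \<ge> 1" "r + s = 7 * k + 3"
  shows "hw (X \<times> {..<7::nat}) (complete_edges (X \<times> {..<7})) r s"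
proof -
  obtain \<P> where ex: "finite \<P>" "card \<P> = k" "\<forall>P\<in>\<P>. triple_partition X P"
    "\<forall>x\<in>X. \<forall>y\<in>X. x \<noteq> y \<longrightarrow> (\<exists>P\<in>\<P>. \<exists>T\<in>P. x \<in> T \<and> y \<in> T)"
    "\<forall>P\<in>\<P>. \<forall>P'\<in>\<P>. \<forall>T\<in>P. \<forall>T'\<in>P'. \<forall>x\<in>T \<inter> T'. \<forall>y\<in>T \<inter> T'. x \<noteq> y \<longrightarrow> P = P'"
    using kirkman_exact[OF assms(1)] by (elim exE conjE)
  note \<P> = ex(1,2) ex(3)[rule_format]
  have cov: "\<exists>P\<in>\<P>. \<exists>T\<in>P. x \<in> T \<and> y \<in> T" if "x \<in> X" "y \<in> X" "x \<noteq> y" for x y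
    using ex(4) that by blast
  have un: "P = P'" if "P \<in> \<P>" "P' \<in> \<P>" "T \<in> P" "T' \<in> P'" "x \<noteq> y" "x \<in> T" "y \<in> T" "x \<in> T'" "y \<in> T'"
    for P P' T T' x y
    using ex(5) that by blast
  obtain P0 where P0: "P0 \<in> \<P>" using \<P>(2) assms(2) by fastforce
  let ?\<Q> = "\<P> - {P0}"
  have part: "\<Union>P = X" if "P \<in> \<P>" for P
    using \<P>(3)[OF that] unfolding triple_partition_def partition_on_def by simp
  have cQ: "card ?\<Q> = k - 1" using \<P> P0 by simp
  obtain r' q e where rq: "r' \<in> {0, 1, 3, 5, 7, 8, 9, 10}" "q < k - 1" "e \<in> {0, 1, 3, 5, 7}"
    "r = r' + (7 * q + e)"
  proof (rule split_triangle_count[of r "k - 1"])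
    show "r \<le> 7 * (k - 1) + 9" "k - 1 \<ge> 1" using assms by auto
  qed (use assms(3) in auto)
  have fill: "hw (X \<times> {..<7::nat}) (\<Union>T\<in>P0. complete_edges (T \<times> {..<7})) r' (10 - r')"
    by (rule hw_partition_times[OF \<P>(3)[OF P0]]) (use hw_fill rq(1) \<P>(3)[OF P0] in \<open>auto simp: triple_partition_def\<close>)
  have bl: "\<exists>T x y i j. T \<in> P \<and> x \<in> T \<and> y \<in> T \<and> x \<noteq> y \<and> e = {(x, i), (y, j)}"
    if "e \<in> (\<Union>T\<in>P. blow T)" for e P using that unfolding blow_def by blast
  have blow_disj: "(\<Union>T\<in>P. blow T) \<inter> (\<Union>T\<in>P'. blow T) = {}"
    if "P \<in> \<P>" "P' \<in> \<P>" "P \<noteq> P'" for P P'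
  proof (rule ccontr)
    assume "(\<Union>T\<in>P. blow T) \<inter> (\<Union>T\<in>P'. blow T) \<noteq> {}"
    then obtain e where e: "e \<in> (\<Union>T\<in>P. blow T)" "e \<in> (\<Union>T\<in>P'. blow T)" by blast
    obtain T x y i j where 1: "T \<in> P" "x \<in> T" "y \<in> T" "x \<noteq> y" "e = {(x, i), (y, j)}" using bl[OF e(1)] by blast
    obtain T' x' y' i' j' where 2: "T' \<in> P'" "x' \<in> T'" "y' \<in> T'" "e = {(x', i'), (y', j')}" using bl[OF e(2)] by blast
    have "x \<in> T'" "y \<in> T'" using 1(5) 2 by (auto simp: doubleton_eq_iff)
    then show False using un[OF that(1,2) 1(1) 2(1) 1(4,2,3)] that(3) by blast
  qed
  have "hw (X \<times> {..<7}) (\<Union>P\<in>?\<Q>. \<Union>T\<in>P. blow T) (7 * q + e) (7 * card ?\<Q> - (7 * q + e))"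
    by (rule hw_classes) (use \<P> blow_disj rq cQ in auto)
  moreover have "(\<Union>T\<in>P0. complete_edges (T \<times> {..<7::nat})) \<inter> (\<Union>P\<in>?\<Q>. \<Union>T\<in>P. blow T) = {}"
  proof (rule ccontr)
    assume "\<not> ?thesis"
    then obtain P T0 e where e: "P \<in> \<P>" "P \<noteq> P0" "e \<in> (\<Union>T\<in>P. blow T)" "T0 \<in> P0" "e \<in> complete_edges (T0 \<times> {..<7::nat})"
      by blast
    obtain T x y i j where 1: "T \<in> P" "x \<in> T" "y \<in> T" "x \<noteq> y" "e = {(x, i), (y, j)}" using bl[OF e(3)] by blast
    have "x \<in> T0" "y \<in> T0" using 1(5) e(5) unfolding complete_edges_def by auto
    then show False using un[OF e(1) P0 1(1) e(4) 1(4,2,3)] e(2) by blast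
  qed
  ultimately have "hw (X \<times> {..<7::nat}) ((\<Union>T\<in>P0. complete_edges (T \<times> {..<7})) \<union> (\<Union>P\<in>?\<Q>. \<Union>T\<in>P. blow T))
    (r' + (7 * q + e)) ((10 - r') + (7 * card ?\<Q> - (7 * q + e)))"
    by (rule hw_union[OF fill])
  moreover have "(10 - r') + (7 * card ?\<Q> - (7 * q + e)) = s" 
    unfolding cQ using rq assms by auto
  moreover have "(\<Union>T\<in>P0. complete_edges (T \<times> {..<7})) \<union> (\<Union>P\<in>?\<Q>. \<Union>T\<in>P. blow T) = complete_edges (X \<times> {..<7::nat})"
  proof (intro equalityI Un_least)
    show "(\<Union>T\<in>P0. complete_edges (T \<times> {..<7})) \<subseteq> complete_edges (X \<times> {..<7::nat})"
      using part[OF P0] unfolding complete_edges_def by blast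
    show "(\<Union>P\<in>?\<Q>. \<Union>T\<in>P. blow T) \<subseteq> complete_edges (X \<times> {..<7::nat})"
    proof
      fix e assume "e \<in> (\<Union>P\<in>?\<Q>. \<Union>T\<in>P. blow T)"
      then obtain P T x y i j where "P \<in> \<P>" "T \<in> P" "x \<in> T" "y \<in> T" "x \<noteq> y" "i < 7" "j < 7" "e = {(x, i), (y, j)}"
        unfolding blow_def by blast
      then show "e \<in> complete_edges (X \<times> {..<7::nat})" using part[of P] by (auto intro!: complete_edgesI)
    qed
    show "complete_edges (X \<times> {..<7::nat}) \<subseteq> (\<Union>T\<in>P0. complete_edges (T \<times> {..<7})) \<union> (\<Union>P\<in>?\<Q>. \<Union>T\<in>P. blow T)"
    proof
      fix e assume "e \<in> complete_edges (X \<times> {..<7::nat})"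
      then obtain x i y j where e: "e = {(x, i), (y, j)}" "x \<in> X" "y \<in> X" "i < 7" "j < 7" "(x, i) \<noteq> (y, j)"
        by (auto elim!: complete_edgesE)
      show "e \<in> (\<Union>T\<in>P0. complete_edges (T \<times> {..<7})) \<union> (\<Union>P\<in>?\<Q>. \<Union>T\<in>P. blow T)"
      proof (cases "x = y")
        case True
        obtain T where "T \<in> P0" "x \<in> T" using part[OF P0] e by blast
        then have "e \<in> complete_edges (T \<times> {..<7::nat})" using e True by (auto intro!: complete_edgesI)
        then show ?thesis using \<open>T \<in> P0\<close> by blast
      next
        case False
        obtain P T where PT: "P \<in> \<P>" "T \<in> P" "x \<in> T" "y \<in> T" using cov[OF e(2,3) False] by blast
        show ?thesis
        proof (cases "P = P0")
          case True
          have "e \<in> complete_edges (T \<times> {..<7::nat})" using e PT by (auto intro!: complete_edgesI)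
          then show ?thesis using PT True by blast
        next
          case P: False
          have "e \<in> blow T" unfolding blow_def using e PT False by blast
          then show ?thesis using PT P by blast
        qed
      qed
    qed
  qed
  ultimately show ?thesis using rq(4) by simp
qed

lemma HW_of_kirkman:
  assumes "kirkman k X" "k \<ge> 2" "r \<ge> 1" "s \<ge> 1" "n = 14 * k + 7" "r + s = (n - 1) div 2"
  shows "\<exists>P. HW n r s 3 7 P"
proof -
  let ?V = "X \<times> {..<7::nat}"
  have "finite ?V" "card ?V = n" using assms unfolding kirkman_def by auto
  then obtain g where g: "bij_betw g ?V {..<n}"
    using ex_bij_betw_finite_nat[of ?V] by (auto simp: atLeast0LessThan)
  have "hw (g ` ?V) ((`) g ` complete_edges ?V) r s"
    using g assms by (intro hw_image hw_kirkman) (auto simp: bij_betw_def)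
  then have "hw {..<n} (complete_edges {..<n}) r s"
    using complete_edges_image[of g ?V] g by (simp add: bij_betw_def)
  then show ?thesis by (rule hw_HW) (use assms in auto)
qed

section \<open>Kirkman frames\<close>

lemma triple_partition_image:
  assumes "triple_partition X P" "inj_on g X"
  shows "triple_partition (g ` X) ((`) g ` P)"
proof -
  have P: "partition_on X P" "\<And>T. T \<in> P \<Longrightarrow> card T = 3" using assms(1) unfolding triple_partition_def by auto
  have "{} \<notin> (`) g ` P" using partition_onD3[OF P(1)] by auto
  then have "partition_on (g ` X) ((`) g ` P)" using partition_on_inj_image[OF P(1) assms(2)] by simp
  moreover have "card (g ` T) = 3" if "T \<in> P" for T
  proof -
    have "T \<subseteq> X" using partition_onD1[OF P(1)] that by auto
    then show ?thesis using P(2)[OF that] card_image[OF inj_on_subset[OF assms(2)]] by metis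
  qed
  ultimately show ?thesis unfolding triple_partition_def by auto
qed

lemma triple_partition_UN:
  assumes "\<And>i. i \<in> I \<Longrightarrow> triple_partition (A i) (P i)"
    and "\<And>i j. i \<in> I \<Longrightarrow> j \<in> I \<Longrightarrow> i \<noteq> j \<Longrightarrow> A i \<inter> A j = {}"
  shows "triple_partition (\<Union>i\<in>I. A i) (\<Union>i\<in>I. P i)"
proof -
  have P: "partition_on (A i) (P i)" "\<And>T. T \<in> P i \<Longrightarrow> card T = 3" if "i \<in> I" for i
    using assms(1)[OF that] unfolding triple_partition_def by auto
  have "partition_on (\<Union>i\<in>I. A i) (\<Union>i\<in>I. P i)"
  proof (rule partition_onI)
    show "\<Union> (\<Union>i\<in>I. P i) = (\<Union>i\<in>I. A i)" using partition_onD1[OF P(1)] by auto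
    show "{} \<notin> (\<Union>i\<in>I. P i)" using partition_onD3[OF P(1)] by auto
    show "disjnt p q" if pq: "p \<in> (\<Union>i\<in>I. P i)" "q \<in> (\<Union>i\<in>I. P i)" "p \<noteq> q" for p q
    proof -
      obtain i j where ij: "i \<in> I" "p \<in> P i" "j \<in> I" "q \<in> P j" using pq by blast
      show ?thesis
      proof (cases "i = j")
        case True
        then show ?thesis using partition_onD2[OF P(1)[OF ij(1)]] ij pq(3) unfolding disjoint_def disjnt_def by auto
      next
        case False
        then have "A i \<inter> A j = {}" using assms(2) ij by auto
        moreover have "p \<subseteq> A i" "q \<subseteq> A j" using partition_onD1[OF P(1)] ij by auto
        ultimately show ?thesis unfolding disjnt_def by auto
      qed
    qed
  qed
  then show ?thesis using P(2) unfolding triple_partition_def by auto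
qed

text \<open>A class is given by the map from a point to its block. If all points of a block name the
  same block, two blocks that meet coincide, so pairwise disjointness needs no separate
  proof.\<close>

lemma triple_partition_fun:
  assumes "\<And>p. p \<in> X \<Longrightarrow> p \<in> B p \<and> B p \<subseteq> X \<and> card (B p) = 3"
    and "\<And>p q. p \<in> X \<Longrightarrow> q \<in> B p \<Longrightarrow> B q = B p"
  shows "triple_partition X (B ` X)"
proof -
  have "partition_on X (B ` X)"
  proof (rule partition_onI)
    show "\<Union> (B ` X) = X" using assms(1) by blast
    show "{} \<notin> B ` X" using assms(1) by fastforce
    show "disjnt P Q" if "P \<in> B ` X" "Q \<in> B ` X" "P \<noteq> Q" for P Q
      using that assms(2) unfolding disjnt_def by blast
  qed
  then show ?thesis using assms(1) unfolding triple_partition_def by auto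
qed

lemma triple_partition_insert:
  assumes "triple_partition X P" "card T = 3" "T \<inter> X = {}"
  shows "triple_partition (T \<union> X) (insert T P)"
proof -
  have P: "partition_on X P" using assms(1) unfolding triple_partition_def by simp
  have "disjnt T (\<Union>P)" "T \<union> X - T = X" "T \<noteq> {}"
    using partition_onD1[OF P] assms(2,3) by (auto simp: disjnt_def)
  then have "partition_on (T \<union> X) (insert T P)" using partition_on_insert P by (metis Un_upper1)
  then show ?thesis using assms unfolding triple_partition_def by simp
qed

text \<open>A Kirkman frame of type \<open>2\<^sup>n\<close> on the groups \<open>{x} \<times> UNIV\<close>: one class of triples for every
  group, missing exactly that group.\<close>

definition kirkman_frame :: "'a set \<Rightarrow> bool" where
  "kirkman_frame B \<longleftrightarrow> (\<exists>Q. (\<forall>x\<in>B. triple_partition ((B - {x}) \<times> (UNIV :: bool set)) (Q x)) \<and>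
    (\<forall>x\<in>B. \<forall>y\<in>B. x \<noteq> y \<longrightarrow> (\<forall>i j. \<exists>z\<in>B. \<exists>T\<in>Q z. (x, i) \<in> T \<and> (y, j) \<in> T)))"

lemma kirkman_frameI:
  assumes "\<And>x. x \<in> B \<Longrightarrow> triple_partition ((B - {x}) \<times> (UNIV :: bool set)) (Q x)"
    and "\<And>x y i j. x \<in> B \<Longrightarrow> y \<in> B \<Longrightarrow> x \<noteq> y \<Longrightarrow> \<exists>z\<in>B. \<exists>T\<in>Q z. (x, i) \<in> T \<and> (y, j) \<in> T"
  shows "kirkman_frame B"
  unfolding kirkman_frame_def by (intro exI[of _ Q] conjI ballI impI allI assms)

lemma kirkmanI:
  assumes "finite X" "card X = 2 * r + 1" "finite \<P>" "card \<P> \<le> r"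
    and "\<And>P. P \<in> \<P> \<Longrightarrow> triple_partition X P"
    and "\<And>x y. x \<in> X \<Longrightarrow> y \<in> X \<Longrightarrow> x \<noteq> y \<Longrightarrow> \<exists>P\<in>\<P>. \<exists>T\<in>P. x \<in> T \<and> y \<in> T"
  shows "kirkman r X"
  unfolding kirkman_def by (intro exI[of _ \<P>] conjI ballI impI assms)

lemma kirkman_frame_image:
  assumes "kirkman_frame B" "inj_on g B"
  shows "kirkman_frame (g ` B)"
proof -
  obtain Q where Q: "\<And>x. x \<in> B \<Longrightarrow> triple_partition ((B - {x}) \<times> (UNIV :: bool set)) (Q x)"
    and cov: "\<And>x y i j. x \<in> B \<Longrightarrow> y \<in> B \<Longrightarrow> x \<noteq> y \<Longrightarrow> \<exists>z\<in>B. \<exists>T\<in>Q z. (x, i) \<in> T \<and> (y, j) \<in> T"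
    using assms(1) unfolding kirkman_frame_def by metis
  let ?g = "map_prod g (id :: bool \<Rightarrow> bool)"
  define Q' where "Q' y = (`) ?g ` Q (inv_into B g y)" for y
  have Q': "Q' (g x) = (`) ?g ` Q x" if "x \<in> B" for x
    unfolding Q'_def using assms(2) that by simp
  have inj: "inj_on ?g (B \<times> UNIV)" using assms(2) by (auto simp: inj_on_def)
  have "triple_partition ((g ` B - {y}) \<times> UNIV) (Q' y)" if y: "y \<in> g ` B" for y
  proof -
    obtain x where x: "x \<in> B" "y = g x" using y by auto
    have "triple_partition (?g ` ((B - {x}) \<times> UNIV)) ((`) ?g ` Q x)"
      by (rule triple_partition_image[OF Q[OF x(1)]]) (rule inj_on_subset[OF inj], auto)
    moreover have "?g ` ((B - {x}) \<times> UNIV) = (g ` B - {y}) \<times> UNIV"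
    proof -
      have "g ` (B - {x}) = g ` B - {y}" using inj_on_image_set_diff[OF assms(2), of B "{x}"] x by simp
      then show ?thesis by (simp add: map_prod_surj_on)
    qed
    ultimately show ?thesis using Q'[OF x(1)] x(2) by simp
  qed
  moreover have "\<exists>z\<in>g ` B. \<exists>T\<in>Q' z. (x, i) \<in> T \<and> (y, j) \<in> T"
    if xy: "x \<in> g ` B" "y \<in> g ` B" "x \<noteq> y" for x y i j
  proof -
    obtain a b where ab: "a \<in> B" "b \<in> B" "x = g a" "y = g b" "a \<noteq> b" using xy by auto
    obtain z T where zT: "z \<in> B" "T \<in> Q z" "(a, i) \<in> T" "(b, j) \<in> T" using cov[OF ab(1,2,5)] by blast
    have T: "?g ` T \<in> Q' (g z)" using Q'[OF zT(1)] zT(2) by simp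
    have "(x, i) \<in> ?g ` T" "(y, j) \<in> ?g ` T"
      using imageI[OF zT(3), of ?g] imageI[OF zT(4), of ?g] ab(3,4) by simp_all
    then show ?thesis by (intro bexI[OF _ imageI[OF zT(1)]] bexI[OF _ T] conjI)
  qed
  ultimately show ?thesis by (rule kirkman_frameI)
qed

lemma kirkman_frame_card:
  assumes "kirkman_frame {..<card B}" "finite B"
  shows "kirkman_frame B"
proof -
  obtain g where "bij_betw g {..<card B} B"
    using ex_bij_betw_nat_finite[OF assms(2)] by (auto simp: atLeast0LessThan)
  then show ?thesis using kirkman_frame_image[OF assms(1), of g] by (simp add: bij_betw_def)
qed

lemma kirkman_frame_1: "kirkman_frame {..<1::nat}"
proof (rule kirkman_frameI[of _ "\<lambda>_. {}"])
  fix x :: nat assume "x \<in> {..<1}"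
  then have "{..<1} - {x} = {}" by auto
  then show "triple_partition (({..<1} - {x}) \<times> (UNIV :: bool set)) {}"
    by (simp only: Sigma_empty1) (simp add: triple_partition_def partition_on_def)
qed simp

text \<open>Blocks through \<open>x\<close> meet only in \<open>x\<close>, so without
  \<open>x\<close> they partition the remaining points. The classes missing the group of
  \<open>x\<close>, one from the frame on each of these blocks, therefore add up to one class on all
  of \<open>X\<close>.\<close>

lemma kirkman_frame_pbd:
  assumes sub: "\<And>B. B \<in> \<B> \<Longrightarrow> B \<subseteq> X"
    and cov: "\<And>x y. x \<in> X \<Longrightarrow> y \<in> X \<Longrightarrow> x \<noteq> y \<Longrightarrow> \<exists>B\<in>\<B>. x \<in> B \<and> y \<in> B"
    and un: "\<And>B B' x y. B \<in> \<B> \<Longrightarrow> B' \<in> \<B> \<Longrightarrow> x \<noteq> y \<Longrightarrow> x \<in> B \<Longrightarrow> y \<in> B \<Longrightarrow> x \<in> B' \<Longrightarrow> y \<in> B' \<Longrightarrow> B = B'"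
    and fr: "\<And>B. B \<in> \<B> \<Longrightarrow> kirkman_frame B"
  shows "kirkman_frame X"
proof -
  have "\<forall>B\<in>\<B>. \<exists>Q. (\<forall>x\<in>B. triple_partition ((B - {x}) \<times> (UNIV :: bool set)) (Q x)) \<and>
    (\<forall>x\<in>B. \<forall>y\<in>B. x \<noteq> y \<longrightarrow> (\<forall>i j. \<exists>z\<in>B. \<exists>T\<in>Q z. (x, i) \<in> T \<and> (y, j) \<in> T))"
    using fr unfolding kirkman_frame_def by blast
  then obtain Q where "\<forall>B\<in>\<B>. (\<forall>x\<in>B. triple_partition ((B - {x}) \<times> (UNIV :: bool set)) (Q B x)) \<and>
    (\<forall>x\<in>B. \<forall>y\<in>B. x \<noteq> y \<longrightarrow> (\<forall>i j. \<exists>z\<in>B. \<exists>T\<in>Q B z. (x, i) \<in> T \<and> (y, j) \<in> T))"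
    by (rule bchoice[THEN exE])
  note QB = this
  have Q: "triple_partition ((B - {x}) \<times> (UNIV :: bool set)) (Q B x)" if "B \<in> \<B>" "x \<in> B" for B x
    using bspec[OF bspec[OF QB that(1), THEN conjunct1] that(2)] .
  have Qcov: "\<exists>z\<in>B. \<exists>T\<in>Q B z. (x, i) \<in> T \<and> (y, j) \<in> T" if "B \<in> \<B>" "x \<in> B" "y \<in> B" "x \<noteq> y" for B x y i j
    using bspec[OF bspec[OF bspec[OF QB that(1), THEN conjunct2] that(2)] that(3), THEN mp, OF that(4)] by simp
  define R where "R x = (\<Union>B\<in>{B \<in> \<B>. x \<in> B}. Q B x)" for x
  have "triple_partition ((X - {x}) \<times> UNIV) (R x)" if x: "x \<in> X" for x
  proof -
    have "triple_partition (\<Union>B\<in>{B \<in> \<B>. x \<in> B}. (B - {x}) \<times> UNIV) (R x)"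
      unfolding R_def
    proof (rule triple_partition_UN)
      show "triple_partition ((B - {x}) \<times> UNIV) (Q B x)" if "B \<in> {B \<in> \<B>. x \<in> B}" for B
        using Q that by blast
      show "(B - {x}) \<times> UNIV \<inter> (B' - {x}) \<times> UNIV = {}"
        if BB: "B \<in> {B \<in> \<B>. x \<in> B}" "B' \<in> {B \<in> \<B>. x \<in> B}" "B \<noteq> B'" for B B'
      proof -
        have "y \<notin> B'" if "y \<in> B" "y \<noteq> x" for y using un[of B B' x y] BB that by auto
        then show ?thesis by auto
      qed
    qed
    moreover have "(\<Union>B\<in>{B \<in> \<B>. x \<in> B}. (B - {x}) \<times> UNIV) = (X - {x}) \<times> (UNIV :: bool set)"
    proof
      show "(\<Union>B\<in>{B \<in> \<B>. x \<in> B}. (B - {x}) \<times> UNIV) \<subseteq> (X - {x}) \<times> (UNIV :: bool set)" using sub by blast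
      show "(X - {x}) \<times> (UNIV :: bool set) \<subseteq> (\<Union>B\<in>{B \<in> \<B>. x \<in> B}. (B - {x}) \<times> UNIV)"
      proof
        fix p assume "p \<in> (X - {x}) \<times> (UNIV :: bool set)"
        then obtain y i where p: "p = (y, i)" "y \<in> X" "y \<noteq> x" by auto
        then obtain B where "B \<in> \<B>" "x \<in> B" "y \<in> B" using cov[OF x, of y] by auto
        then show "p \<in> (\<Union>B\<in>{B \<in> \<B>. x \<in> B}. (B - {x}) \<times> UNIV)" using p by blast
      qed
    qed
    ultimately show ?thesis by simp
  qed
  moreover have "\<exists>z\<in>X. \<exists>T\<in>R z. (x, i) \<in> T \<and> (y, j) \<in> T" if xy: "x \<in> X" "y \<in> X" "x \<noteq> y" for x y i j
  proof -
    obtain B where B: "B \<in> \<B>" "x \<in> B" "y \<in> B" using cov[OF xy] by blast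
    obtain z T where "z \<in> B" "T \<in> Q B z" "(x, i) \<in> T" "(y, j) \<in> T" using Qcov[OF B xy(3)] by blast
    then show ?thesis using B(1) sub[OF B(1)] unfolding R_def by blast
  qed
  ultimately show ?thesis by (rule kirkman_frameI)
qed

text \<open>The new point \<open>None\<close> forms a triple with each group, and this triple
  completes the class that misses the group.\<close>

lemma kirkman_of_frame:
  assumes "kirkman_frame B" "finite B"
  shows "kirkman (card B) (insert None (Some ` (B \<times> (UNIV :: bool set))))"
proof -
  let ?X = "insert None (Some ` (B \<times> (UNIV :: bool set)))"
  obtain Q where Q: "\<And>x. x \<in> B \<Longrightarrow> triple_partition ((B - {x}) \<times> (UNIV :: bool set)) (Q x)"
    and cov: "\<And>x y i j. x \<in> B \<Longrightarrow> y \<in> B \<Longrightarrow> x \<noteq> y \<Longrightarrow> \<exists>z\<in>B. \<exists>T\<in>Q z. (x, i) \<in> T \<and> (y, j) \<in> T"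
    using assms(1) unfolding kirkman_frame_def by metis
  define I where "I x = {None, Some (x, False), Some (x, True)}" for x :: 'a
  define C where "C x = insert (I x) ((`) Some ` Q x)" for x
  have part: "triple_partition ?X (C x)" if x: "x \<in> B" for x
  proof -
    have "triple_partition (I x \<union> Some ` ((B - {x}) \<times> UNIV)) (C x)"
      unfolding C_def
      by (intro triple_partition_insert triple_partition_image Q x) (auto simp: I_def)
    moreover have "I x \<union> Some ` ((B - {x}) \<times> UNIV) = ?X"
      using x by (auto simp: I_def image_iff)
    ultimately show ?thesis by simp
  qed
  have pairs: "\<exists>x\<in>B. \<exists>T\<in>C x. p \<in> T \<and> q \<in> T" if pq: "p \<in> ?X" "q \<in> ?X" "p \<noteq> q" for p q
  proof -
    consider x where "x \<in> B" "p \<in> I x" "q \<in> I x" |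
      x i y j where "x \<in> B" "y \<in> B" "x \<noteq> y" "p = Some (x, i)" "q = Some (y, j)"
    proof (cases p)
      case None
      then obtain y j where "q = Some (y, j)" "y \<in> B" using pq by auto
      then show thesis using that(1)[of y] None by (cases j) (auto simp: I_def)
    next
      case (Some a)
      obtain x i where a: "a = (x, i)" by (cases a)
      then have x: "x \<in> B" using Some pq by auto
      show thesis
      proof (cases q)
        case None
        then show thesis using that(1)[of x] Some a x by (cases i) (auto simp: I_def)
      next
        case (Some b)
        obtain y j where b: "b = (y, j)" by (cases b)
        then have y: "y \<in> B" using Some pq by auto
        show thesis
        proof (cases "x = y")
          case True
          then show thesis using that(1)[of x] \<open>p = Some a\<close> Some a b x by (cases i; cases j) (auto simp: I_def)
        next
          case False
          then show thesis using that(2)[of x y i j] \<open>p = Some a\<close> Some a b x y by auto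
        qed
      qed
    qed
    then show ?thesis
    proof cases
      case 1
      then show ?thesis unfolding C_def by blast
    next
      case 2
      obtain z T where "z \<in> B" "T \<in> Q z" "(x, i) \<in> T" "(y, j) \<in> T" using cov[OF 2(1-3)] by blast
      then show ?thesis using 2(4,5) unfolding C_def by blast
    qed
  qed
  have "card ?X = 2 * card B + 1"
    using assms(2) by (simp add: card_image card_cartesian_product)
  moreover have "\<exists>P\<in>C ` B. \<exists>T\<in>P. p \<in> T \<and> q \<in> T" if "p \<in> ?X" "q \<in> ?X" "p \<noteq> q" for p q
    using pairs[OF that] by blast
  ultimately show ?thesis
    using assms(2) part card_image_le[OF assms(2), of C] by (intro kirkmanI[of _ _ "C ` B"]) auto
qed

lemma kirkman_image:
  assumes "kirkman r X" "inj_on g X"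
  shows "kirkman r (g ` X)"
proof -
  obtain \<P> where X: "finite X" "card X = 2 * r + 1" and \<P>: "finite \<P>" "card \<P> \<le> r"
    and P: "\<And>P. P \<in> \<P> \<Longrightarrow> triple_partition X P"
    and cov: "\<And>x y. x \<in> X \<Longrightarrow> y \<in> X \<Longrightarrow> x \<noteq> y \<Longrightarrow> \<exists>P\<in>\<P>. \<exists>T\<in>P. x \<in> T \<and> y \<in> T"
    using assms(1) unfolding kirkman_def by metis
  let ?\<P> = "(`) ((`) g) ` \<P>"
  have "finite ?\<P>" "card ?\<P> \<le> r" using \<P> card_image_le[OF \<P>(1), of "(`) ((`) g)"] by auto
  moreover have "triple_partition (g ` X) P" if "P \<in> ?\<P>" for P
    using that P triple_partition_image[OF _ assms(2)] by blast
  moreover have "\<exists>P\<in>?\<P>. \<exists>T\<in>P. x \<in> T \<and> y \<in> T" if xy: "x \<in> g ` X" "y \<in> g ` X" "x \<noteq> y" for x y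
  proof -
    obtain a b where ab: "a \<in> X" "b \<in> X" "x = g a" "y = g b" "a \<noteq> b" using xy by auto
    then obtain P T where "P \<in> \<P>" "T \<in> P" "a \<in> T" "b \<in> T" using cov by blast
    then show ?thesis using ab by blast
  qed
  ultimately show ?thesis using X assms(2) by (intro kirkmanI[of _ _ ?\<P>]) (auto simp: card_image)
qed

lemma kirkman_card:
  assumes "kirkman r X" "finite Y" "card Y = 2 * r + 1"
  shows "kirkman r Y"
proof -
  have "finite X" "card X = card Y" using assms unfolding kirkman_def by auto
  then obtain g where "bij_betw g X Y" using finite_same_card_bij[OF _ assms(2)] by blast
  then show ?thesis using kirkman_image[OF assms(1), of g] by (simp add: bij_betw_def)
qed

section \<open>Kirkman triple systems from cube roots of unity\<close>

lemma coverI: "P \<in> \<P> \<Longrightarrow> B \<in> P \<Longrightarrow> p \<in> B \<Longrightarrow> q \<in> B \<Longrightarrow> \<exists>P\<in>\<P>. \<exists>B\<in>P. p \<in> B \<and> q \<in> B"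
  by blast

locale cube_root =
  fixes w :: "'a::{finite,ab_group_add} \<Rightarrow> 'a"
  assumes w_add: "w (x + y) = w x + w y"
    and w_root: "w (w x) + w x + x = 0"
    and w_fixed: "w x = x \<Longrightarrow> x = 0"
    and two_torsion: "x + x = 0 \<Longrightarrow> x = 0"
begin

lemma w_0 [simp]: "w 0 = 0"
  using w_add[of 0 0] by simp

lemma w_minus [simp]: "w (- x) = - w x"
  using w_add[of x "- x"] by (simp add: eq_neg_iff_add_eq_0 add.commute)

lemma w_diff [simp]: "w (x - y) = w x - w y"
  using w_add[of x "- y"] by simp

lemma w_w [simp]: "w (w x) = - x - w x"
  using w_root[of x] by (simp add: algebra_simps eq_neg_iff_add_eq_0)

declare w_add [simp]

lemma w_eq_0 [simp]: "w x = 0 \<longleftrightarrow> x = 0"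
  using w_w[of x] by fastforce

lemma w_eq [simp]: "w x = x \<longleftrightarrow> x = 0" "x = w x \<longleftrightarrow> x = 0"
  using w_fixed by (auto dest: sym)

lemma two_cancel: "(x::'a) + x = y + y \<longleftrightarrow> x = y"
proof
  assume "x + x = y + y"
  then have "(x - y) + (x - y) = 0" by (simp add: algebra_simps)
  then have "x - y = 0" by (rule two_torsion)
  then show "x = y" by simp
qed simp

text \<open>The term \<open>- x - w x\<close> is the simp normal form of \<open>w (w x)\<close>, so
  this says that the orbit of a nonzero \<open>x\<close> has three different elements.\<close>

lemma w_ne_double: "x \<noteq> 0 \<Longrightarrow> - x - w x \<noteq> x" "x \<noteq> 0 \<Longrightarrow> - x - w x \<noteq> w x"
proof -
  show "- x - w x \<noteq> x" if "x \<noteq> 0"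
  proof
    assume "- x - w x = x"
    then have "w (w (w x)) = w x" by (metis w_w)
    then show False using that by simp
  qed
  show "- x - w x \<noteq> w x" if "x \<noteq> 0"
  proof
    assume "- x - w x = w x"
    then have "w (w x) = w x" by simp
    then show False using that w_fixed[of "w x"] by simp
  qed
qed

lemma surj_w_minus_id: "\<exists>u. w u - u = d"
proof -
  have "inj (\<lambda>u. w u - u)"
  proof (rule injI)
    fix x y assume "w x - x = w y - y"
    then have "w (x - y) = x - y" by (simp add: algebra_simps)
    then have "x - y = 0" by (rule w_fixed)
    then show "x = y" by simp
  qed
  then have "surj (\<lambda>u. w u - u)" by (intro finite_UNIV_inj_surj) auto
  from surjD[OF this, of d] obtain u where "d = w u - u" by (rule exE)
  then show ?thesis by (intro exI[of _ u]) (rule sym)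
qed

lemma surj_w2_minus_id: "\<exists>u. w (w u) - u = d"
proof -
  obtain v where v: "w v - v = d" using surj_w_minus_id by blast
  \<comment> \<open>Since w^3 = 1, the product of w^2 - 1 and -w is w - 1.\<close>
  have "w (w (- w v)) - (- w v) = d" using v by (simp add: algebra_simps)
  then show ?thesis by blast
qed

lemma surj_double: "\<exists>u. u + u = (d::'a)"
proof -
  have "inj (\<lambda>u::'a. u + u)" using two_cancel by (auto intro: injI)
  then have "surj (\<lambda>u::'a. u + u)" by (intro finite_UNIV_inj_surj) auto
  from surjD[OF this, of d] obtain u where "d = u + u" by (rule exE)
  then show ?thesis by (intro exI[of _ u]) (rule sym)
qed

text \<open>Two different elements of the orbit add up to minus the third; doubles are excluded by
  \<open>two_torsion\<close>. Hence an orbit never meets its own negative, which lets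
  \<open>half_set\<close> choose between them.\<close>

lemma orbit_sum_nonzero:
  assumes "x \<noteq> 0" "a \<in> {x, w x, w (w x)}" "b \<in> {x, w x, w (w x)}"
  shows "a + b \<noteq> 0"
proof -
  define y z where "y = w x" and "z = w (w x)"
  have nz: "x \<noteq> 0" "y \<noteq> 0" "z \<noteq> 0" using assms(1) unfolding y_def z_def w_eq_0 by simp_all
  then have dbl: "x + x \<noteq> 0" "y + y \<noteq> 0" "z + z \<noteq> 0" using two_torsion by blast+
  have "z + y + x = 0" using w_root[of x] unfolding y_def z_def .
  then have "x + y = - z" "y + z = - x" "x + z = - y"
    by (simp_all add: eq_neg_iff_add_eq_0 ac_simps)
  then have "x + y \<noteq> 0" "y + z \<noteq> 0" "x + z \<noteq> 0" "y + x \<noteq> 0" "z + y \<noteq> 0" "z + x \<noteq> 0"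
    using nz by (simp_all add: add.commute)
  moreover have "a \<in> {x, y, z}" using assms(2) unfolding y_def z_def .
  moreover have "b \<in> {x, y, z}" using assms(3) unfolding y_def z_def .
  ultimately show ?thesis using dbl by auto
qed

lemma w_w_w: "w (w (w x)) = x"
  by simp

definition half_closed :: "'a set \<Rightarrow> bool" where
  "half_closed H \<longleftrightarrow> 0 \<notin> H \<and> (\<forall>x\<in>H. w x \<in> H) \<and> (\<forall>x\<in>H. - x \<notin> H)"

text \<open>\<open>- w\<close> generates a group of order 6 acting freely on the nonzero elements; \<open>H\<close> is a union of
  \<open>w\<close>-orbits containing one element of each pair \<open>\<plusminus>x\<close>.\<close>

lemma half_set:
  "\<exists>H. 0 \<notin> H \<and> (\<forall>x\<in>H. w x \<in> H) \<and> (\<forall>x. x \<noteq> 0 \<longrightarrow> (- x \<in> H \<longleftrightarrow> x \<notin> H))"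
proof -
  have "half_closed {}" unfolding half_closed_def by simp
  moreover have "card H < Suc CARD('a)" for H :: "'a set" by (simp add: card_mono le_imp_less_Suc)
  \<comment> \<open>A largest \<open>half_closed\<close> set meets each pair of a nonzero element
    and its negative, since otherwise a whole orbit could be added.\<close>
  ultimately obtain H where H: "half_closed H" and mx: "\<And>H'. half_closed H' \<Longrightarrow> card H' \<le> card H"
    using ex_has_greatest_nat[of half_closed "{}" card "Suc CARD('a)"] by blast
  have cl: "w x \<in> H" "- x \<notin> H" if "x \<in> H" for x using H that unfolding half_closed_def by auto
  have "x \<in> H" if x: "x \<noteq> 0" "- x \<notin> H" for x
  proof (rule ccontr)
    assume "x \<notin> H"
    let ?T = "{x, w x, w (w x)}"
    have nT: "- y \<notin> H" if "y \<in> ?T" for y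
    proof
      assume "- y \<in> H"
      then have "w (- y) \<in> H" "w (w (- y)) \<in> H" using cl by blast+
      then have "- w y \<in> H" "- w (w y) \<in> H" by (simp_all only: w_minus)
      then show False using \<open>- y \<in> H\<close> that x(2) w_w_w by (metis insertE singletonD)
    qed
    have "half_closed (H \<union> ?T)"
      unfolding half_closed_def
    proof (intro conjI ballI)
      show "0 \<notin> H \<union> ?T" using H x(1) unfolding half_closed_def by (metis UnE insertE singletonD w_eq_0)
      show "w y \<in> H \<union> ?T" if "y \<in> H \<union> ?T" for y using that cl(1) w_w_w by (metis Un_iff insertCI insertE singletonD)
      show "- y \<notin> H \<union> ?T" if "y \<in> H \<union> ?T" for y
      proof
        assume h: "- y \<in> H \<union> ?T"
        show False
        proof (cases "y \<in> H")
          case True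
          then have "- y \<in> ?T" using cl h by blast
          then have "- (- y) \<notin> H" by (rule nT)
          then show False using True unfolding minus_minus by blast
        next
          case False
          then have yT: "y \<in> ?T" using that by blast
          then have "- y \<in> ?T" using nT h by blast
          then have "y + - y \<noteq> 0" by (rule orbit_sum_nonzero[OF x(1) yT])
          then show False by simp
        qed
      qed
    qed
    then have "card (H \<union> ?T) \<le> card H" by (rule mx)
    moreover have "H \<subset> H \<union> ?T" using \<open>x \<notin> H\<close> by blast
    ultimately show False using psubset_card_mono[of "H \<union> ?T" H] by (metis finite_code not_less)
  qed
  then have "- x \<in> H \<longleftrightarrow> x \<notin> H" if "x \<noteq> 0" for x using that cl by blast
  then show ?thesis using cl(1) H unfolding half_closed_def by (intro exI[of _ H] conjI) auto
qed

lemma half_set_w: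
  assumes "\<And>x. x \<in> H \<Longrightarrow> w x \<in> H"
  shows "w x \<in> H \<longleftrightarrow> x \<in> H" "- x - w x \<in> H \<longleftrightarrow> x \<in> H"
  using assms[of x] assms[of "w x"] assms[of "w (w x)"] w_w_w[of x] w_w[of x] by metis+

text \<open>The base class has the triples \<open>L x j\<close> for \<open>x \<in> H\<close> and \<open>A u 0\<close> for \<open>u \<notin> H\<close>; its translates together
  with the translation orbits of \<open>A h 0\<close>, \<open>h \<in> H\<close>, are all classes.\<close>

lemma kirkman_levels:
  assumes "2 * r + 1 = 3 * CARD('a)"
  shows "kirkman r ((UNIV :: 'a set) \<times> {..<3::nat})"
proof -
  obtain H where H': "0 \<notin> H" "\<forall>x\<in>H. w x \<in> H" "\<forall>x. x \<noteq> 0 \<longrightarrow> (- x \<in> H \<longleftrightarrow> x \<notin> H)"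
    using half_set by (elim exE conjE)
  note H = H'(1) H'(2)[rule_format] H'(3)[rule_format]
  note Hw = half_set_w[OF H(2)]
  let ?X = "(UNIV :: 'a set) \<times> {..<3::nat}"
  \<comment> \<open>\<open>pw j\<close> is the power w^j. The last branch serves
    \<open>pw 3\<close>, as w^3 = 1, so that \<open>pw (3 - j)\<close> inverts \<open>pw j\<close>
    also for \<open>j = 0\<close>.\<close>
  define pw where "pw j x = (if j = 0 then x else if j = 1 then w x else if j = 2 then w (w x) else x)"
    for j :: nat and x
  define A where "A u c = {(u + c, 0::nat), (w u + c, 1), (w (w u) + c, 2)}" for u c :: 'a
  define L where "L x j = {(x, j), (w x, j), (w (w x), j)}" for x :: 'a and j :: nat
  \<comment> \<open>\<open>T p\<close> is the triple of the base class through \<open>p\<close>; for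
    \<open>p = (x, j)\<close> off \<open>H\<close>, the parameter \<open>u\<close> with w^j u = x is
    \<open>pw (3 - j) x\<close>.\<close>
  define T where "T p = (if fst p \<in> H then L (fst p) (snd p) else A (pw (3 - snd p) (fst p)) 0)" for p
  define S where "S c = map_prod (\<lambda>x. x + c) (id :: nat \<Rightarrow> nat)" for c :: 'a
  define R where "R c = (`) (S c) ` T ` ?X" for c
  \<comment> \<open>The translate of \<open>A h 0\<close> that contains \<open>p\<close> is the one
    by \<open>fst p - pw (snd p) h\<close>.\<close>
  define Q where "Q h = (\<lambda>p. A h (fst p - pw (snd p) h)) ` ?X" for h
  have lt3: "j = 0 \<or> j = 1 \<or> j = 2" if "j < 3" for j :: nat using that by auto
  have pwH: "pw j x \<in> H \<longleftrightarrow> x \<in> H" for j x unfolding pw_def using Hw by auto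
  have pwinv: "pw (3 - j) (pw j x) = x" "pw j (pw (3 - j) x) = x" if "j < 3" for j x
    using lt3[OF that] unfolding pw_def by auto
  have Apw: "A u c = (\<lambda>j. (pw j u + c, j)) ` {..<3}" for u c
    unfolding A_def pw_def by (auto simp: numeral_3_eq_3 lessThan_Suc)
  have cardA: "card (A u c) = 3" for u c unfolding A_def by simp
  have cardL: "card (L x j) = 3" if "x \<in> H" for x j
  proof -
    have "x \<noteq> 0" using that H(1) by auto
    then show ?thesis using w_ne_double[of x] unfolding L_def by auto
  qed
  have LT: "L y j = L x j" if "(y, j) \<in> L x j" for x y j
    using that unfolding L_def by auto
  have base: "triple_partition ?X (T ` ?X)"
  proof (rule triple_partition_fun)
    fix p assume p: "p \<in> ?X"
    obtain x j where xj: "p = (x, j)" "j < 3" using p by auto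
    show "p \<in> T p \<and> T p \<subseteq> ?X \<and> card (T p) = 3"
    proof (cases "x \<in> H")
      case True
      then show ?thesis using xj cardL by (auto simp: T_def L_def)
    next
      case False
      then have Tp: "T p = A (pw (3 - j) x) 0" using xj by (simp add: T_def)
      have "p \<in> A (pw (3 - j) x) 0" unfolding Apw using xj pwinv(2)[OF xj(2), of x] by (auto simp: image_iff)
      moreover have "A (pw (3 - j) x) 0 \<subseteq> ?X" unfolding Apw by auto
      ultimately show ?thesis using Tp cardA by simp
    qed
    fix q assume q: "q \<in> T p"
    show "T q = T p"
    proof (cases "x \<in> H")
      case True
      then have "q \<in> L x j" using q xj by (simp add: T_def)
      moreover from this obtain y where "q = (y, j)" "y \<in> H" using True Hw unfolding L_def by auto
      ultimately show ?thesis using LT[of y j x] True xj by (simp add: T_def)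
    next
      case False
      define u where "u = pw (3 - j) x"
      have Tp: "T p = A u 0" using xj False by (simp add: T_def u_def)
      then obtain i where i: "i < 3" "q = (pw i u, i)" using q unfolding Apw by auto
      have "pw i u \<notin> H" unfolding pwH u_def using False .
      then show ?thesis using i pwinv(1)[OF i(1), of u] Tp by (simp add: T_def)
    qed
  qed
  have injS: "inj (S c)" for c unfolding S_def by (auto simp: inj_on_def)
  have R: "triple_partition ?X (R c)" for c
  proof -
    have "S c ` ?X = ?X"
    proof
      show "?X \<subseteq> S c ` ?X"
      proof
        fix p assume "p \<in> ?X"
        then obtain x j where "p = (x, j)" "j < 3" by auto
        then have "p = S c (x - c, j)" "(x - c, j) \<in> ?X" by (auto simp: S_def)
        then show "p \<in> S c ` ?X" by (rule image_eqI)
      qed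
    qed (auto simp: S_def)
    then show ?thesis
      using triple_partition_image[OF base inj_on_subset[OF injS subset_UNIV], of c] unfolding R_def by simp
  qed
  have Q: "triple_partition ?X (Q h)" for h
    unfolding Q_def
  proof (rule triple_partition_fun)
    fix p assume p: "p \<in> ?X"
    obtain x j where xj: "p = (x, j)" "j < 3" using p by auto
    show "p \<in> A h (fst p - pw (snd p) h) \<and> A h (fst p - pw (snd p) h) \<subseteq> ?X \<and> card (A h (fst p - pw (snd p) h)) = 3"
      using xj cardA unfolding Apw by (auto simp: image_iff)
    fix q assume "q \<in> A h (fst p - pw (snd p) h)"
    then show "A h (fst q - pw (snd q) h) = A h (fst p - pw (snd p) h)" unfolding Apw by auto
  qed
  have SL: "(x, j) \<in> S (x - u) ` L u j \<and> (y, j) \<in> S (x - u) ` L u j" if "w u - u = y - x" for x y u j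
  proof
    show "(x, j) \<in> S (x - u) ` L u j" by (rule image_eqI[of _ _ "(u, j)"]) (auto simp: S_def L_def)
    have "w u + (x - u) = y" using that by (simp add: algebra_simps)
    then show "(y, j) \<in> S (x - u) ` L u j" by (intro image_eqI[of _ _ "(w u, j)"]) (auto simp: S_def L_def)
  qed
  have inR: "S c ` L u j \<in> R c" if "u \<in> H" "j < 3" for c u j
  proof -
    have "T (u, j) \<in> T ` ?X" using that by blast
    then show ?thesis using that unfolding R_def T_def by auto
  qed
  have cover_level: "\<exists>P\<in>range R. \<exists>B\<in>P. (x, j) \<in> B \<and> (y, j) \<in> B" if "x \<noteq> y" "j < 3" for x y j
  proof -
    obtain u where u: "w u - u = y - x" using surj_w_minus_id by blast
    then have "u \<noteq> 0" using that by auto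
    \<comment> \<open>If only \<open>- u\<close> lies in \<open>H\<close>, it produces the opposite
      difference, and \<open>x\<close> and \<open>y\<close> change roles.\<close>
    then consider "u \<in> H" | "- u \<in> H" using H(3) by blast
    then show ?thesis
    proof cases
      case 1
      then show ?thesis using SL[OF u, of j] inR[OF 1 that(2), of "x - u"]
        by (intro coverI[OF rangeI[of R "x - u"], of "S (x - u) ` L u j"]) (elim conjE, assumption)+
    next
      case 2
      have u': "w (- u) - (- u) = x - y" using u by (simp add: algebra_simps)
      show ?thesis using SL[OF u', of j] inR[OF 2 that(2), of "y - - u"]
        by (intro coverI[OF rangeI[of R "y - - u"], of "S (y - - u) ` L (- u) j"]) (elim conjE, assumption)+
    qed
  qed
  \<comment> \<open>On two different levels w^i - w^j is injective, hence bijective, so the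
    difference of the two points determines \<open>u\<close>.\<close>
  have pw_ex: "\<exists>u c. pw i u + c = x \<and> pw j u + c = y" if "i < 3" "j < 3" "i \<noteq> j" for i j x y
  proof -
    have inj: "u = 0" if "pw i u = pw j u" for u
    proof (rule ccontr)
      assume "u \<noteq> 0"
      then show False using that lt3[OF \<open>i < 3\<close>] lt3[OF \<open>j < 3\<close>] \<open>i \<noteq> j\<close> w_ne_double[of u]
        unfolding pw_def by (elim disjE) auto
    qed
    have pwd: "pw k (u - v) = pw k u - pw k v" for k u v unfolding pw_def by (simp add: algebra_simps)
    have "inj (\<lambda>u. pw i u - pw j u)"
    proof (rule injI)
      fix u v assume "pw i u - pw j u = pw i v - pw j v"
      then have "pw i (u - v) = pw j (u - v)" unfolding pwd by (simp add: algebra_simps)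
      then have "u - v = 0" by (rule inj)
      then show "u = v" by simp
    qed
    then have "surj (\<lambda>u. pw i u - pw j u)" by (intro finite_UNIV_inj_surj) auto
    from surjD[OF this, of "x - y"] obtain u where "x - y = pw i u - pw j u" by (rule exE)
    then have "pw i u + (x - pw i u) = x \<and> pw j u + (x - pw i u) = y" by (simp add: algebra_simps)
    then show ?thesis by blast
  qed
  have cover_mixed: "\<exists>P\<in>range R \<union> Q ` H. \<exists>B\<in>P. (x, i) \<in> B \<and> (y, j) \<in> B" if ij: "i < 3" "j < 3" "i \<noteq> j" for x y i j
  proof -
    obtain u c where u: "pw i u + c = x" "pw j u + c = y" using pw_ex[OF ij] by blast
    have mem: "(x, i) \<in> A u c \<and> (y, j) \<in> A u c" unfolding Apw using u ij by auto
    show ?thesis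
    proof (cases "u \<in> H")
      case True
      have "A u (fst (x, i) - pw (snd (x, i)) u) \<in> Q u" unfolding Q_def by (rule imageI) (use ij in simp)
      moreover have "fst (x, i) - pw (snd (x, i)) u = c" using u by auto
      ultimately have "A u c \<in> Q u" by simp
      then show ?thesis
        using mem by (intro coverI[of "Q u" _ "A u c"] UnI2 imageI True) (elim conjE, assumption)+
    next
      case False
      have "T (u, 0) = A u 0" using False by (simp add: T_def pw_def)
      then have "S c ` A u 0 \<in> R c" unfolding R_def by (metis SigmaI UNIV_I imageI lessThan_iff zero_less_numeral)
      moreover have "S c ` A u 0 = A u c" unfolding S_def A_def by simp
      ultimately have "A u c \<in> R c" by simp
      then show ?thesis
        using mem by (intro coverI[of "R c" _ "A u c"] UnI1 rangeI) (elim conjE, assumption)+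
    qed
  qed
  \<comment> \<open>\<open>H\<close> and its negative split the nonzero elements, so the translates
    of the base class and the orbits indexed by \<open>H\<close> number
    \<open>CARD('a) + card H\<close>, which is \<open>r\<close>.\<close>
  have cardH: "CARD('a) = 1 + 2 * card H"
  proof -
    have "(UNIV :: 'a set) = insert 0 (H \<union> uminus ` H)"
    proof -
      have "x \<in> insert 0 (H \<union> uminus ` H)" for x
        using H(3)[of x] by (metis UnI1 UnI2 add.inverse_inverse imageI insertCI)
      then show ?thesis by blast
    qed
    moreover have "0 \<notin> H \<union> uminus ` H" using H(1) by auto
    moreover have "H \<inter> uminus ` H = {}"
    proof -
      have "y \<noteq> 0 \<and> - y \<notin> H" if "y \<in> H" for y using H(1) H(3)[of y] that by auto
      then show ?thesis by auto
    qed
    moreover have "card (uminus ` H) = card H" by (rule card_image) (auto simp: inj_on_def)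
    ultimately have "card (insert 0 (H \<union> uminus ` H)) = 1 + 2 * card H"
      by (subst card_insert_disjoint) (simp_all add: card_Un_disjoint)
    then show ?thesis using \<open>UNIV = insert 0 (H \<union> uminus ` H)\<close> by simp
  qed
  show ?thesis
  proof (rule kirkmanI[of _ _ "range R \<union> Q ` H"])
    show "card ?X = 2 * r + 1" using assms by simp
    have "card (range R \<union> Q ` H) \<le> card (range R) + card (Q ` H)" by (rule card_Un_le)
    also have "\<dots> \<le> CARD('a) + card H" by (intro add_mono card_image_le) auto
    finally show "card (range R \<union> Q ` H) \<le> r" using assms cardH by simp
    show "triple_partition ?X P" if "P \<in> range R \<union> Q ` H" for P using that R Q by blast
    show "\<exists>P\<in>range R \<union> Q ` H. \<exists>B\<in>P. p \<in> B \<and> q \<in> B" if pq: "p \<in> ?X" "q \<in> ?X" "p \<noteq> q" for p q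
    proof -
      obtain x i y j where xy: "p = (x, i)" "q = (y, j)" "i < 3" "j < 3" using pq by auto
      show ?thesis
      proof (cases "i = j")
        case True
        then have "x \<noteq> y" using xy pq(3) by simp
        then obtain P B where "P \<in> range R" "B \<in> P" "(x, j) \<in> B" "(y, j) \<in> B"
          using cover_level[OF _ xy(4), of x y] by blast
        then show ?thesis unfolding xy True by (intro coverI[OF UnI1])
      next
        case False
        then show ?thesis unfolding xy by (rule cover_mixed[OF xy(3,4)])
      qed
    qed
  qed auto
qed

text \<open>All classes are translates of one. The second level is scaled by \<open>(1 - w\<^sup>2) / 2\<close>, to avoid division
  by 2: \<open>t\<close> translates the two levels by \<open>t - w\<^sup>2 t\<close> and \<open>2 t\<close>.\<close>

lemma kirkman_doubled:
  "kirkman CARD('a) (UNIV :: ('a \<times> bool) option set)"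
proof -
  obtain H where H': "0 \<notin> H" "\<forall>x\<in>H. w x \<in> H" "\<forall>x. x \<noteq> 0 \<longrightarrow> (- x \<in> H \<longleftrightarrow> x \<notin> H)"
    using half_set by (elim exE conjE)
  note H = H'(1) H'(2)[rule_format] H'(3)[rule_format]
  note Hw = half_set_w[OF H(2)]
  define I :: "('a \<times> bool) option set" where "I = {None, Some (0, False), Some (0, True)}"
  define M where "M u = {Some (u, False), Some (- w (w u), False), Some (u, True)}" for u
  define L where "L z = {Some (z, True), Some (w z, True), Some (w (w z), True)}" for z
  \<comment> \<open>On the lower level a point \<open>x\<close> outside \<open>H\<close> is the
    second point of \<open>M u\<close> with -w^2 u = x, that is \<open>u = - w x\<close>.\<close>
  define T where "T p = (case p of None \<Rightarrow> I | Some (x, b) \<Rightarrow>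
    if x = 0 then I else if x \<in> H then M x else if b then L x else M (- w x))" for p
  define S where "S t = map_option (\<lambda>(x, b). (if b then x + (t + t) else x + (t - w (w t)), b))" for t
  define R where "R t = (`) (S t) ` range T" for t
  have H0: "x \<noteq> 0" if "x \<in> H" for x using that H(1) by auto
  have HN: "x \<noteq> 0 \<Longrightarrow> x \<notin> H \<Longrightarrow> - x \<in> H \<and> - w x \<in> H" for x
    using H(3)[of x] H(2)[of "- x"] by simp
  have HM: "x \<in> H \<Longrightarrow> - x \<notin> H" for x using H(3)[of x] H0 by blast
  have TI: "T None = I" "T (Some (0, b)) = I" for b unfolding T_def by simp_all
  have TM: "T (Some (u, b)) = M u" if "u \<in> H" for u b using that H0[OF that] unfolding T_def by simp
  have TL: "T (Some (z, True)) = L z" if "z \<noteq> 0" "z \<notin> H" for z using that unfolding T_def by simp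
  have TN: "T (Some (x, False)) = M (- w x)" if "x \<noteq> 0" "x \<notin> H" for x using that unfolding T_def by simp
  have base: "triple_partition UNIV (range T)"
  proof (rule triple_partition_fun)
    fix p :: "('a \<times> bool) option"
    consider "T p = I" "p \<in> I" | u where "u \<in> H" "T p = M u" "p \<in> M u" | z where "z \<noteq> 0" "z \<notin> H" "T p = L z" "p \<in> L z"
    proof (cases p)
      case None
      then show thesis using that(1) TI by (simp add: I_def)
    next
      case (Some a)
      obtain x b where a: "a = (x, b)" by (cases a)
      show thesis
      proof (cases "x = 0")
        case True
        then show thesis using that(1) TI Some a by (cases b) (simp_all add: I_def)
      next
        case x0: False
        show thesis
        proof (cases "x \<in> H")
          case True
          then show thesis using that(2)[OF True] TM[OF True] Some a by (cases b) (simp_all add: M_def)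
        next
          case xH: False
          show thesis
          proof (cases b)
            case True
            then show thesis using that(3)[OF x0 xH] TL[OF x0 xH] Some a by (simp add: L_def)
          next
            case False
            then show thesis using that(2)[of "- w x"] HN[OF x0 xH] TN[OF x0 xH] Some a by (simp add: M_def)
          qed
        qed
      qed
    qed
    then have "p \<in> T p \<and> card (T p) = 3 \<and> (\<forall>q\<in>T p. T q = T p)"
    proof cases
      case 1
      then show ?thesis using TI by (auto simp: I_def)
    next
      case (2 u)
      have u0: "u \<noteq> 0" using H0[OF 2(1)] .
      have ne: "- w (w u) \<noteq> u" using w_eq_0[of u] u0 by simp
      have nH: "- w (w u) \<notin> H" "- w (w u) \<noteq> 0" using HM[of "w (w u)"] H(2) 2(1) u0 by (blast, metis w_eq_0 neg_equal_0_iff_equal)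
      have "T (Some (- w (w u), False)) = M u" using TN[OF nH(2,1)] by simp
      then have "\<forall>q\<in>M u. T q = M u" using TM[OF 2(1)] unfolding M_def by blast
      moreover have "card (M u) = 3" using ne unfolding M_def by auto
      ultimately show ?thesis using 2 by simp
    next
      case (3 z)
      have n: "w z \<noteq> 0" "w z \<notin> H" "w (w z) \<noteq> 0" "w (w z) \<notin> H" using 3(1,2) Hw by (simp_all del: w_w add: Hw(1))
      have "L (w z) = L z" "L (w (w z)) = L z" unfolding L_def w_w_w by auto
      then have "T (Some (z, True)) = L z" "T (Some (w z, True)) = L z" "T (Some (w (w z), True)) = L z"
        using TL[OF 3(1,2)] TL[OF n(1,2)] TL[OF n(3,4)] by (simp_all only:)
      then have "\<forall>q\<in>{Some (z, True), Some (w z, True), Some (w (w z), True)}. T q = L z" by (simp del: w_w)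
      then have "\<forall>q\<in>L z. T q = L z" by (simp only: L_def[of z])
      moreover have "card (L z) = 3" using w_ne_double[OF 3(1)] 3(1) unfolding L_def by auto
      ultimately show ?thesis using 3 by simp
    qed
    note c = this[THEN conjunct1] this[THEN conjunct2, THEN conjunct1] this[THEN conjunct2, THEN conjunct2]
    show "p \<in> T p \<and> T p \<subseteq> UNIV \<and> card (T p) = 3" by (intro conjI c subset_UNIV)
    show "T q = T p" if "q \<in> T p" for q by (rule bspec[OF c(3) that])
  qed
  have injS: "inj (S t)" for t
    unfolding S_def by (rule option.inj_map) (auto simp: inj_on_def split: if_splits)
  have R: "triple_partition UNIV (R t)" for t
  proof -
    have "surj (S t)" by (rule finite_UNIV_inj_surj[OF _ injS]) simp
    then show ?thesis using triple_partition_image[OF base injS, of t] unfolding R_def by simp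
  qed
  have SF: "S t (Some (x, False)) = Some (x + (t - w (w t)), False)" and ST: "S t (Some (x, True)) = Some (x + (t + t), True)"
    and SN: "S t None = None" for t x unfolding S_def by simp_all
  have cov: "\<exists>P\<in>range R. \<exists>B\<in>P. S t p \<in> B \<and> S t q \<in> B" if "q \<in> T p" "p \<in> T p" for t p q
    by (rule coverI[of "R t" _ "S t ` T p"]) (use that in \<open>auto simp: R_def\<close>)
  have ex_F: "\<exists>t. t - w (w t) = d" for d
  proof -
    obtain u where "w (w u) - u = - d" using surj_w2_minus_id by blast
    then have "u - w (w u) = d" by (metis minus_diff_eq minus_minus)
    then show ?thesis by blast
  qed
  have cover_N: "\<exists>P\<in>range R. \<exists>B\<in>P. None \<in> B \<and> Some (x, b) \<in> B" for x b
  proof (cases b)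
    case True
    obtain t where "t + t = x" using surj_double by blast
    then show ?thesis using cov[of "Some (0, True)" None t] True by (simp add: TI I_def SN ST)
  next
    case False
    obtain t where "t - w (w t) = x" using ex_F by blast
    then show ?thesis using cov[of "Some (0, False)" None t] False by (simp add: TI I_def SN SF del: w_w)
  qed
  have cover_F: "\<exists>P\<in>range R. \<exists>B\<in>P. Some (x, False) \<in> B \<and> Some (y, False) \<in> B" if "x \<noteq> y" for x y
  proof -
    \<comment> \<open>The two lower points of \<open>M u\<close> differ by -w^2 u - u = w u.\<close>
    define u where "u = w (w (y - x))"
    have wu: "w u = y - x" unfolding u_def by (rule w_w_w)
    then have "u \<noteq> 0" using that by auto
    then consider "u \<in> H" | "- u \<in> H" using H(3) by blast
    then show ?thesis
    proof cases
      case 1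
      obtain t where t: "t - w (w t) = x - u" using ex_F by blast
      have "S t (Some (u, False)) = Some (x, False)" unfolding SF t by simp
      moreover have "- w (w u) + (x - u) = y" using wu by (simp add: algebra_simps)
      then have "S t (Some (- w (w u), False)) = Some (y, False)" unfolding SF t by simp
      ultimately show ?thesis using cov[of "Some (- w (w u), False)" "Some (u, False)" t] TM[OF 1]
        unfolding M_def by simp
    next
      case 2
      obtain t where t: "t - w (w t) = y + u" using ex_F by blast
      have "S t (Some (- u, False)) = Some (y, False)" unfolding SF t by simp
      moreover have "- w (w (- u)) + (y + u) = x" using wu by (simp add: algebra_simps)
      then have "S t (Some (- w (w (- u)), False)) = Some (x, False)" unfolding SF t by simp
      ultimately show ?thesis using cov[of "Some (- w (w (- u)), False)" "Some (- u, False)" t] TM[OF 2]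
        unfolding M_def by (simp add: conj_commute)
    qed
  qed
  have cover_T: "\<exists>P\<in>range R. \<exists>B\<in>P. Some (x, True) \<in> B \<and> Some (y, True) \<in> B" if "x \<noteq> y" for x y
  proof -
    obtain u where u: "w u - u = y - x" using surj_w_minus_id by blast
    then have u0: "u \<noteq> 0" using that by auto
    show ?thesis
    proof (cases "u \<in> H")
      case False
      obtain t where t: "t + t = x - u" using surj_double by blast
      have "w u + (x - u) = y" using u by (simp add: algebra_simps)
      then have "S t (Some (u, True)) = Some (x, True)" "S t (Some (w u, True)) = Some (y, True)" unfolding ST t by simp_all
      then show ?thesis using cov[of "Some (w u, True)" "Some (u, True)" t] TL[OF u0 False] unfolding L_def by simp
    next
      case True
      then have v: "- u \<noteq> 0" "- u \<notin> H" using HM u0 by auto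
      obtain t where t: "t + t = x + w u" using surj_double by blast
      have "- u + (x + w u) = y" using u by (simp add: algebra_simps)
      then have "S t (Some (- u, True)) = Some (y, True)" "S t (Some (w (- u), True)) = Some (x, True)"
        unfolding ST t by simp_all
      then show ?thesis using cov[of "Some (w (- u), True)" "Some (- u, True)" t] TL[OF v]
        unfolding L_def by (simp add: conj_commute)
    qed
  qed
  have cover_FT: "\<exists>P\<in>range R. \<exists>B\<in>P. Some (x, False) \<in> B \<and> Some (y, True) \<in> B" for x y
  proof -
    \<comment> \<open>\<open>D\<close> is invariant under all \<open>S t\<close>. It is 0 on
      \<open>I\<close>, while the two mixed pairs of \<open>M u\<close> have the values -w u and w
      u; as \<open>u\<close> runs through \<open>H\<close>, these are all nonzero elements.\<close>
    define D where "D = (x + x) - (y - w (w y))"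
    show ?thesis
    proof (cases "D = 0")
      case True
      obtain t where t: "t + t = y" using surj_double by blast
      have "x + x = (t - w (w t)) + (t - w (w t))" using True unfolding D_def t[symmetric] by (simp add: algebra_simps)
      then have "x = t - w (w t)" by (simp only: two_cancel)
      then have "S t (Some (0, False)) = Some (x, False)" "S t (Some (0, True)) = Some (y, True)" unfolding SF ST t by simp_all
      then show ?thesis using cov[of "Some (0, True)" "Some (0, False)" t] TI unfolding I_def by simp
    next
      case False
      define u where "u = - w (w D)"
      have Du: "D = - w u" unfolding u_def by simp
      then have "u \<noteq> 0" using False by auto
      then consider "u \<in> H" | "- u \<in> H" using H(3) by blast
      then show ?thesis
      proof cases
        case 1
        obtain t where t: "t + t = y - u" using surj_double by blast
        have y: "y = t + t + u" using t by (simp add: algebra_simps)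
        have "x + x = (u + (t - w (w t))) + (u + (t - w (w t)))"
          using Du unfolding D_def y by (simp add: algebra_simps)
        then have "x = u + (t - w (w t))" by (simp only: two_cancel)
        then have "S t (Some (u, False)) = Some (x, False)" "S t (Some (u, True)) = Some (y, True)" unfolding SF ST t by simp_all
        then show ?thesis using cov[of "Some (u, True)" "Some (u, False)" t] TM[OF 1] unfolding M_def by simp
      next
        case 2
        define v where "v = - u"
        have vH: "v \<in> H" using 2 v_def by simp
        have Dv: "D = w v" unfolding v_def Du by simp
        obtain t where t: "t + t = y - v" using surj_double by blast
        have y: "y = t + t + v" using t by (simp add: algebra_simps)
        have "x + x = (- w (w v) + (t - w (w t))) + (- w (w v) + (t - w (w t)))"
          using Dv unfolding D_def y by (simp add: algebra_simps)
        then have "x = - w (w v) + (t - w (w t))" by (simp only: two_cancel)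
        then have "S t (Some (- w (w v), False)) = Some (x, False)" "S t (Some (v, True)) = Some (y, True)"
          unfolding SF ST t by simp_all
        moreover have "T (Some (- w (w v), False)) = M v"
          using TN[of "- w (w v)"] HM[of "w (w v)"] H(2) vH H0[OF vH] by (metis w_w_w w_minus minus_minus w_eq_0 neg_equal_0_iff_equal)
        ultimately show ?thesis using cov[of "Some (v, True)" "Some (- w (w v), False)" t] unfolding M_def by simp
      qed
    qed
  qed
  have fin: "finite (UNIV :: ('a \<times> bool) option set)" by simp
  show ?thesis
  proof (rule kirkmanI[of _ _ "range R"])
    show "card (UNIV :: ('a \<times> bool) option set) = 2 * CARD('a) + 1" by (simp add: card_UNIV_option)
    show "card (range R) \<le> CARD('a)" by (rule card_image_le) simp
    show "triple_partition UNIV P" if "P \<in> range R" for P using that R by blast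
    fix p q :: "('a \<times> bool) option" assume pq: "p \<noteq> q"
    have sw: "\<exists>P\<in>range R. \<exists>B\<in>P. q \<in> B \<and> p \<in> B \<Longrightarrow> \<exists>P\<in>range R. \<exists>B\<in>P. p \<in> B \<and> q \<in> B" by (simp only: conj_commute)
    show "\<exists>P\<in>range R. \<exists>B\<in>P. p \<in> B \<and> q \<in> B"
    proof (cases p)
      case None
      then obtain y c where "q = Some (y, c)" using pq by (cases q) auto
      then show ?thesis using None cover_N by simp
    next
      case (Some a)
      obtain x b where p: "p = Some (x, b)" using Some by (cases a) simp
      show ?thesis
      proof (cases q)
        case None
        then show ?thesis using cover_N[of x b] unfolding p by (simp only: conj_commute)
      next
        case (Some a')
        obtain y c where q: "q = Some (y, c)" using Some by (cases a') simp
        show ?thesis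
        proof (cases b; cases c)
          assume "b" "c"
          then show ?thesis unfolding p q using cover_T[of x y] pq p q by simp
        next
          assume "b" "\<not> c"
          then show ?thesis unfolding p q using cover_FT[of y x] by (simp add: conj_commute)
        next
          assume "\<not> b" "c"
          then show ?thesis unfolding p q using cover_FT[of x y] by simp
        next
          assume "\<not> b" "\<not> c"
          then show ?thesis unfolding p q using cover_F[of x y] pq p q by simp
        qed
      qed
    qed
  qed (use fin in auto)
qed

end

text \<open>Deleting a point \<open>z\<close> removes one triple from each class. The other two
  points of that triple become the group missed by the class; that these groups are disjoint relies
  on the exactness obtained by counting.\<close>

lemma kirkman_frame_of_kirkman:
  assumes "kirkman r X"
  shows "kirkman_frame {..<r}"
proof -
  have X: "finite X" "card X = 2 * r + 1" using assms unfolding kirkman_def by auto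
  obtain \<P> where \<P>: "finite \<P>" "card \<P> = r" and part: "\<forall>P\<in>\<P>. triple_partition X P"
    and cov: "\<forall>x\<in>X. \<forall>y\<in>X. x \<noteq> y \<longrightarrow> (\<exists>P\<in>\<P>. \<exists>T\<in>P. x \<in> T \<and> y \<in> T)"
    and un: "\<forall>P\<in>\<P>. \<forall>P'\<in>\<P>. \<forall>T\<in>P. \<forall>T'\<in>P'. \<forall>x\<in>T \<inter> T'. \<forall>y\<in>T \<inter> T'. x \<noteq> y \<longrightarrow> P = P'"
    using kirkman_exact[OF assms] by (elim exE conjE)
  obtain z where z: "z \<in> X" using X by fastforce
  obtain p where p: "bij_betw p {..<r} \<P>"
    using ex_bij_betw_nat_finite[OF \<P>(1)] \<P>(2) by (auto simp: atLeast0LessThan)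
  have pP: "p i \<in> \<P>" if "i < r" for i using p that unfolding bij_betw_def by auto
  have pinj: "i = j" if "p i = p j" "i < r" "j < r" for i j using p that unfolding bij_betw_def inj_on_def by auto
  have P: "partition_on X (p i)" "\<And>T. T \<in> p i \<Longrightarrow> card T = 3" if "i < r" for i
    using part pP[OF that] unfolding triple_partition_def by auto
  have "\<exists>a b. {z, a, b} \<in> p i \<and> a \<noteq> b \<and> a \<noteq> z \<and> b \<noteq> z" if i: "i < r" for i
  proof -
    obtain T where T: "T \<in> p i" "z \<in> T" using partition_onD1[OF P(1)[OF i]] z by blast
    then have "card (T - {z}) = 2" using P(2)[OF i T(1)] by (simp add: card_Diff_singleton)
    then obtain a b where "T - {z} = {a, b}" "a \<noteq> b" by (auto simp: card_2_iff)
    then have "T = {z, a, b}" "a \<noteq> z" "b \<noteq> z" using T(2) by auto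
    then show ?thesis using T(1) \<open>a \<noteq> b\<close> by auto
  qed
  then obtain a b where ab: "\<And>i. i < r \<Longrightarrow> {z, a i, b i} \<in> p i \<and> a i \<noteq> b i \<and> a i \<noteq> z \<and> b i \<noteq> z" by metis
  define f where "f q = (if snd q then b (fst q) else a (fst q))" for q :: "nat \<times> bool"
  let ?G = "{..<r} \<times> (UNIV :: bool set)"
  have fT: "f q \<in> {z, a (fst q), b (fst q)}" "f q \<noteq> z" if "q \<in> ?G" for q
    using ab[of "fst q"] that unfolding f_def by auto
  have surj: "f ` ?G = X - {z}"
  proof
    show "f ` ?G \<subseteq> X - {z}"
    proof
      fix y assume "y \<in> f ` ?G"
      then obtain q where q: "q \<in> ?G" "y = f q" by auto
      have "{z, a (fst q), b (fst q)} \<subseteq> X"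
      proof -
        have "fst q < r" using q by auto
        then show ?thesis using partition_onD1[OF P(1)[of "fst q"]] ab[of "fst q"] by blast
      qed
      then show "y \<in> X - {z}" using fT[OF q(1)] q(2) by auto
    qed
    show "X - {z} \<subseteq> f ` ?G"
    proof
      fix x assume x: "x \<in> X - {z}"
      then obtain Q T where QT: "Q \<in> \<P>" "T \<in> Q" "x \<in> T" "z \<in> T" using cov z by blast
      then obtain i where i: "i < r" "Q = p i" using p unfolding bij_betw_def by auto
      have "T = {z, a i, b i}" by (rule partition_on_eqI[OF P(1)[OF i(1)], of _ _ z]) (use QT i ab[OF i(1)] in auto)
      then have "x = a i \<or> x = b i" using x QT by auto
      then show "x \<in> f ` ?G"
      proof
        assume "x = a i" then show ?thesis using i by (intro image_eqI[of _ _ "(i, False)"]) (auto simp: f_def)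
      next
        assume "x = b i" then show ?thesis using i by (intro image_eqI[of _ _ "(i, True)"]) (auto simp: f_def)
      qed
    qed
  qed
  \<comment> \<open>Domain and image both have \<open>2 * r\<close> elements, so surjectivity
    suffices.\<close>
  have inj: "inj_on f ?G"
    by (rule eq_card_imp_inj_on) (use surj X z in \<open>simp_all add: card_cartesian_product\<close>)
  define h where "h = inv_into ?G f"
  have hf: "h (f q) = q" if "q \<in> ?G" for q unfolding h_def using inj that by (rule inv_into_f_f)
  have hinj: "inj_on h (X - {z})" unfolding h_def surj[symmetric] by (rule inj_on_inv_into) simp
  define T where "T i = {z, a i, b i}" for i
  define Q where "Q i = (`) h ` (p i - {T i})" for i
  show ?thesis
  proof (rule kirkman_frameI[of _ Q])
    fix i assume "i \<in> {..<r}"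
    then have i: "i < r" by simp
    have "triple_partition (X - T i) (p i - {T i})"
      unfolding triple_partition_def
    proof (intro conjI ballI)
      show "partition_on (X - T i) (p i - {T i})"
      proof (rule partition_onI)
        show "\<Union> (p i - {T i}) = X - T i"
        proof -
          have "T i \<in> p i" using ab[OF i] unfolding T_def by simp
          then have "A \<inter> T i = {}" if "A \<in> p i" "A \<noteq> T i" for A
            using partition_onD2[OF P(1)[OF i]] that unfolding disjoint_def by auto
          then show ?thesis using partition_onD1[OF P(1)[OF i]] by blast
        qed
        show "{} \<notin> p i - {T i}" using partition_onD3[OF P(1)[OF i]] by simp
        show "disjnt A B" if "A \<in> p i - {T i}" "B \<in> p i - {T i}" "A \<noteq> B" for A B
          using partition_onD2[OF P(1)[OF i]] that unfolding disjoint_def disjnt_def by auto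
      qed
      show "card A = 3" if "A \<in> p i - {T i}" for A using P(2)[OF i] that by simp
    qed
    then have "triple_partition (h ` (X - T i)) (Q i)"
      unfolding Q_def by (rule triple_partition_image) (rule inj_on_subset[OF hinj], auto simp: T_def)
    moreover have "h ` (X - T i) = ({..<r} - {i}) \<times> UNIV"
    proof -
      have "T i - {z} = f ` ({i} \<times> UNIV)"
        using ab[OF i] unfolding T_def f_def by (auto simp: UNIV_bool)
      moreover have "X - T i = (X - {z}) - (T i - {z})" unfolding T_def by auto
      ultimately have "X - T i = f ` ?G - f ` ({i} \<times> UNIV)" using surj by simp
      also have "\<dots> = f ` (?G - {i} \<times> UNIV)" by (rule inj_on_image_set_diff[OF inj, symmetric]) (use i in auto)
      finally have "h ` (X - T i) = (\<lambda>q. h (f q)) ` (?G - {i} \<times> UNIV)" by (simp add: image_image)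
      also have "\<dots> = (\<lambda>q. q) ` (?G - {i} \<times> UNIV)" by (rule image_cong) (use hf in auto)
      also have "\<dots> = ({..<r} - {i}) \<times> UNIV" by auto
      finally show ?thesis .
    qed
    ultimately show "triple_partition (({..<r} - {i}) \<times> UNIV) (Q i)" by simp
  next
    fix i j :: nat and c d :: bool assume "i \<in> {..<r}" "j \<in> {..<r}" "i \<noteq> j"
    then have ij: "i < r" "j < r" "i \<noteq> j" by auto
    define x y where "x = f (i, c)" and "y = f (j, d)"
    have q: "(i, c) \<in> ?G" "(j, d) \<in> ?G" using ij by auto
    have xy: "x \<in> X" "y \<in> X" "x \<noteq> z" "y \<noteq> z" using surj q unfolding x_def y_def by blast+
    have "x \<noteq> y" using inj_onD[OF inj, OF _ q] ij(3) unfolding x_def y_def by auto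
    then obtain R A where RA: "R \<in> \<P>" "A \<in> R" "x \<in> A" "y \<in> A" using cov xy by blast
    then obtain k where k: "k < r" "R = p k" using p unfolding bij_betw_def by auto
    \<comment> \<open>Otherwise \<open>T k\<close> shares the pair \<open>x\<close>,
      \<open>z\<close> with \<open>T i\<close> and the pair \<open>y\<close>, \<open>z\<close> with
      \<open>T j\<close>, which forces \<open>i = k = j\<close>.\<close>
    have "A \<noteq> T k"
    proof
      assume A: "A = T k"
      have Tp: "T l \<in> p l" if "l < r" for l using ab[OF that] unfolding T_def by simp
      have zT: "z \<in> T l" for l unfolding T_def by simp
      have xT: "x \<in> T i" "y \<in> T j" using fT(1)[OF q(1)] fT(1)[OF q(2)] unfolding x_def y_def T_def by simp_all
      have "p k = p i"
        by (rule un[rule_format, OF pP[OF k(1)] pP[OF ij(1)] Tp[OF k(1)] Tp[OF ij(1)], of x z])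
          (use RA A xT zT xy in auto)
      moreover have "p k = p j"
        by (rule un[rule_format, OF pP[OF k(1)] pP[OF ij(2)] Tp[OF k(1)] Tp[OF ij(2)], of y z])
          (use RA A xT zT xy in auto)
      ultimately show False using pinj[of i j] ij by simp
    qed
    then have "h ` A \<in> Q k" unfolding Q_def using RA k by blast
    moreover have "(i, c) \<in> h ` A" "(j, d) \<in> h ` A"
      using imageI[OF RA(3), of h] imageI[OF RA(4), of h] hf[OF q(1)] hf[OF q(2)] unfolding x_def y_def by simp_all
    ultimately show "\<exists>k\<in>{..<r}. \<exists>A\<in>Q k. (i, c) \<in> A \<and> (j, d) \<in> A"
      using k(1) by (intro bexI[of _ k] bexI[of _ "h ` A"] conjI) auto
  qed
qed

text \<open>\<open>kts t\<close> amounts to the existence of a Kirkman triple system on \<open>6t + 3\<close> points.\<close>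

definition kts :: "nat \<Rightarrow> bool" where
  "kts t \<longleftrightarrow> kirkman_frame {..<3 * t + 1}"

lemma kts_of_kirkman: "kirkman (3 * t + 1) X \<Longrightarrow> kts t"
  unfolding kts_def by (rule kirkman_frame_of_kirkman)

lemma kirkman_of_kts:
  assumes "kts t" "finite X" "card X = 6 * t + 3"
  shows "kirkman (3 * t + 1) X"
proof -
  have "kirkman (3 * t + 1) (insert None (Some ` ({..<3 * t + 1} \<times> (UNIV :: bool set))))"
    using kirkman_of_frame[OF assms(1)[unfolded kts_def] finite_lessThan] by (simp only: card_lessThan)
  then show ?thesis by (rule kirkman_card[OF _ assms(2)]) (simp add: assms(3))
qed

lemma kirkman_frame_kts:
  assumes "kts t" "finite B" "card B = 3 * t + 1"
  shows "kirkman_frame B"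
  using kirkman_frame_card[OF _ assms(2)] assms unfolding kts_def by simp

lemma kts_of_frame: "kirkman_frame B \<Longrightarrow> finite B \<Longrightarrow> card B = 3 * t + 1 \<Longrightarrow> kts t"
  using kts_of_kirkman kirkman_of_frame by metis

lemma kts_0: "kts 0"
  unfolding kts_def using kirkman_frame_1 by simp

text \<open>\<open>d\<close> and \<open>e\<close> are inverses of \<open>c - 1\<close> and 2.
  Supplied as numerals, they reduce the axioms of \<open>cube_root\<close> to three evaluations in a
  concrete ring.\<close>

lemma cube_root_mult:
  fixes c d e :: "'a::{finite,comm_ring_1}"
  assumes "c * c + c + 1 = 0" "d * (c - 1) = 1" "e * 2 = 1"
  shows "cube_root (\<lambda>x. c * x)"
proof
  show "c * (x + y) = c * x + c * y" for x y by (simp add: algebra_simps)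
  show "c * (c * x) + c * x + x = 0" for x
  proof -
    have "c * (c * x) + c * x + x = (c * c + c + 1) * x" by (simp add: algebra_simps)
    then show ?thesis using assms(1) by simp
  qed
  show "x = 0" if "c * x = x" for x
  proof -
    have "x = (d * (c - 1)) * x" using assms(2) by simp
    also have "\<dots> = d * (c * x - x)" by (simp add: algebra_simps)
    finally show ?thesis using that by simp
  qed
  show "x = 0" if "x + x = 0" for x :: 'a
  proof -
    have "x = (e * 2) * x" using assms(3) by simp
    also have "\<dots> = e * (x + x)" by (simp add: algebra_simps)
    finally show ?thesis using that by simp
  qed
qed

section \<open>Concrete groups: three copies of one of odd order, or two copies and a point at
  infinity\<close>

lemma kts_levels:
  assumes "cube_root (w :: 'a::{finite,ab_group_add} \<Rightarrow> 'a)" "CARD('a) = 2 * t + 1"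
  shows "kts t"
  by (rule kts_of_kirkman[OF cube_root.kirkman_levels[OF assms(1)]]) (use assms(2) in simp)

lemma kts_doubled:
  assumes "cube_root (w :: 'a::{finite,ab_group_add} \<Rightarrow> 'a)" "CARD('a) = 3 * t + 1"
  shows "kts t"
  by (rule kts_of_kirkman) (use cube_root.kirkman_doubled[OF assms(1)] assms(2) in simp)

lemma cube_root_7: "cube_root (\<lambda>x::7. 2 * x)"
  by (rule cube_root_mult[of _ 1 4]) simp_all

lemma cube_root_43: "cube_root (\<lambda>x::43. 6 * x)"
  by (rule cube_root_mult[of _ 26 22]) simp_all

lemma cube_root_79: "cube_root (\<lambda>x::79. 23 * x)"
  by (rule cube_root_mult[of _ 18 40]) simp_all

text \<open>The companion matrix of the polynomial X^2 + X + 1. It has no root modulo 5, as 5 is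
  congruent to 2 modulo 3, so the field with 25 elements is used through its additive group.\<close>

lemma cube_root_25: "cube_root (\<lambda>(a, b). (- b, a - b) :: 5 \<times> 5)"
proof
  have five: "x + x = 0 \<longleftrightarrow> x = 0" "x + x + x = 0 \<longleftrightarrow> x = 0" for x :: 5
  proof -
    have "(5 :: 5) = 0" by simp
    then have "x * 5 = 0" by (simp only: mult_zero_right)
    \<comment> \<open>Both use that 6 is 1 modulo 5.\<close>
    then have "x = 3 * (x + x)" "x = 2 * (x + x + x)" by (simp_all add: algebra_simps)
    then show "x + x = 0 \<longleftrightarrow> x = 0" "x + x + x = 0 \<longleftrightarrow> x = 0" by (metis mult_zero_right add_0)+
  qed
  show "x = 0" if "x + x = 0" for x :: "5 \<times> 5" using that five by (cases x) (simp add: zero_prod_def)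
  show "x = 0" if "(case x of (a, b) \<Rightarrow> (- b, a - b)) = x" for x :: "5 \<times> 5"
  proof -
    obtain a b where x: "x = (a, b)" by (cases x)
    then have "a = - b" "a - b = b" using that by auto
    then have "b + b + b = 0" by (simp add: algebra_simps)
    then show ?thesis using x \<open>a = - b\<close> five by (simp add: zero_prod_def)
  qed
qed (auto simp: algebra_simps zero_prod_def split: prod.splits)

lemma kts_2: "kts 2" by (rule kts_doubled[OF cube_root_7]) simp
lemma kts_3: "kts 3" by (rule kts_levels[OF cube_root_7]) simp
lemma kts_6: "kts 6" by (rule kts_levels[OF cube_root_mult[of "3 :: 13" 7 7]]) simp_all
lemma kts_8: "kts 8" by (rule kts_doubled[OF cube_root_25]) simp
lemma kts_9: "kts 9" by (rule kts_levels[OF cube_root_mult[of "7 :: 19" 16 10]]) simp_all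
lemma kts_14: "kts 14" by (rule kts_doubled[OF cube_root_43]) simp
lemma kts_15: "kts 15" by (rule kts_levels[OF cube_root_mult[of "5 :: 31" 8 16]]) simp_all
lemma kts_18: "kts 18" by (rule kts_levels[OF cube_root_mult[of "10 :: 37" 33 19]]) simp_all
lemma kts_26: "kts 26" by (rule kts_doubled[OF cube_root_79]) simp
lemma kts_36: "kts 36" by (rule kts_levels[OF cube_root_mult[of "8 :: 73" 21 37]]) simp_all
lemma kts_39: "kts 39" by (rule kts_levels[OF cube_root_79]) simp

section \<open>Products\<close>

lemma mod_interval: "(m::int) > 0 \<Longrightarrow> x mod m \<in> {0..<m}"
  by simp

text \<open>Over each triple of a class other than \<open>P0\<close>, the lines of slope a over the
  integers modulo 2t + 1 give one class for every a. Over a triple of \<open>P0\<close> there are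
  3(2t + 1) = 6t + 3 points, which receive a copy of the system on \<open>Y\<close>. The classes
  number 3s(2t + 1) + 3t + 1 = 3u + 1.\<close>

lemma kirkman_product:
  fixes X :: "'a set" and Y :: "'b set"
  assumes X: "kirkman (3 * s + 1) X" and Y: "kirkman (3 * t + 1) Y"
    and u: "2 * u + 1 = (2 * s + 1) * (2 * t + 1)"
  shows "kirkman (3 * u + 1) (X \<times> {0..<int (2 * t + 1)})"
proof -
  let ?m = "int (2 * t + 1)"
  let ?Z = "{0..<?m}"
  let ?W = "X \<times> ?Z"
  have m: "?m > 0" "odd ?m" by simp_all
  have cardZ: "card ?Z = 2 * t + 1" by (simp only: card_atLeastLessThan_int diff_zero nat_int)
  obtain \<P> where fX: "finite X" "card X = 2 * (3 * s + 1) + 1" and \<P>: "finite \<P>" "card \<P> \<le> 3 * s + 1"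
    and P: "\<And>P. P \<in> \<P> \<Longrightarrow> triple_partition X P"
    and Pcov: "\<And>x y. x \<in> X \<Longrightarrow> y \<in> X \<Longrightarrow> x \<noteq> y \<Longrightarrow> \<exists>P\<in>\<P>. \<exists>T\<in>P. x \<in> T \<and> y \<in> T"
    using X unfolding kirkman_def by metis
  obtain \<Y> where fY: "finite Y" "card Y = 2 * (3 * t + 1) + 1" and \<Y>: "finite \<Y>" "card \<Y> \<le> 3 * t + 1"
    and Q: "\<And>P. P \<in> \<Y> \<Longrightarrow> triple_partition Y P"
    and Qcov: "\<And>x y. x \<in> Y \<Longrightarrow> y \<in> Y \<Longrightarrow> x \<noteq> y \<Longrightarrow> \<exists>P\<in>\<Y>. \<exists>T\<in>P. x \<in> T \<and> y \<in> T"
    using Y unfolding kirkman_def by metis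
  have "\<exists>x y. x \<in> X \<and> y \<in> X \<and> x \<noteq> y"
  proof (rule ccontr)
    assume "\<not> ?thesis"
    then have "card X \<le> 1" by (metis card_le_Suc0_iff_eq fX(1) One_nat_def)
    then show False using fX(2) by simp
  qed
  then obtain P0 where P0: "P0 \<in> \<P>" using Pcov by blast
  have part: "T \<subseteq> X" "card T = 3" "finite T" if "P \<in> \<P>" "T \<in> P" for P T
  proof -
    show "T \<subseteq> X" "card T = 3" using P[OF that(1)] that(2) unfolding triple_partition_def partition_on_def by auto
    then show "finite T" using fX(1) finite_subset by blast
  qed
  have Tdisj: "T \<inter> T' = {}" if "P \<in> \<P>" "T \<in> P" "T' \<in> P" "T \<noteq> T'" for P T T'
    using P[OF that(1)] that(2-) unfolding triple_partition_def partition_on_def disjoint_def by auto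
  have Tun: "\<Union>P = X" if "P \<in> \<P>" for P
    using P[OF that] unfolding triple_partition_def partition_on_def by auto
  have "\<exists>f. card T = 3 \<longrightarrow> bij_betw f T {0, 1, 2::int}" for T :: "'a set"
  proof (cases "card T = 3")
    case True
    then have "finite T" using card.infinite by fastforce
    moreover have "card T = card {0, 1, 2::int}" using True by simp
    ultimately show ?thesis using finite_same_card_bij[of T "{0, 1, 2::int}"] by blast
  qed simp
  then obtain f where f: "\<And>T::'a set. card T = 3 \<Longrightarrow> bij_betw (f T) T {0, 1, 2::int}" by metis
  \<comment> \<open>The line of slope \<open>a\<close> through \<open>p\<close>, with the labels 0,
    1, 2 of the points of \<open>T\<close> as abscissas.\<close>
  define B where "B T a p = (\<lambda>y. (y, (snd p + (f T y - f T (fst p)) * a) mod ?m)) ` T" for T a and p :: "'a \<times> int"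
  define C where "C P a = (\<Union>T\<in>P. B T a ` (T \<times> ?Z))" for P a
  have B: "triple_partition (T \<times> ?Z) (B T a ` (T \<times> ?Z))" if "card T = 3" for T a
  proof (rule triple_partition_fun)
    fix p assume p: "p \<in> T \<times> ?Z"
    obtain x j where xj: "p = (x, j)" "x \<in> T" "0 \<le> j" "j < ?m" using p by auto
    have "p \<in> B T a p" unfolding B_def by (rule image_eqI[of _ _ x]) (use xj in auto)
    moreover have "B T a p \<subseteq> T \<times> ?Z" unfolding B_def using mod_interval[OF m(1)] by auto
    moreover have "card (B T a p) = 3" unfolding B_def using that by (subst card_image) (auto simp: inj_on_def)
    ultimately show "p \<in> B T a p \<and> B T a p \<subseteq> T \<times> ?Z \<and> card (B T a p) = 3" by blast
    fix q assume "q \<in> B T a p"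
    then obtain y where y: "y \<in> T" "q = (y, (j + (f T y - f T x) * a) mod ?m)" unfolding B_def xj(1) by auto
    have "((j + (f T y - f T x) * a) mod ?m + (f T z - f T y) * a) mod ?m = (j + (f T z - f T x) * a) mod ?m" for z
    proof -
      have "((j + (f T y - f T x) * a) mod ?m + (f T z - f T y) * a) mod ?m
        = ((j + (f T y - f T x) * a) + (f T z - f T y) * a) mod ?m" by (rule mod_add_left_eq)
      also have "(j + (f T y - f T x) * a) + (f T z - f T y) * a = j + (f T z - f T x) * a" by (simp add: algebra_simps)
      finally show ?thesis .
    qed
    then show "B T a q = B T a p" unfolding B_def xj(1) y(2) by (intro image_cong refl) simp
  qed
  have TZ: "(\<Union>T\<in>P. T \<times> ?Z) = ?W" if "P \<in> \<P>" for P using Tun[OF that] by blast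
  have C: "triple_partition ?W (C P a)" if P: "P \<in> \<P>" for P a
  proof -
    have "triple_partition (\<Union>T\<in>P. T \<times> ?Z) (C P a)"
      unfolding C_def
    proof (rule triple_partition_UN)
      show "triple_partition (T \<times> ?Z) (B T a ` (T \<times> ?Z))" if "T \<in> P" for T by (rule B[OF part(2)[OF P that]])
      show "T \<times> ?Z \<inter> T' \<times> ?Z = {}" if "T \<in> P" "T' \<in> P" "T \<noteq> T'" for T T' using Tdisj[OF P that] by auto
    qed
    then show ?thesis using TZ[OF P] by simp
  qed
  have "\<exists>g. bij_betw g Y (T \<times> ?Z)" if T: "T \<in> P0" for T
  proof -
    have "card Y = card (T \<times> ?Z)" unfolding card_cartesian_product cardZ using part(2)[OF P0 T] fY(2) by simp
    then show ?thesis using finite_same_card_bij[OF fY(1), of "T \<times> ?Z"] part(3)[OF P0 T] by simp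
  qed
  then obtain g where g: "\<And>T. T \<in> P0 \<Longrightarrow> bij_betw (g T) Y (T \<times> ?Z)" by metis
  define D where "D R = (\<Union>T\<in>P0. (`) (g T) ` R)" for R
  have D: "triple_partition ?W (D R)" if "R \<in> \<Y>" for R
  proof -
    have "triple_partition (\<Union>T\<in>P0. T \<times> ?Z) (D R)"
      unfolding D_def
    proof (rule triple_partition_UN)
      show "triple_partition (T \<times> ?Z) ((`) (g T) ` R)" if "T \<in> P0" for T
        using triple_partition_image[OF Q[OF \<open>R \<in> \<Y>\<close>], of "g T"] g[OF that] unfolding bij_betw_def by simp
      show "T \<times> ?Z \<inter> T' \<times> ?Z = {}" if "T \<in> P0" "T' \<in> P0" "T \<noteq> T'" for T T' using Tdisj[OF P0 that] by auto
    qed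
    then show ?thesis using TZ[OF P0] by simp
  qed
  let ?C = "(\<lambda>(P, a). C P a) ` ((\<P> - {P0}) \<times> ?Z)"
  have cardW: "card ?W = 2 * (3 * u + 1) + 1"
  proof -
    have "card ?W = (6 * s + 3) * (2 * t + 1)" unfolding card_cartesian_product cardZ using fX(2) by (simp add: algebra_simps)
    also have "\<dots> = 3 * (2 * u + 1)" unfolding u by (simp add: algebra_simps)
    finally show ?thesis by simp
  qed
  have cov1: "\<exists>R\<in>?C. \<exists>A\<in>R. p \<in> A \<and> q \<in> A"
    if pq: "p = (x, i)" "q = (y, j)" "i \<in> ?Z" "j \<in> ?Z" "x \<noteq> y" "x \<in> T" "y \<in> T" "T \<in> P" "P \<in> \<P>" "P \<noteq> P0"
    for p q x i y j T P
  proof -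
    define d where "d = f T y - f T x"
    have fT: "bij_betw (f T) T {0, 1, 2}" using f part(2) pq by blast
    have "f T x \<noteq> f T y" using fT pq unfolding bij_betw_def inj_on_def by blast
    moreover have "f T x \<in> {0, 1, 2}" "f T y \<in> {0, 1, 2}" using fT pq unfolding bij_betw_def by blast+
    \<comment> \<open>Labels differ by at most 2, so the odd modulus makes \<open>d\<close>
      invertible and a slope joining the two points exists.\<close>
    ultimately have "d \<in> {1, -1, 2, -2}" unfolding d_def by auto
    moreover have "coprime (2::int) ?m" by (rule coprime_left_2_iff_odd[THEN iffD2, OF m(2)])
    ultimately have "coprime d ?m" by (auto simp: coprime_minus_left_iff)
    then obtain v where v: "[d * v = 1] (mod ?m)" using cong_solve_coprime_int by blast
    define a where "a = (v * (j - i)) mod ?m"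
    have "[i + d * a = j] (mod ?m)"
    proof -
      have "[a = v * (j - i)] (mod ?m)" unfolding a_def by simp
      then have "[i + d * a = i + d * (v * (j - i))] (mod ?m)" by (intro cong_add cong_mult cong_refl)
      also have "i + d * (v * (j - i)) = i + (d * v) * (j - i)" by simp
      also have "[\<dots> = i + 1 * (j - i)] (mod ?m)" using v by (intro cong_add cong_mult cong_refl)
      finally show ?thesis by simp
    qed
    then have ij: "(i + d * a) mod ?m = j" using pq(4) unfolding cong_def by simp
    have aZ: "a \<in> ?Z" unfolding a_def by (rule mod_interval[OF m(1)])
    show ?thesis
    proof (rule coverI[of "C P a" _ "B T a (x, i)"])
      show "C P a \<in> ?C" using pq aZ by (intro image_eqI[of _ _ "(P, a)"]) auto
      show "B T a (x, i) \<in> C P a" unfolding C_def using pq by blast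
      show "p \<in> B T a (x, i)" unfolding B_def pq(1) by (rule image_eqI[of _ _ x]) (use pq in auto)
      show "q \<in> B T a (x, i)" unfolding B_def pq(2) by (rule image_eqI[of _ _ y]) (use pq ij d_def in auto)
    qed
  qed
  have cov0: "\<exists>R\<in>D ` \<Y>. \<exists>A\<in>R. p \<in> A \<and> q \<in> A"
    if pq: "p \<in> T \<times> ?Z" "q \<in> T \<times> ?Z" "p \<noteq> q" "T \<in> P0" for p q T
  proof -
    obtain x y where xy: "x \<in> Y" "y \<in> Y" "p = g T x" "q = g T y"
    proof -
      have "g T ` Y = T \<times> ?Z" using g[OF pq(4)] unfolding bij_betw_def by (rule conjunct2)
      then have "p \<in> g T ` Y" "q \<in> g T ` Y" using pq(1,2) by (simp_all only:)
      then show thesis using that by blast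
    qed
    then have "x \<noteq> y" using pq(3) by auto
    then obtain R A where RA: "R \<in> \<Y>" "A \<in> R" "x \<in> A" "y \<in> A" using Qcov xy by blast
    show ?thesis
    proof (rule coverI[of "D R" _ "g T ` A"])
      show "g T ` A \<in> D R" unfolding D_def using pq(4) RA by blast
    qed (use RA xy in auto)
  qed
  show ?thesis
  proof (rule kirkmanI[of _ _ "?C \<union> D ` \<Y>"])
    show "card ?W = 2 * (3 * u + 1) + 1" by (rule cardW)
    show "finite ?W" "finite (?C \<union> D ` \<Y>)" using fX(1) \<P>(1) \<Y>(1) by auto
    have "card (?C \<union> D ` \<Y>) \<le> card ?C + card (D ` \<Y>)" by (rule card_Un_le)
    also have "\<dots> \<le> card ((\<P> - {P0}) \<times> ?Z) + card \<Y>"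
      using \<P>(1) \<Y>(1) by (intro add_mono card_image_le) auto
    also have "card ((\<P> - {P0}) \<times> ?Z) = (card \<P> - 1) * (2 * t + 1)"
      unfolding card_cartesian_product cardZ using P0 \<P>(1) by simp
    also have "\<dots> + card \<Y> \<le> (3 * s) * (2 * t + 1) + (3 * t + 1)"
      using \<P>(2) \<Y>(2) by (intro add_mono mult_right_mono) auto
    also have "\<dots> = 3 * u + 1" using u by (simp add: algebra_simps)
    finally show "card (?C \<union> D ` \<Y>) \<le> 3 * u + 1" .
    show "triple_partition ?W R" if "R \<in> ?C \<union> D ` \<Y>" for R using that C D by auto
    fix p q assume pq: "p \<in> ?W" "q \<in> ?W" "p \<noteq> q"
    obtain x i y j where xy: "p = (x, i)" "q = (y, j)" "x \<in> X" "y \<in> X" "i \<in> ?Z" "j \<in> ?Z" using pq by blast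
    have "(\<exists>R\<in>?C. \<exists>A\<in>R. p \<in> A \<and> q \<in> A) \<or> (\<exists>R\<in>D ` \<Y>. \<exists>A\<in>R. p \<in> A \<and> q \<in> A)"
    proof (cases "x = y")
      case True
      obtain T where "T \<in> P0" "x \<in> T" using Tun[OF P0] xy by blast
      then show ?thesis using cov0[of p T q] xy True pq(3) by blast
    next
      case False
      then obtain P T where PT: "P \<in> \<P>" "T \<in> P" "x \<in> T" "y \<in> T" using Pcov xy by blast
      show ?thesis
      proof (cases "P = P0")
        case True
        then show ?thesis using cov0[of p T q] xy PT pq(3) by blast
      next
        case False
        then show ?thesis using cov1[OF xy(1,2,5,6) \<open>x \<noteq> y\<close> PT(3,4,2,1)] by blast
      qed
    qed
    then show "\<exists>R\<in>?C \<union> D ` \<Y>. \<exists>A\<in>R. p \<in> A \<and> q \<in> A" unfolding bex_Un .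
  qed
qed

lemma kts_product:
  assumes "kts s" "kts t" "2 * u + 1 = (2 * s + 1) * (2 * t + 1)"
  shows "kts u"
  using kts_of_kirkman[OF kirkman_product[OF kirkman_of_kts[OF assms(1)] kirkman_of_kts[OF assms(2)] assms(3)],
    of "{..<6 * s + 3}" "{..<6 * t + 3}"] by simp

section \<open>Group divisible designs\<close>

text \<open>A group divisible design whose groups are the fibres of the first projection.\<close>

definition gdd :: "('a \<times> 'b) set \<Rightarrow> ('a \<times> 'b) set set \<Rightarrow> bool" where
  "gdd X \<B> \<longleftrightarrow> (\<forall>B\<in>\<B>. B \<subseteq> X \<and> inj_on fst B) \<and>
    (\<forall>p\<in>X. \<forall>q\<in>X. fst p \<noteq> fst q \<longrightarrow> (\<exists>B\<in>\<B>. p \<in> B \<and> q \<in> B)) \<and>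
    (\<forall>B\<in>\<B>. \<forall>B'\<in>\<B>. \<forall>p\<in>B \<inter> B'. \<forall>q\<in>B \<inter> B'. p \<noteq> q \<longrightarrow> B = B')"

lemma gddD:
  assumes "gdd X \<B>"
  shows "B \<in> \<B> \<Longrightarrow> B \<subseteq> X" "B \<in> \<B> \<Longrightarrow> inj_on fst B"
    "p \<in> X \<Longrightarrow> q \<in> X \<Longrightarrow> fst p \<noteq> fst q \<Longrightarrow> \<exists>B\<in>\<B>. p \<in> B \<and> q \<in> B"
    "B \<in> \<B> \<Longrightarrow> B' \<in> \<B> \<Longrightarrow> p \<in> B \<Longrightarrow> p \<in> B' \<Longrightarrow> q \<in> B \<Longrightarrow> q \<in> B' \<Longrightarrow> p \<noteq> q \<Longrightarrow> B = B'"
proof -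
  note d = assms[unfolded gdd_def]
  show "B \<in> \<B> \<Longrightarrow> B \<subseteq> X" "B \<in> \<B> \<Longrightarrow> inj_on fst B" using d[THEN conjunct1] by auto
  show "p \<in> X \<Longrightarrow> q \<in> X \<Longrightarrow> fst p \<noteq> fst q \<Longrightarrow> \<exists>B\<in>\<B>. p \<in> B \<and> q \<in> B"
    using d[THEN conjunct2, THEN conjunct1] by simp
  show "B \<in> \<B> \<Longrightarrow> B' \<in> \<B> \<Longrightarrow> p \<in> B \<Longrightarrow> p \<in> B' \<Longrightarrow> q \<in> B \<Longrightarrow> q \<in> B' \<Longrightarrow> p \<noteq> q \<Longrightarrow> B = B'"
    using d[THEN conjunct2, THEN conjunct2, rule_format, of B B' p q] by simp
qed

lemma gddI:
  assumes "\<And>B. B \<in> \<B> \<Longrightarrow> B \<subseteq> X" "\<And>B. B \<in> \<B> \<Longrightarrow> inj_on fst B"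
    "\<And>p q. p \<in> X \<Longrightarrow> q \<in> X \<Longrightarrow> fst p \<noteq> fst q \<Longrightarrow> \<exists>B\<in>\<B>. p \<in> B \<and> q \<in> B"
    "\<And>B B' p q. B \<in> \<B> \<Longrightarrow> B' \<in> \<B> \<Longrightarrow> p \<in> B \<Longrightarrow> p \<in> B' \<Longrightarrow> q \<in> B \<Longrightarrow> q \<in> B' \<Longrightarrow> p \<noteq> q \<Longrightarrow> B = B'"
  shows "gdd X \<B>"
  unfolding gdd_def
proof (intro conjI ballI impI)
  fix B B' p q assume "B \<in> \<B>" "B' \<in> \<B>" "p \<in> B \<inter> B'" "q \<in> B \<inter> B'" "p \<noteq> q"
  then show "B = B'" by (intro assms(4)[of B B' p q]) auto
qed (use assms in auto)

lemma gdd_image: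
  assumes "gdd X \<B>" "inj_on h (fst ` X)"
  shows "gdd (map_prod h id ` X) ((`) (map_prod h id) ` \<B>)"
proof -
  let ?g = "map_prod h id"
  note d = gddD[OF assms(1)]
  have inj: "inj_on ?g X"
    using assms(2) by (auto simp: inj_on_def map_prod_def split: prod.splits)
  have hh: "h (fst p) = h (fst q) \<longleftrightarrow> fst p = fst q" if "p \<in> X" "q \<in> X" for p q
    using inj_on_eq_iff[OF assms(2), of "fst p" "fst q"] that by simp
  have gg: "p = q" if "?g p = ?g q" "p \<in> X" "q \<in> X" for p q by (rule inj_onD[OF inj that])
  show ?thesis
  proof (rule gddI)
    fix B' assume "B' \<in> (`) ?g ` \<B>"
    then obtain B where B: "B \<in> \<B>" "B' = ?g ` B" by blast
    show "B' \<subseteq> ?g ` X" using B d(1) by blast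
    show "inj_on fst B'"
    proof (rule inj_onI)
      fix p' q' assume a: "p' \<in> B'" "q' \<in> B'" "fst p' = fst q'"
      obtain p where p: "p' = ?g p" "p \<in> B" using a(1) unfolding B(2) by (rule imageE)
      obtain q where q: "q' = ?g q" "q \<in> B" using a(2) unfolding B(2) by (rule imageE)
      note pq = p(2) q(2) p(1) q(1)
      have "h (fst p) = h (fst q)" using a(3) unfolding p(1) q(1) by simp
      moreover have "p \<in> X" "q \<in> X" using pq(1,2) d(1)[OF B(1)] by blast+
      ultimately have "fst p = fst q" using hh by simp
      then have "p = q" by (rule inj_onD[OF d(2)[OF B(1)] _ pq(1,2)])
      then show "p' = q'" using pq(3,4) by simp
    qed
  next
    fix p' q' assume a: "p' \<in> ?g ` X" "q' \<in> ?g ` X" "fst p' \<noteq> fst q'"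
    obtain p where p: "p' = ?g p" "p \<in> X" using a(1) by (rule imageE)
    obtain q where q: "q' = ?g q" "q \<in> X" using a(2) by (rule imageE)
    note pq = p(2) q(2) p(1) q(1)
    have "fst p \<noteq> fst q" using a(3) unfolding p(1) q(1) by auto
    then obtain B where "B \<in> \<B>" "p \<in> B" "q \<in> B" using d(3)[OF pq(1,2)] by blast
    then show "\<exists>B\<in>(`) ?g ` \<B>. p' \<in> B \<and> q' \<in> B"
      unfolding pq(3,4) by (intro bexI[of _ "?g ` B"] conjI imageI)
  next
    fix B1' B2' p' q' assume h: "B1' \<in> (`) ?g ` \<B>" "B2' \<in> (`) ?g ` \<B>" "p' \<in> B1'" "p' \<in> B2'" "q' \<in> B1'" "q' \<in> B2'" "p' \<noteq> q'"
    obtain B1 where B1: "B1' = ?g ` B1" "B1 \<in> \<B>" using h(1) by (rule imageE)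
    obtain B2 where B2: "B2' = ?g ` B2" "B2 \<in> \<B>" using h(2) by (rule imageE)
    note B = B1(2,1) B2(2,1)
    obtain p1 where p1: "p' = ?g p1" "p1 \<in> B1" using h(3) unfolding B1(1) by (rule imageE)
    obtain p2 where p2: "p' = ?g p2" "p2 \<in> B2" using h(4) unfolding B2(1) by (rule imageE)
    obtain q1 where q1: "q' = ?g q1" "q1 \<in> B1" using h(5) unfolding B1(1) by (rule imageE)
    obtain q2 where q2: "q' = ?g q2" "q2 \<in> B2" using h(6) unfolding B2(1) by (rule imageE)
    note p = p1(2,1) p2(2,1) q1(2,1) q2(2,1)
    have X: "p1 \<in> X" "p2 \<in> X" "q1 \<in> X" "q2 \<in> X"
      using subsetD[OF d(1)[OF B1(2)]] subsetD[OF d(1)[OF B2(2)]] p by simp_all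
    have "?g p1 = ?g p2" "?g q1 = ?g q2" using p1(1) p2(1) q1(1) q2(1) by (simp_all only:)
    then have "p1 = p2" "q1 = q2" using gg X by (simp_all only:)
    moreover have "p1 \<noteq> q1" using h(7) p1(1) q1(1) by auto
    ultimately have "B1 = B2" using d(4)[OF B(1,3), of p1 q1] p(1,3,5,7) by simp
    then show "B1' = B2'" using B by simp
  qed
qed

text \<open>Blocks and groups together form a pairwise balanced design.\<close>

lemma kirkman_frame_gdd:
  assumes "gdd X \<B>" "\<And>B. B \<in> \<B> \<Longrightarrow> kirkman_frame B" "\<And>i. i \<in> fst ` X \<Longrightarrow> kirkman_frame {p \<in> X. fst p = i}"
  shows "kirkman_frame X"
proof (rule kirkman_frame_pbd[of "\<B> \<union> (\<lambda>i. {p \<in> X. fst p = i}) ` fst ` X"])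
  note d = gddD[OF assms(1)]
  let ?G = "(\<lambda>i. {p \<in> X. fst p = i}) ` fst ` X"
  show "B \<subseteq> X" if "B \<in> \<B> \<union> ?G" for B using that d(1) by blast
  show "kirkman_frame B" if "B \<in> \<B> \<union> ?G" for B using that assms(2,3) by blast
  show "\<exists>B\<in>\<B> \<union> ?G. p \<in> B \<and> q \<in> B" if pq: "p \<in> X" "q \<in> X" "p \<noteq> q" for p q
  proof (cases "fst p = fst q")
    case True
    then have "p \<in> {p' \<in> X. fst p' = fst p}" "q \<in> {p' \<in> X. fst p' = fst p}" using pq by auto
    moreover have m: "{p' \<in> X. fst p' = fst p} \<in> \<B> \<union> ?G"
      by (intro UnI2 image_eqI[of _ _ "fst p"] refl imageI pq(1))
    ultimately show ?thesis by (intro bexI[OF _ m] conjI)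
  next
    case False
    then show ?thesis using d(3)[OF pq(1,2)] by blast
  qed
  fix B B' p q
  assume h: "B \<in> \<B> \<union> ?G" "B' \<in> \<B> \<union> ?G" "p \<noteq> q" "p \<in> B" "q \<in> B" "p \<in> B'" "q \<in> B'"
  have G: "fst p = fst q \<and> C = {p' \<in> X. fst p' = fst p}" if "C \<in> ?G" "p \<in> C" "q \<in> C" for C using that by auto
  have nB: "fst p \<noteq> fst q" if "C \<in> \<B>" "p \<in> C" "q \<in> C" for C
    using inj_onD[OF d(2)[OF that(1)], of p q] that h(3) by blast
  show "B = B'"
  proof (cases "fst p = fst q")
    case True
    have "C = {p' \<in> X. fst p' = fst p}" if C: "C \<in> \<B> \<union> ?G" "p \<in> C" "q \<in> C" for C
      using C(1)
    proof
      assume "C \<in> \<B>"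
      then show ?thesis using nB[OF _ C(2,3)] True by simp
    next
      assume "C \<in> ?G"
      then show ?thesis using G[OF _ C(2,3)] by simp
    qed
    note e = this
    show ?thesis by (rule trans[OF e[OF h(1,4,5)] e[OF h(2,6,7), symmetric]])
  next
    case False
    have "C \<in> \<B>" if C: "C \<in> \<B> \<union> ?G" "p \<in> C" "q \<in> C" for C
      using C(1)
    proof
      assume "C \<in> ?G"
      then show ?thesis using G[OF _ C(2,3)] False by simp
    qed
    note e = this
    show ?thesis by (rule d(4)[OF e[OF h(1,4,5)] e[OF h(2,6,7)] h(4,6,5,7,3)])
  qed
qed

text \<open>Wilson's fundamental construction with weight 3: each block is replaced by a design on
  the triplicated points, and each triplicated group is filled together with the common point
  \<open>None\<close>. The result is a pairwise balanced design.\<close>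

lemma kirkman_frame_weight:
  assumes X: "gdd X \<B>" and L: "\<And>B. B \<in> \<B> \<Longrightarrow> gdd (B \<times> {..<3::nat}) (\<L> B)"
    and fr: "\<And>B A. B \<in> \<B> \<Longrightarrow> A \<in> \<L> B \<Longrightarrow> kirkman_frame A"
    and grp: "\<And>i. i \<in> fst ` X \<Longrightarrow> kirkman_frame (insert None (Some ` ({p \<in> X. fst p = i} \<times> {..<3::nat})))"
    and ne: "X \<noteq> {}"
  shows "kirkman_frame (insert None (Some ` (X \<times> {..<3::nat})))"
proof -
  let ?Y = "insert None (Some ` (X \<times> {..<3::nat}))"
  note d = gddD[OF X]
  define G where "G i = insert None (Some ` ({p \<in> X. fst p = i} \<times> {..<3::nat}))" for i
  define \<A> where "\<A> = (\<Union>B\<in>\<B>. (`) Some ` \<L> B)"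
  have A: "\<exists>B A'. B \<in> \<B> \<and> A' \<in> \<L> B \<and> A = Some ` A' \<and> A' \<subseteq> B \<times> {..<3} \<and> inj_on fst A'" if inA: "A \<in> \<A>" for A
  proof -
    obtain B A' where "B \<in> \<B>" "A' \<in> \<L> B" "A = Some ` A'" using inA unfolding \<A>_def by blast
    then show ?thesis using gddD(1,2)[OF L] by blast
  qed
  show ?thesis
  proof (rule kirkman_frame_pbd[of "\<A> \<union> G ` fst ` X"])
    show "C \<subseteq> ?Y" if "C \<in> \<A> \<union> G ` fst ` X" for C
      using that
    proof
      assume "C \<in> \<A>"
      then obtain B A' where "B \<in> \<B>" "C = Some ` A'" "A' \<subseteq> B \<times> {..<3}" using A by blast
      then show ?thesis using d(1)[of B] by blast
    next
      assume "C \<in> G ` fst ` X"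
      then show ?thesis unfolding G_def by blast
    qed
    show "kirkman_frame C" if "C \<in> \<A> \<union> G ` fst ` X" for C
      using that
    proof
      assume "C \<in> \<A>"
      then obtain B A' where "B \<in> \<B>" "A' \<in> \<L> B" "C = Some ` A'" using A by blast
      then show ?thesis using kirkman_frame_image[OF fr, of B A' Some] by simp
    next
      assume "C \<in> G ` fst ` X"
      then show ?thesis using grp unfolding G_def by blast
    qed
    show "\<exists>C\<in>\<A> \<union> G ` fst ` X. y \<in> C \<and> z \<in> C" if yz: "y \<in> ?Y" "z \<in> ?Y" "y \<noteq> z" for y z
    proof -
      have NG: "\<exists>C\<in>\<A> \<union> G ` fst ` X. None \<in> C \<and> v \<in> C" if "v \<in> ?Y" for v
      proof -
        obtain p where p: "p \<in> X" "v = None \<or> (\<exists>c<3. v = Some (p, c))" using \<open>v \<in> ?Y\<close> ne by auto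
        then have "None \<in> G (fst p)" "v \<in> G (fst p)" unfolding G_def by auto
        moreover have "G (fst p) \<in> \<A> \<union> G ` fst ` X" using p(1) by blast
        ultimately show ?thesis by blast
      qed
      consider "y = None" | "z = None" | p c q e where "y = Some (p, c)" "z = Some (q, e)" "p \<in> X" "q \<in> X" "c < 3" "e < 3"
        using yz(1,2) by blast
      then show ?thesis
      proof cases
        case 1
        then show ?thesis using NG[OF yz(2)] by simp
      next
        case 2
        then show ?thesis using NG[OF yz(1)] by blast
      next
        case (3 p c q e)
        show ?thesis
        proof (cases "fst p = fst q")
          case True
          then have "y \<in> G (fst p)" "z \<in> G (fst p)" unfolding G_def using 3 by auto
          moreover have "G (fst p) \<in> \<A> \<union> G ` fst ` X" using 3 by blast
          ultimately show ?thesis by blast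
        next
          case False
          then obtain B where B: "B \<in> \<B>" "p \<in> B" "q \<in> B" using d(3) 3 by blast
          have pq: "fst (p, c) \<noteq> fst (q, e)" using False by auto
          obtain A' where "A' \<in> \<L> B" "(p, c) \<in> A'" "(q, e) \<in> A'"
            using gddD(3)[OF L[OF B(1)] _ _ pq] B 3 by blast
          then have "Some ` A' \<in> \<A>" "y \<in> Some ` A'" "z \<in> Some ` A'" unfolding \<A>_def using B 3 by auto
          then show ?thesis by blast
        qed
      qed
    qed
    fix C D y z
    assume h: "C \<in> \<A> \<union> G ` fst ` X" "D \<in> \<A> \<union> G ` fst ` X" "y \<noteq> z" "y \<in> C" "z \<in> C" "y \<in> D" "z \<in> D"
    \<comment> \<open>A pair inside an inflated block belongs to different points of the original
      block, hence to different groups.\<close>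
    have GG: False if CC: "C \<in> \<A>" "y \<in> C" "z \<in> C" "y \<in> G i" "z \<in> G i" for C i
    proof -
      obtain B A' where BA: "B \<in> \<B>" "C = Some ` A'" "A' \<subseteq> B \<times> {..<3}" "inj_on fst A'" using A[OF CC(1)] by blast
      then obtain p c q e where pq: "y = Some (p, c)" "z = Some (q, e)" "(p, c) \<in> A'" "(q, e) \<in> A'" "p \<in> B" "q \<in> B"
        using CC(2,3) by blast
      then have "fst p = fst q" using CC(4,5) unfolding G_def by auto
      then have "p = q" using inj_onD[OF d(2)[OF BA(1)]] pq by blast
      then have "(p, c) = (q, e)" using inj_onD[OF BA(4)] pq by (metis fst_conv)
      then show False using h(3) pq by simp
    qed
    consider "C \<in> \<A>" "D \<in> \<A>" | i j where "C = G i" "D = G j" | i where "C \<in> \<A>" "D = G i" | i where "D \<in> \<A>" "C = G i"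
      using h(1,2) by blast
    then show "C = D"
    proof cases
      case 1
      obtain B A' where BA: "B \<in> \<B>" "A' \<in> \<L> B" "C = Some ` A'" "A' \<subseteq> B \<times> {..<3}" "inj_on fst A'" using A[OF 1(1)] by blast
      obtain B2 A2 where BA2: "B2 \<in> \<B>" "A2 \<in> \<L> B2" "D = Some ` A2" "A2 \<subseteq> B2 \<times> {..<3}" using A[OF 1(2)] by blast
      obtain y' where y': "y = Some y'" "y' \<in> A'" using h(4) unfolding BA(3) by (rule imageE)
      obtain z' where z': "z = Some z'" "z' \<in> A'" using h(5) unfolding BA(3) by (rule imageE)
      obtain p c where pc: "y' = (p, c)" by (cases y')
      obtain q e where qe: "z' = (q, e)" by (cases z')
      note pq = y'(1)[unfolded pc] z'(1)[unfolded qe] y'(2)[unfolded pc] z'(2)[unfolded qe]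
      have pq2: "(p, c) \<in> A2" "(q, e) \<in> A2" using h(6,7) unfolding BA2(3) pq(1,2) by auto
      have ne: "(p, c) \<noteq> (q, e)" using h(3) pq by auto
      then have "p \<noteq> q" using inj_onD[OF BA(5) _ pq(3,4)] by auto
      moreover have "p \<in> B" "q \<in> B" "p \<in> B2" "q \<in> B2" using pq pq2 BA BA2 by blast+
      ultimately have "B = B2" using d(4)[OF BA(1) BA2(1), of p q] by simp
      then have "A' = A2" using gddD(4)[OF L[OF BA(1)] BA(2), of A2 "(p, c)" "(q, e)"] BA2(2) pq pq2 ne by simp
      then show ?thesis using BA BA2 by simp
    next
      case (2 i j)
      obtain p c where "y = Some (p, c) \<or> z = Some (p, c)" using h(3) by (cases y; cases z) auto
      then have "i = fst p \<and> j = fst p" using h(4-7) unfolding 2 G_def by auto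
      then show ?thesis using 2 by simp
    next
      case (3 i)
      show ?thesis using GG[OF 3(1) h(4,5) h(6,7)[unfolded 3(2)]] ..
    next
      case (4 i)
      show ?thesis using GG[OF 4(1) h(6,7) h(4,5)[unfolded 4(2)]] ..
    qed
  qed
qed

text \<open>An executable certificate for a group divisible design with \<open>n\<close> groups of
  size 3 and blocks of size 4. A filter of length 1 states existence and uniqueness of the joining
  block together.\<close>

definition line_list_ok :: "nat \<Rightarrow> (nat \<times> nat) list list \<Rightarrow> bool" where
  "line_list_ok n Ls \<longleftrightarrow>
    list_all (\<lambda>L. length L = 4 \<and> distinct (map fst L) \<and> list_all (\<lambda>p. fst p < n \<and> snd p < 3) L) Ls \<and>
    list_all (\<lambda>p. list_all (\<lambda>q. fst p = fst q \<or> length (filter (\<lambda>L. p \<in> set L \<and> q \<in> set L) Ls) = 1)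
      (List.product [0..<n] [0..<3])) (List.product [0..<n] [0..<3])"

lemma gdd_line_list:
  assumes "line_list_ok n Ls"
  shows "gdd ({..<n} \<times> {..<3}) (set ` set Ls)" "\<And>A. A \<in> set ` set Ls \<Longrightarrow> card A = 4 \<and> finite A"
proof -
  have L: "length L = 4" "distinct (map fst L)" "set L \<subseteq> {..<n} \<times> {..<3}" if "L \<in> set Ls" for L
  proof -
    have "\<forall>L\<in>set Ls. length L = 4 \<and> distinct (map fst L) \<and> (\<forall>p\<in>set L. fst p < n \<and> snd p < 3)"
      using assms unfolding line_list_ok_def list_all_iff by (rule conjunct1)
    then have c: "length L = 4" "distinct (map fst L)" "\<forall>p\<in>set L. fst p < n \<and> snd p < 3" using that by blast+
    show "length L = 4" "distinct (map fst L)" by (fact c(1), fact c(2))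
    show "set L \<subseteq> {..<n} \<times> {..<3}"
    proof
      fix p assume "p \<in> set L"
      then have "fst p < n \<and> snd p < 3" using c(3) by blast
      then show "p \<in> {..<n} \<times> {..<3}" by (simp add: mem_Times_iff)
    qed
  qed
  have one: "length (filter (\<lambda>L. p \<in> set L \<and> q \<in> set L) Ls) = 1"
    if "p \<in> {..<n} \<times> {..<3}" "q \<in> {..<n} \<times> {..<3}" "fst p \<noteq> fst q" for p q
  proof -
    have "p \<in> set (List.product [0..<n] [0..<3])" "q \<in> set (List.product [0..<n] [0..<3])" using that by auto
    then show ?thesis using assms that(3) unfolding line_list_ok_def list_all_iff by blast
  qed
  have inj: "inj_on fst (set L)" if "L \<in> set Ls" for L using L(2)[OF that] by (simp add: distinct_map)
  show "gdd ({..<n} \<times> {..<3}) (set ` set Ls)"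
  proof (rule gddI)
    show "B \<subseteq> {..<n} \<times> {..<3}" if "B \<in> set ` set Ls" for B using that L(3) by blast
    show "inj_on fst B" if "B \<in> set ` set Ls" for B using that inj by blast
    show "\<exists>B\<in>set ` set Ls. p \<in> B \<and> q \<in> B" if pq: "p \<in> {..<n} \<times> {..<3}" "q \<in> {..<n} \<times> {..<3}" "fst p \<noteq> fst q" for p q
    proof -
      have "filter (\<lambda>L. p \<in> set L \<and> q \<in> set L) Ls \<noteq> []" using one[OF pq] by auto
      then show ?thesis by (auto simp: filter_empty_conv)
    qed
    fix B B' p q assume h: "B \<in> set ` set Ls" "B' \<in> set ` set Ls" "p \<in> B" "p \<in> B'" "q \<in> B" "q \<in> B'" "p \<noteq> q"
    obtain M M' where M: "M \<in> set Ls" "B = set M" "M' \<in> set Ls" "B' = set M'" using h by blast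
    have "fst p \<noteq> fst q" using inj_onD[OF inj[OF M(1)], of p q] h M by blast
    moreover have "p \<in> {..<n} \<times> {..<3}" "q \<in> {..<n} \<times> {..<3}" using L(3)[OF M(1)] h M by blast+
    ultimately have "length (filter (\<lambda>L. p \<in> set L \<and> q \<in> set L) Ls) = 1" using one by blast
    then obtain N where N: "filter (\<lambda>L. p \<in> set L \<and> q \<in> set L) Ls = [N]" by (cases "filter (\<lambda>L. p \<in> set L \<and> q \<in> set L) Ls") auto
    have "M \<in> set (filter (\<lambda>L. p \<in> set L \<and> q \<in> set L) Ls)" "M' \<in> set (filter (\<lambda>L. p \<in> set L \<and> q \<in> set L) Ls)"
      using M h by auto
    then show "B = B'" unfolding N M by simp
  qed
  show "card A = 4 \<and> finite A" if A: "A \<in> set ` set Ls" for A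
  proof -
    obtain M where M: "A = set M" "M \<in> set Ls" using A by (rule imageE)
    have "distinct M" using L(2)[OF M(2)] by (simp add: distinct_map)
    then show ?thesis using L(1)[OF M(2)] M(1) by (simp add: distinct_card)
  qed
qed

text \<open>The linear forms a, b, a + b, a + 2b over GF(3) are pairwise independent, so they define
  a transversal design with four groups of size 3.\<close>

lemma line_list_4: "line_list_ok 4 (concat (map (\<lambda>a. map (\<lambda>b.
    [(0, a), (1, b), (2, (a + b) mod 3), (3, (a + 2 * b) mod 3)]) [0..<3]) [0..<3]))"
  by code_simp

text \<open>The affine plane of order 4 minus a point, developed modulo 15 from the relative difference
  set \<open>{0, 1, 3, 7}\<close>.\<close>

lemma line_list_5: "line_list_ok 5 (map (\<lambda>i. map (\<lambda>d. ((d + i) mod 5, (d + i) mod 15 div 5)) [0, 1, 3, 7]) [0..<15])"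
  by code_simp

text \<open>The ingredients of the weighting. Blocks of a transversal design with five groups, one
  of them truncated, have just the sizes 4 and 5.\<close>

lemma gdd_weight_3:
  assumes "finite B" "card B \<in> {4, 5}"
  shows "\<exists>\<L>. gdd (B \<times> {..<3::nat}) \<L> \<and> (\<forall>A\<in>\<L>. card A = 4 \<and> finite A)"
proof -
  have "\<exists>\<L>. gdd ({..<card B} \<times> {..<3::nat}) \<L> \<and> (\<forall>A\<in>\<L>. card A = 4 \<and> finite A)"
    using assms(2)
  proof (elim insertE emptyE)
    assume "card B = 4"
    then show ?thesis using gdd_line_list[OF line_list_4] by (simp only:) blast
  next
    assume "card B = 5"
    then show ?thesis using gdd_line_list[OF line_list_5] by (simp only:) blast
  qed
  then obtain \<L> where L: "gdd ({..<card B} \<times> {..<3::nat}) \<L>" and Lc: "\<forall>A\<in>\<L>. card A = 4 \<and> finite A"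
    by (elim exE conjE)
  obtain h where h: "bij_betw h {..<card B} B"
    using ex_bij_betw_nat_finite[OF assms(1)] by (auto simp: atLeast0LessThan)
  let ?X = "{..<card B} \<times> {..<3::nat}"
  have hi: "inj_on h (fst ` ?X)" by (rule inj_on_subset[of h "{..<card B}"]) (use h in \<open>auto simp: bij_betw_def\<close>)
  have "gdd (map_prod h id ` ?X) ((`) (map_prod h id) ` \<L>)" by (rule gdd_image[OF L hi])
  moreover have "map_prod h id ` ?X = B \<times> {..<3}" using h by (simp add: map_prod_surj_on bij_betw_def)
  moreover have "card A = 4 \<and> finite A" if A: "A \<in> (`) (map_prod h id) ` \<L>" for A
  proof -
    obtain A' where A': "A = map_prod h id ` A'" "A' \<in> \<L>" using A by (rule imageE)
    have "inj_on (map_prod h id) ?X" using h by (intro map_prod_inj_on) (auto simp: bij_betw_def)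
    then have "inj_on (map_prod h id) A'" by (rule inj_on_subset) (rule gddD(1)[OF L A'(2)])
    then have "card A = card A'" unfolding A'(1) by (rule card_image)
    then show ?thesis using bspec[OF Lc A'(2)] A'(1) by simp
  qed
  ultimately have "gdd (B \<times> {..<3}) ((`) (map_prod h id) ` \<L>) \<and> (\<forall>A\<in>(`) (map_prod h id) ` \<L>. card A = 4 \<and> finite A)"
    by simp
  then show ?thesis by (rule exI)
qed

section \<open>Transversal designs\<close>

text \<open>The condition that M be coprime to 6 enters here: the indices 0, 1, 2, 3 of the full
  groups differ by at most 3.\<close>

lemma coprime_small:
  fixes M d :: int
  assumes "odd M" "\<not> 3 dvd M" "d \<in> {1, 2, 3, - 1, - 2, - 3}"
  shows "coprime d M"
proof -
  have "coprime 2 M" by (rule coprime_left_2_iff_odd[THEN iffD2, OF assms(1)])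
  moreover have "coprime 3 M" by (rule prime_imp_coprime) (use assms(2) in auto)
  ultimately show ?thesis using assms(3) by auto
qed

lemma eq_of_dvd_diff:
  fixes y y' M :: int
  assumes "M dvd y - y'" "0 \<le> y" "y < M" "0 \<le> y'" "y' < M"
  shows "y = y'"
proof -
  have "y mod M = y' mod M" using assms(1) by (simp add: mod_eq_dvd_iff)
  then show ?thesis using assms(2-) by simp
qed

definition td_points :: "int \<Rightarrow> int \<Rightarrow> (int \<times> int) set" where
  "td_points M w = {0..<4} \<times> {0..<M} \<union> {4} \<times> {0..<w}"

text \<open>The line with intercept \<open>x\<close> and slope \<open>y\<close>, read off in columns
  0 to 3. The fifth column records the slope itself, and truncation keeps only slopes below
  \<open>w\<close>.\<close>

definition td_block :: "int \<Rightarrow> int \<Rightarrow> int \<Rightarrow> int \<Rightarrow> (int \<times> int) set" where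
  "td_block M w x y = (\<lambda>i. (i, (x + i * y) mod M)) ` {0..<4} \<union> (if y < w then {(4, y)} else {})"

lemma td_block_iff:
  "(i, a) \<in> td_block M w x y \<longleftrightarrow> 0 \<le> i \<and> i < 4 \<and> a = (x + i * y) mod M \<or> i = 4 \<and> a = y \<and> y < w"
  unfolding td_block_def by auto

lemma td_diff:
  fixes i j :: int
  assumes "0 \<le> i" "i < 4" "0 \<le> j" "j < 4" "i \<noteq> j"
  shows "j - i \<in> {1, 2, 3, - 1, - 2, - 3}"
  using assms by auto

text \<open>Two points in columns \<open>i\<close> and \<open>j\<close> below 4 determine the slope
  because \<open>j - i\<close> is invertible, and then the intercept. A point of column 4 is the
  slope, and \<open>w \<le> M\<close> ensures that each of its points occurs as one.\<close>

lemma td_gdd: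
  assumes M: "odd M" "\<not> 3 dvd M" "M > 0" and w: "0 \<le> w" "w \<le> M"
  shows "gdd (td_points M w) ((\<lambda>(x, y). td_block M w x y) ` ({0..<M} \<times> {0..<M}))"
    (is "gdd ?X ?B")
proof (rule gddI)
  have blk: "td_block M w x y \<in> ?B" if "0 \<le> x" "x < M" "0 \<le> y" "y < M" for x y
    by (rule image_eqI[of _ _ "(x, y)"]) (use that in auto)
  fix B assume "B \<in> ?B"
  then obtain x y where B: "B = td_block M w x y" "0 \<le> x" "x < M" "0 \<le> y" "y < M" by auto
  show "B \<subseteq> ?X"
  proof
    fix p assume p: "p \<in> B"
    obtain i a where ia: "p = (i, a)" by (cases p)
    have "0 \<le> i \<and> i < 4 \<and> a = (x + i * y) mod M \<or> i = 4 \<and> a = y \<and> y < w"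
      using p unfolding ia B(1) td_block_iff .
    then show "p \<in> ?X" unfolding ia td_points_def using M(3) B by auto
  qed
  show "inj_on fst B"
  proof (rule inj_onI)
    fix p q assume pq: "p \<in> B" "q \<in> B" "fst p = fst q"
    obtain i a b where ia: "p = (i, a)" "q = (i, b)" using pq(3) by (cases p; cases q) auto
    show "p = q" using pq(1,2) unfolding ia B(1) td_block_iff by auto
  qed
next
  have mM: "0 \<le> z mod M" "z mod M < M" for z using M(3) by simp_all
  have c4: "\<exists>B\<in>?B. (i, a) \<in> B \<and> (4, b) \<in> B" if "0 \<le> i" "i < 4" "0 \<le> a" "a < M" "0 \<le> b" "b < w" for i a b
  proof -
    have "((a - i * b) mod M + i * b) mod M = a" using that by (simp add: mod_add_left_eq)
    then have "(i, a) \<in> td_block M w ((a - i * b) mod M) b \<and> (4, b) \<in> td_block M w ((a - i * b) mod M) b"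
      unfolding td_block_iff using that by simp
    moreover have "td_block M w ((a - i * b) mod M) b \<in> ?B"
      by (rule image_eqI[of _ _ "((a - i * b) mod M, b)"]) (use that w mM in auto)
    ultimately show ?thesis by (rule bexI)
  qed
  have c3: "\<exists>B\<in>?B. (i, a) \<in> B \<and> (j, b) \<in> B"
    if ij: "0 \<le> i" "i < 4" "0 \<le> j" "j < 4" "i \<noteq> j" "0 \<le> a" "a < M" "0 \<le> b" "b < M" for i j a b
  proof -
    have "coprime (j - i) M" by (rule coprime_small[OF M(1,2) td_diff[OF ij(1-5)]])
    then obtain v where v: "[(j - i) * v = 1] (mod M)" using cong_solve_coprime_int by blast
    define y where "y = (v * (b - a)) mod M"
    define x where "x = (a - i * y) mod M"
    have "[(j - i) * y = (j - i) * (v * (b - a))] (mod M)"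
      unfolding y_def by (intro cong_mult cong_refl) simp
    also have "(j - i) * (v * (b - a)) = ((j - i) * v) * (b - a)" by simp
    also have "[\<dots> = 1 * (b - a)] (mod M)" by (intro cong_mult v cong_refl)
    finally have "[a + (j - i) * y = a + 1 * (b - a)] (mod M)" by (intro cong_add cong_refl)
    then have "(a + (j - i) * y) mod M = b" using ij unfolding cong_def by simp
    moreover have "(x + k * y) mod M = (a + (k - i) * y) mod M" for k
      unfolding x_def mod_add_left_eq by (simp add: algebra_simps)
    ultimately have "(x + i * y) mod M = a" "(x + j * y) mod M = b" using ij by simp_all
    then have "(i, a) \<in> td_block M w x y \<and> (j, b) \<in> td_block M w x y"
      unfolding td_block_iff using ij by simp
    moreover have "td_block M w x y \<in> ?B"
      by (rule image_eqI[of _ _ "(x, y)"]) (use mM x_def y_def in auto)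
    ultimately show ?thesis by (rule bexI)
  qed
  fix p q assume pq: "p \<in> ?X" "q \<in> ?X" "fst p \<noteq> fst q"
  obtain i a j b where p: "p = (i, a)" "q = (j, b)" by (cases p; cases q)
  have "0 \<le> i \<and> i < 4 \<and> 0 \<le> a \<and> a < M \<or> i = 4 \<and> 0 \<le> a \<and> a < w"
    "0 \<le> j \<and> j < 4 \<and> 0 \<le> b \<and> b < M \<or> j = 4 \<and> 0 \<le> b \<and> b < w" "i \<noteq> j"
    using pq unfolding p td_points_def by auto
  then consider "0 \<le> i" "i < 4" "0 \<le> a" "a < M" "0 \<le> j" "j < 4" "0 \<le> b" "b < M" |
    "0 \<le> i" "i < 4" "0 \<le> a" "a < M" "j = 4" "0 \<le> b" "b < w" | "i = 4" "0 \<le> a" "a < w" "0 \<le> j" "j < 4" "0 \<le> b" "b < M"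
    by blast
  then show "\<exists>B\<in>?B. p \<in> B \<and> q \<in> B"
  proof cases
    case 1
    show ?thesis unfolding p by (rule c3[OF 1(1,2,5,6) \<open>i \<noteq> j\<close> 1(3,4,7,8)])
  next
    case 2
    show ?thesis unfolding p 2(5) by (rule c4[OF 2(1-4,6-7)])
  next
    case 3
    obtain B where "B \<in> ?B" "(j, b) \<in> B" "(4, a) \<in> B" using c4[OF 3(4-7) 3(2,3)] by (elim bexE conjE)
    then show ?thesis unfolding p 3(1) by (intro bexI[of _ B] conjI)
  qed
next
  fix B B' p q assume h: "B \<in> ?B" "B' \<in> ?B" "p \<in> B" "p \<in> B'" "q \<in> B" "q \<in> B'" "p \<noteq> q"
  obtain x y where B: "B = td_block M w x y" "0 \<le> x" "x < M" "0 \<le> y" "y < M" using h(1) by auto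
  obtain x' y' where B': "B' = td_block M w x' y'" "0 \<le> x'" "x' < M" "0 \<le> y'" "y' < M" using h(2) by auto
  obtain i a j b where p: "p = (i, a)" "q = (j, b)" by (cases p; cases q)
  note m = h(3)[unfolded p B(1) td_block_iff] h(4)[unfolded p B'(1) td_block_iff]
    h(5)[unfolded p B(1) td_block_iff] h(6)[unfolded p B'(1) td_block_iff]
  have ij: "i \<noteq> j"
  proof
    assume "i = j"
    then have "a = b" using m(1,3) by auto
    then show False using \<open>i = j\<close> h(7) p by simp
  qed
  have xx: "x = x'" if "y = y'" "0 \<le> k" "(x + k * y) mod M = (x' + k * y') mod M" for k
  proof -
    have "M dvd (x + k * y) - (x' + k * y')" using that(3) by (simp only: mod_eq_dvd_iff)
    then have "M dvd x - x'" using that(1) by simp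
    then show ?thesis by (rule eq_of_dvd_diff) (use B B' in auto)
  qed
  have "y = y' \<and> x = x'"
  proof (cases "i = 4 \<or> j = 4")
    case True
    then have "y = y'" using m by auto
    moreover have "\<exists>k\<ge>0. (x + k * y) mod M = (x' + k * y') mod M" using True ij m by auto
    ultimately show ?thesis using xx by blast
  next
    case False
    then have i: "0 \<le> i" "i < 4" "(x + i * y) mod M = (x' + i * y') mod M"
      and j: "0 \<le> j" "j < 4" "(x + j * y) mod M = (x' + j * y') mod M" using m by auto
    have "M dvd (x + i * y) - (x' + i * y')" "M dvd (x + j * y) - (x' + j * y')"
      using i(3) j(3) by (simp_all only: mod_eq_dvd_iff)
    then have "M dvd ((x + j * y) - (x' + j * y')) - ((x + i * y) - (x' + i * y'))" by (rule dvd_diff[rotated])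
    also have "((x + j * y) - (x' + j * y')) - ((x + i * y) - (x' + i * y')) = (j - i) * (y - y')"
      by (simp add: algebra_simps)
    finally have "M dvd y - y'"
      using coprime_small[OF M(1,2) td_diff[OF i(1,2) j(1,2) ij]] by (simp add: coprime_dvd_mult_right_iff coprime_commute)
    then have "y = y'" by (rule eq_of_dvd_diff) (use B B' in auto)
    then show ?thesis using xx[OF _ i(1,3)] by simp
  qed
  then show "B = B'" using B B' by simp
qed

lemma td_block_card:
  "finite (td_block M w x y)" "card (td_block M w x y) = (if y < w then 5 else 4)"
proof -
  have c: "card ((\<lambda>i. (i, (x + i * y) mod M)) ` {0..<4::int}) = 4"
    by (subst card_image) (auto simp: inj_on_def)
  show "finite (td_block M w x y)" unfolding td_block_def by simp
  have "(4, y) \<notin> (\<lambda>i. (i, (x + i * y) mod M)) ` {0..<4::int}" by auto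
  then show "card (td_block M w x y) = (if y < w then 5 else 4)"
    unfolding td_block_def using c by (simp add: Un_insert_right)
qed

lemma td_points_card: "0 \<le> M \<Longrightarrow> 0 \<le> w \<Longrightarrow> card (td_points M w) = 4 * nat M + nat w"
  unfolding td_points_def by (subst card_Un_disjoint) (auto simp: card_cartesian_product)

lemma td_points_group:
  assumes "0 \<le> M" "0 \<le> w" "i \<in> fst ` td_points M w"
  shows "finite {p \<in> td_points M w. fst p = i}"
    "card {p \<in> td_points M w. fst p = i} = (if i = 4 then nat w else nat M)"
proof -
  have eq: "{p \<in> td_points M w. fst p = i} = {i} \<times> (if i = 4 then {0..<w} else {0..<M})"
    using assms(3) unfolding td_points_def by auto
  show "finite {p \<in> td_points M w. fst p = i}"
    "card {p \<in> td_points M w. fst p = i} = (if i = 4 then nat w else nat M)"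
    unfolding eq by (simp_all add: card_cartesian_product)
qed

lemma card_weight:
  assumes "finite X" shows "card (insert None (Some ` (X \<times> {..<3::nat}))) = 3 * card X + 1"
  using assms by (simp add: card_image card_cartesian_product)

text \<open>With the extra point, the weighted groups have \<open>3 * M + 1\<close> and
  \<open>3 * w + 1\<close> points, blocks have size 4 = 3 * 1 + 1, and the whole has
  \<open>3 * (4 * M + w) + 1\<close> points.\<close>

lemma kts_td:
  assumes "odd M" "\<not> 3 dvd M" "w \<le> M" "kts M" "kts w" "kts 1"
  shows "kts (4 * M + w)"
proof -
  let ?X = "td_points (int M) (int w)"
  let ?B = "(\<lambda>(x, y). td_block (int M) (int w) x y) ` ({0..<int M} \<times> {0..<int M})"
  have M0: "M > 0" using assms(1) by (cases M) auto
  have "\<not> 3 dvd int M" using assms(2) int_dvd_int_iff[of 3 M] by simp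
  then have gdd: "gdd ?X ?B" using td_gdd[of "int M" "int w"] assms(1,3) M0 by simp
  have bc: "finite B" "card B \<in> {4, 5}" if "B \<in> ?B" for B
    using that td_block_card by auto
  have "\<forall>B\<in>?B. \<exists>L. gdd (B \<times> {..<3::nat}) L \<and> (\<forall>A\<in>L. card A = 4 \<and> finite A)"
    by (intro ballI gdd_weight_3 bc)
  then obtain L where L: "\<forall>B\<in>?B. gdd (B \<times> {..<3::nat}) (L B) \<and> (\<forall>A\<in>L B. card A = 4 \<and> finite A)"
    by (rule bchoice[THEN exE])
  have fin: "finite ?X" unfolding td_points_def by simp
  have cX: "card ?X = 4 * M + w" using td_points_card[of "int M" "int w"] by simp
  have "kirkman_frame (insert None (Some ` (?X \<times> {..<3::nat})))"
  proof (rule kirkman_frame_weight[OF gdd])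
    show "gdd (B \<times> {..<3}) (L B)" if "B \<in> ?B" for B using bspec[OF L that] by (rule conjunct1)
    show "kirkman_frame A" if B: "B \<in> ?B" and A: "A \<in> L B" for B A
    proof -
      have "card A = 4 \<and> finite A" using bspec[OF bspec[OF L B, THEN conjunct2] A] .
      then show ?thesis using kirkman_frame_kts[OF assms(6), of A] by simp
    qed
    show "kirkman_frame (insert None (Some ` ({p \<in> ?X. fst p = i} \<times> {..<3::nat})))" if i: "i \<in> fst ` ?X" for i
    proof -
      note g = td_points_group[OF _ _ i]
      have f: "finite (insert None (Some ` ({p \<in> ?X. fst p = i} \<times> {..<3::nat})))" using g(1) by simp
      have c: "card (insert None (Some ` ({p \<in> ?X. fst p = i} \<times> {..<3::nat}))) = 3 * (if i = 4 then w else M) + 1"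
        using card_weight[OF g(1)] g(2) by simp
      have k: "kts (if i = 4 then w else M)" using assms(4,5) by simp
      show ?thesis by (rule kirkman_frame_kts[OF k f c])
    qed
    show "?X \<noteq> {}" using cX M0 by auto
  qed
  then show ?thesis
    by (rule kts_of_frame) (use fin card_weight[OF fin] cX in simp_all)
qed

text \<open>Weighting misses 41, which lies between 5 * 7 and 4 * 11; moreover 2 * 41 + 1 = 83 is a
  prime congruent to 2 modulo 3. An unweighted design with four groups works: 4 * 31 = 3 * 41 + 1
  and 31 = 3 * 10 + 1.\<close>

lemma kts_41:
  assumes "kts 1" "kts 10"
  shows "kts 41"
proof -
  let ?X = "td_points 31 0"
  have gdd: "gdd ?X ((\<lambda>(x, y). td_block 31 0 x y) ` ({0..<31} \<times> {0..<31}))"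
    by (rule td_gdd) simp_all
  have "kirkman_frame ?X"
  proof (rule kirkman_frame_gdd[OF gdd])
    fix B assume "B \<in> (\<lambda>(x, y). td_block 31 0 x y) ` ({0..<31} \<times> {0..<31})"
    then obtain x y where "B = td_block 31 0 x y" "0 \<le> y" by auto
    then have "finite B" "card B = 3 * 1 + 1" using td_block_card[of 31 0 x y] by auto
    then show "kirkman_frame B" by (rule kirkman_frame_kts[OF assms(1)])
  next
    fix i assume i: "i \<in> fst ` ?X"
    then have "i \<noteq> 4" unfolding td_points_def by auto
    then show "kirkman_frame {p \<in> ?X. fst p = i}"
      using td_points_group[OF _ _ i] by (intro kirkman_frame_kts[OF assms(2)]) simp_all
  qed
  then show ?thesis
    by (rule kts_of_frame) (simp_all add: td_points_card td_points_def)
qed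

section \<open>The systems on 9 and on 69 points\<close>

lemma triple_partition_list:
  "cycles_on 3 V F \<Longrightarrow> triple_partition V (set ` set F)"
proof (induction F arbitrary: V)
  case Nil
  then show ?case by (simp add: cycles_on_def triple_partition_def partition_on_def)
next
  case (Cons xs F)
  then have "triple_partition (set (concat F)) (set ` set F)" by (auto simp: cycles_on_def)
  moreover have "card (set xs) = 3" using Cons.prems by (simp add: cycles_on_def distinct_card)
  moreover have "set xs \<inter> set (concat F) = {}" "V = set xs \<union> set (concat F)"
    using Cons.prems by (auto simp: cycles_on_def)
  ultimately show ?case using triple_partition_insert[of "set (concat F)" "set ` set F" "set xs"] by simp
qed

definition affine_plane_3 :: "nat list list list" where
  "affine_plane_3 = [[[0, 1, 2], [3, 4, 5], [6, 7, 8]], [[0, 3, 6], [1, 4, 7], [2, 5, 8]],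
    [[0, 4, 8], [1, 5, 6], [2, 3, 7]], [[0, 5, 7], [1, 3, 8], [2, 4, 6]]]"

lemma kts_1: "kts 1"
proof -
  have "kirkman (3 * 1 + 1) {..<9::nat}"
  proof (rule kirkmanI[of _ _ "(\<lambda>F. set ` set F) ` set affine_plane_3"])
    have "card ((\<lambda>F. set ` set F) ` set affine_plane_3) \<le> length affine_plane_3"
      by (rule order_trans[OF card_image_le card_length]) simp
    then show "card ((\<lambda>F. set ` set F) ` set affine_plane_3) \<le> 3 * 1 + 1" by (simp add: affine_plane_3_def)
    show "triple_partition {..<9} P" if P: "P \<in> (\<lambda>F. set ` set F) ` set affine_plane_3" for P
    proof -
      have "list_all (\<lambda>F. list_all (\<lambda>xs. length xs = 3) F \<and> distinct (concat F) \<and> sort (concat F) = [0..<9]) affine_plane_3"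
        by (simp add: affine_plane_3_def upt_rec)
      moreover obtain F where F: "P = set ` set F" "F \<in> set affine_plane_3" using P by (rule imageE)
      ultimately have "list_all (\<lambda>xs. length xs = 3) F" "distinct (concat F)" "sort (concat F) = [0..<9]"
        by (auto simp: list_all_iff)
      moreover from this(3) have "set (concat F) = {..<9}" by (metis set_sort set_upt atLeast_upt)
      ultimately have "cycles_on 3 {..<9} F" by (simp add: cycles_on_def)
      then show ?thesis unfolding F(1) by (rule triple_partition_list)
    qed
    fix x y :: nat assume xy: "x \<in> {..<9}" "y \<in> {..<9}" "x \<noteq> y"
    have c: "list_all (\<lambda>x. list_all (\<lambda>y. x = y \<or> list_ex (list_ex (\<lambda>T. x \<in> set T \<and> y \<in> set T)) affine_plane_3) [0..<9]) [0..<9]"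
      by code_simp
    then have "list_ex (list_ex (\<lambda>T. x \<in> set T \<and> y \<in> set T)) affine_plane_3"
      using bspec[OF bspec[OF c[unfolded list_all_iff], of x], of y] xy by simp
    then obtain F T where "F \<in> set affine_plane_3" "T \<in> set F" "x \<in> set T" "y \<in> set T" unfolding list_ex_iff by blast
    then show "\<exists>P\<in>(\<lambda>F. set ` set F) ` set affine_plane_3. \<exists>T\<in>P. x \<in> T \<and> y \<in> T"
      by (intro bexI[of _ "set ` set F"] bexI[of _ "set T"] conjI imageI)
  qed simp_all
  then show ?thesis by (rule kts_of_kirkman)
qed

text \<open>The vectors \<open>e\<^sub>i\<close> and \<open>e\<^sub>i - e\<^sub>j\<close> represent six of the 13 directions of \<open>GF(3)\<^sup>3\<close>; these are the
  seven others.\<close>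

type_synonym v3 = "3 \<times> 3 \<times> 3"

definition simplex :: "v3 set" where
  "simplex = {(0, 0, 0), (1, 0, 0), (0, 1, 0), (0, 0, 1)}"

definition directions :: "v3 set" where
  "directions = {(1, 1, 0), (1, 0, 1), (0, 1, 1), (1, 1, 1), (1, 1, 2), (1, 2, 1), (2, 1, 1)}"

lemma cases_3: "(x::3) = 0 \<or> x = 1 \<or> x = 2"
proof (cases x rule: bit1_cases)
  case (of_int z)
  then have "z = 0 \<or> z = 1 \<or> z = 2" by auto
  then show ?thesis using of_int by auto
qed

lemma direction_cases:
  assumes "d \<noteq> 0"
  shows "(\<exists>a\<in>simplex. \<exists>b\<in>simplex. d = a - b) \<or> d \<in> directions \<or> - d \<in> directions"
proof -
  obtain x y z where d: "d = (x, y, z)" by (cases d)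
  \<comment> \<open>The twelve nonzero differences of the simplex; with the seven directions and
    their negatives they make up all 26 nonzero vectors.\<close>
  define D where "D = {(1, 0, 0), (2, 0, 0), (0, 1, 0), (0, 2, 0), (0, 0, 1), (0, 0, 2 :: 3), (1, 2, 0), (2, 1, 0),
    (1, 0, 2), (2, 0, 1), (0, 1, 2), (0 :: 3, 2 :: 3, 1)}"
  have "d \<in> D \<or> d \<in> directions \<or> - d \<in> directions" using assms cases_3[of x] cases_3[of y] cases_3[of z]
    unfolding d D_def directions_def zero_prod_def by (elim disjE) simp_all
  moreover have "\<exists>a\<in>simplex. \<exists>b\<in>simplex. d = a - b" if "d \<in> D" for d
    using that unfolding D_def simplex_def by (elim insertE emptyE) (simp_all add: zero_prod_def)
  ultimately show ?thesis by blast
qed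
lemma simplex_differences:
  assumes "a \<in> simplex" "b \<in> simplex" "a' \<in> simplex" "b' \<in> simplex" "a \<noteq> b" "a - b = a' - b'"
  shows "a = a'"
proof -
  \<comment> \<open>\<open>f\<close> keeps coordinates equal to 1 and erases those equal to 2 = -1,
    which recovers the minuend from a difference of two simplex points.\<close>
  define f :: "3 \<times> 3 \<times> 3 \<Rightarrow> 3 \<times> 3 \<times> 3" where "f d = (case d of (x, y, z) \<Rightarrow>
    (if x = 1 then 1 else 0, if y = 1 then 1 else 0, if z = 1 then 1 else 0))" for d
  have f: "f (c - d) = c" if "c \<in> simplex" "d \<in> simplex" "c \<noteq> d" for c d
    using that unfolding simplex_def by (elim insertE emptyE) (simp_all add: f_def zero_prod_def)
  have "a' \<noteq> b'" using assms(5,6) by auto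
  then show ?thesis using f[OF assms(1,2,5)] f[OF assms(3,4)] assms(6) by simp
qed

lemma simplex_not_direction:
  assumes "a \<in> simplex" "b \<in> simplex"
  shows "a - b \<notin> directions"
  using assms unfolding simplex_def directions_def by (elim insertE emptyE) (simp_all add: zero_prod_def)

lemma direction_unique:
  assumes "d \<in> directions" "e \<in> directions"
  shows "d \<noteq> - e"
  using assms unfolding directions_def by (elim insertE emptyE) simp_all

lemma char_3: "(g::3 \<times> 3 \<times> 3) + d + d = g - d" "g - d - d = g + d"
proof -
  have three: "3 * x = 0" for x :: 3
  proof -
    have "(3 :: 3) = 0" by simp
    then show ?thesis by (simp only: mult_zero_left)
  qed
  have "d + d + d = 0" by (cases d) (simp add: three zero_prod_def)
  then show "g + d + d = g - d" "g - d - d = g + d"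
    by (simp_all add: algebra_simps eq_neg_iff_add_eq_0)
qed

text \<open>The 27 vectors and seven points at infinity make 34 = 3 * 11 + 1 points. Blocks are the
  translates of the simplex, the lines in the seven remaining directions extended by their point at
  infinity, and the set of points at infinity, of size 7 = 3 * 2 + 1. Two vectors are joined by a
  simplex or by a line according to their difference. Products and cube roots fail here: 23 is a
  prime congruent to 2 modulo 3, and 34 is even.\<close>

lemma kts_11:
  assumes "kts 1" "kts 2"
  shows "kts 11"
proof -
  define A :: "v3 \<Rightarrow> (v3 + v3) set" where "A c = (\<lambda>a. Inl (a + c)) ` simplex" for c
  define L :: "v3 \<Rightarrow> v3 \<Rightarrow> (v3 + v3) set"
    where "L d g = insert (Inr d) (Inl ` {g, g + d, g - d})" for d g
  define C :: "(v3 + v3) set" where "C = Inr ` directions"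
  define X :: "(v3 + v3) set" where "X = range Inl \<union> C"
  define \<B> where "\<B> = range A \<union> {L d g | d g. d \<in> directions} \<union> {C}"
  have AB: "A c \<in> \<B>" and LB: "d \<in> directions \<Longrightarrow> L d g \<in> \<B>" and CB: "C \<in> \<B>" for c d g
    unfolding \<B>_def by blast+
  have Bcases: "(\<exists>c. B = A c) \<or> (\<exists>d\<in>directions. \<exists>g. B = L d g) \<or> B = C" if "B \<in> \<B>" for B
    using that unfolding \<B>_def by blast
  have card_dir: "card directions = 7" unfolding directions_def by simp
  have card_simplex: "card simplex = 4" unfolding simplex_def by simp
  have dir0: "d \<noteq> 0" "- d \<noteq> d" if "d \<in> directions" for d
    using that direction_unique[OF that that] unfolding directions_def zero_prod_def by auto
  have Lg: "L d h = L d g" if "Inl h \<in> L d g" for d g h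
    using that unfolding L_def by (auto simp: char_3)
  have Ldiff: "k - h = d \<or> k - h = - d" if "Inl h \<in> L d g" "Inl k \<in> L d g" "h \<noteq> k" for d g h k
  proof -
    have "Inl k \<in> L d h" using that(2) Lg[OF that(1)] by simp
    then show ?thesis using that(3) unfolding L_def by auto
  qed
  have Adiff: "\<exists>a\<in>simplex. \<exists>b\<in>simplex. h = a + c \<and> k = b + c" if hk: "Inl h \<in> A c" "Inl k \<in> A c" for h k c
    using hk unfolding A_def by blast
  have AL: False if AL: "Inl h \<in> A c" "Inl k \<in> A c" "Inl h \<in> L d g" "Inl k \<in> L d g" "h \<noteq> k" "d \<in> directions" for h k c d g
  proof -
    obtain a b where ab: "a \<in> simplex" "b \<in> simplex" "h = a + c" "k = b + c" using Adiff[OF AL(1,2)] by blast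
    have "k - h = b - a" "h - k = a - b" using ab by simp_all
    moreover have "k - h = d \<or> h - k = d" using Ldiff[OF AL(3-5)] by (metis minus_diff_eq minus_minus)
    ultimately show False using simplex_not_direction[OF ab(1,2)] simplex_not_direction[OF ab(2,1)] AL(6) by auto
  qed
  have "kirkman_frame X"
  proof (rule kirkman_frame_pbd[of \<B>])
    fix B assume "B \<in> \<B>"
    then show "B \<subseteq> X" using Bcases[of B] unfolding A_def L_def X_def C_def by auto
  next
    fix B assume "B \<in> \<B>"
    then consider c where "B = A c" | d g where "d \<in> directions" "B = L d g" | "B = C" using Bcases by blast
    then show "kirkman_frame B"
    proof cases
      case (1 c)
      have "card (A c) = 3 * 1 + 1" unfolding A_def using card_simplex by (subst card_image) (auto simp: inj_on_def)
      then show ?thesis unfolding 1 by (intro kirkman_frame_kts[OF assms(1)]) (simp_all add: A_def simplex_def)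
    next
      case (2 d g)
      have "g + d \<noteq> g - d"
      proof
        assume "g + d = g - d"
        then have "g + d + d = g + d" using char_3(1)[of g d] by simp
        then show False using dir0(1)[OF 2(1)] by simp
      qed
      moreover have "g \<noteq> g + d" "g \<noteq> g - d" using dir0(1)[OF 2(1)] by simp_all
      ultimately have "card {g, g + d, g - d} = 3" by simp
      then have "card (Inl ` {g, g + d, g - d} :: (v3 + v3) set) = 3" by (simp only: card_image inj_Inl inj_on_subset[OF inj_Inl subset_UNIV])
      then have "card (L d g) = 3 * 1 + 1" unfolding L_def by (subst card_insert_disjoint) auto
      then show ?thesis unfolding 2(2) by (intro kirkman_frame_kts[OF assms(1)]) (simp_all add: L_def)
    next
      case 3
      have "card C = 3 * 2 + 1" unfolding C_def using card_dir by (simp add: card_image)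
      then show ?thesis unfolding 3 by (intro kirkman_frame_kts[OF assms(2)]) (simp_all add: C_def)
    qed
  next
    fix p q assume pq: "p \<in> X" "q \<in> X" "p \<noteq> q"
    have mixed: "\<exists>B\<in>\<B>. Inl g \<in> B \<and> Inr d \<in> B" if "d \<in> directions" for g d
      by (rule bexI[OF _ LB[OF that]]) (auto simp: L_def)
    show "\<exists>B\<in>\<B>. p \<in> B \<and> q \<in> B"
    proof (cases p)
      case (Inl g)
      show ?thesis
      proof (cases q)
        case q: (Inl h)
        have "h - g \<noteq> 0" using pq(3) Inl q by simp
        then consider a b where "a \<in> simplex" "b \<in> simplex" "h - g = a - b" | "h - g \<in> directions" | "- (h - g) \<in> directions"
          using direction_cases[of "h - g"] by blast
        then show ?thesis
        proof cases
          case (1 a b)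
          have "p \<in> A (g - b)" unfolding Inl A_def by (rule image_eqI[of _ _ b]) (use 1 in auto)
          moreover have "h = a + (g - b)" using 1(3) by (simp add: algebra_simps)
          then have "q \<in> A (g - b)" unfolding q A_def by (intro image_eqI[of _ _ a]) (use 1 in auto)
          ultimately show ?thesis by (intro bexI[OF _ AB] conjI)
        next
          case 2
          show ?thesis by (rule bexI[OF _ LB[OF 2, of g]]) (simp add: Inl q L_def)
        next
          case 3
          show ?thesis by (rule bexI[OF _ LB[OF 3, of g]]) (simp add: Inl q L_def)
        qed
      next
        case (Inr d)
        then have "d \<in> directions" using pq(2) unfolding X_def C_def by auto
        then show ?thesis using mixed[of d g] Inl Inr by simp
      qed
    next
      case (Inr d)
      then have d: "d \<in> directions" using pq(1) unfolding X_def C_def by auto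
      show ?thesis
      proof (cases q)
        case (Inl g)
        then show ?thesis using mixed[OF d, of g] Inr by (simp only: conj_commute)
      next
        case q: (Inr e)
        then have "p \<in> C" "q \<in> C" using d Inr pq(2) unfolding X_def C_def by auto
        then show ?thesis by (intro bexI[OF _ CB] conjI)
      qed
    qed
  next
    fix B B' p q
    assume h: "B \<in> \<B>" "B' \<in> \<B>" "p \<noteq> q" "p \<in> B" "q \<in> B" "p \<in> B'" "q \<in> B'"
    have inr: "B = C \<or> (\<exists>e\<in>directions. \<exists>g. B = L e g \<and> d = e)" if "B \<in> \<B>" "Inr d \<in> B" for B d
      using Bcases[OF that(1)] that(2) unfolding A_def L_def by auto
    have inl: "(\<exists>c. B = A c) \<or> (\<exists>d\<in>directions. B = L d g)" if "B \<in> \<B>" "Inl g \<in> B" for B g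
      using Bcases[OF that(1)]
    proof (elim disjE bexE exE)
      fix d g' assume "d \<in> directions" "B = L d g'"
      then show ?thesis using Lg[of g d g'] that(2) by auto
    qed (use that(2) in \<open>auto simp: C_def\<close>)
    have mix: "B = B'" if "B \<in> \<B>" "B' \<in> \<B>" "Inl g \<in> B" "Inl g \<in> B'" "Inr d \<in> B" "Inr d \<in> B'" for B B' g d
    proof -
      have "D = L d g" if D: "D \<in> \<B>" "Inl g \<in> D" "Inr d \<in> D" for D
        using inl[OF D(1,2)] D(3) unfolding A_def L_def by auto
      then show ?thesis using that by metis
    qed
    show "B = B'"
    proof (cases p; cases q)
      fix g k assume p: "p = Inl g" "q = Inl k"
      then have gk: "g \<noteq> k" using h(3) by simp
      note m = h(4)[unfolded p] h(5)[unfolded p] h(6)[unfolded p] h(7)[unfolded p]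
      consider c c' where "B = A c" "B' = A c'" | c d where "B = A c" "d \<in> directions" "B' = L d g" |
        c d where "B' = A c" "d \<in> directions" "B = L d g" |
        d e where "d \<in> directions" "e \<in> directions" "B = L d g" "B' = L e g"
        using inl[OF h(1) m(1)] inl[OF h(2) m(3)] by blast
      then show ?thesis
      proof cases
        case (1 c c')
        obtain a b where ab: "a \<in> simplex" "b \<in> simplex" "g = a + c" "k = b + c" using Adiff m(1,2) 1 by blast
        obtain a' b' where ab': "a' \<in> simplex" "b' \<in> simplex" "g = a' + c'" "k = b' + c'" using Adiff m(3,4) 1 by blast
        have "a - b = g - k" unfolding ab(3,4) by simp
        moreover have "a' - b' = g - k" unfolding ab'(3,4) by simp
        moreover have "a \<noteq> b" using gk ab(3,4) by auto
        ultimately have "a = a'" by (intro simplex_differences[OF ab(1,2) ab'(1,2)]) simp_all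
        then have "c = c'" using ab(3) ab'(3) by simp
        then show ?thesis using 1 by simp
      next
        case (2 c d)
        then show ?thesis using AL[of g c k d g] m gk by simp
      next
        case (3 c d)
        then show ?thesis using AL[of g c k d g] m gk by simp
      next
        case (4 d e)
        have "k - g = d \<or> k - g = - d" using Ldiff[of g d g k] m gk 4 by simp
        moreover have "k - g = e \<or> k - g = - e" using Ldiff[of g e g k] m gk 4 by simp
        ultimately have "d = e"
          using direction_unique[OF 4(1,2)] direction_unique[OF 4(2,1)] by (metis minus_minus)
        then show ?thesis using 4 by simp
      qed
    next
      fix g d assume "p = Inl g" "q = Inr d"
      then show ?thesis using mix[OF h(1,2), of g d] h(4-7) by simp
    next
      fix d g assume "p = Inr d" "q = Inl g"
      then show ?thesis using mix[OF h(1,2), of g d] h(4-7) by simp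
    next
      fix d e assume p: "p = Inr d" "q = Inr e"
      have "D = C" if D: "D \<in> \<B>" "Inr d \<in> D" "Inr e \<in> D" for D
        using inr[OF D(1,2)] D(3) h(3) p unfolding L_def by auto
      then show ?thesis using h p by metis
    qed
  qed
  moreover have "card X = 3 * 11 + 1"
  proof -
    have "card (range Inl :: (v3 + v3) set) = 27" by (simp add: card_image)
    moreover have "card C = 7" unfolding C_def using card_dir by (simp add: card_image)
    ultimately show ?thesis unfolding X_def by (subst card_Un_disjoint) (auto simp: C_def)
  qed
  ultimately show ?thesis by (intro kts_of_frame[of X]) (simp_all add: X_def C_def)
qed

section \<open>All Kirkman triple systems\<close>

lemma kts_4: "kts 4" using kts_td[of 1 0] kts_0 kts_1 by simp
lemma kts_5: "kts 5" using kts_td[of 1 1] kts_1 by simp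
lemma kts_7: "kts 7" by (rule kts_product[OF kts_1 kts_2]) simp
lemma kts_10: "kts 10" by (rule kts_product[OF kts_1 kts_3]) simp
lemma kts_12: "kts 12" by (rule kts_product[OF kts_2 kts_2]) simp
lemma kts_13: "kts 13" by (rule kts_product[OF kts_1 kts_4]) simp
lemma kts_16: "kts 16" by (rule kts_product[OF kts_1 kts_5]) simp
lemma kts_17: "kts 17" by (rule kts_product[OF kts_2 kts_3]) simp
lemma kts_19: "kts 19" by (rule kts_product[OF kts_1 kts_6]) simp
lemma kts_27: "kts 27" by (rule kts_product[OF kts_2 kts_5]) simp
lemma kts_37: "kts 37" by (rule kts_product[OF kts_1 kts_12]) simp
lemma kts_38: "kts 38" by (rule kts_product[OF kts_3 kts_5]) simp
lemma kts_40: "kts 40" by (rule kts_product[OF kts_1 kts_13]) simp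
lemma kts_42: "kts 42" by (rule kts_product[OF kts_2 kts_8]) simp
lemma kts_43: "kts 43" by (rule kts_product[OF kts_1 kts_14]) simp
lemma kts_66: "kts 66" by (rule kts_product[OF kts_3 kts_9]) simp
text \<open>135 = 3 * 45, and the factor 45 = 2 * 22 + 1 is reached through 22 = 4 * 5 + 2.\<close>

lemma kts_67: "kts 67" by (rule kts_product[OF kts_1, of 22]) (use kts_td[of 5 2] kts_5 kts_2 kts_1 in simp_all)

lemmas kts_small = kts_0 kts_1 kts_2 kts_3 kts_4 kts_5 kts_6 kts_7 kts_8 kts_9 kts_10
  kts_11[OF kts_1 kts_2] kts_12 kts_13 kts_14 kts_15 kts_16 kts_17 kts_18 kts_19 kts_26 kts_27 kts_36
  kts_37 kts_38 kts_39 kts_40 kts_41[OF kts_1 kts_10] kts_42 kts_43 kts_66 kts_67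

text \<open>The listed ranges are unions of intervals from 4M to 5M with M = 5, 7, 11, 13 and larger
  numbers coprime to 6; from 68 on these intervals leave no gaps.\<close>

lemma td_parameters:
  fixes t :: nat
  assumes "t \<in> {20..25} \<union> {28..35} \<union> {44..65} \<union> {68..}"
  shows "\<exists>M. odd M \<and> \<not> 3 dvd M \<and> 4 * M \<le> t \<and> t \<le> 5 * M"
proof -
  consider "t \<in> {20..25}" | "t \<in> {28..35}" | "t \<in> {44..55}" | "t \<in> {52..65}" | "68 \<le> t" using assms by fastforce
  then show ?thesis
  proof cases
    case 1 then show ?thesis by (intro exI[of _ 5]) simp
  next
    case 2 then show ?thesis by (intro exI[of _ 7]) simp
  next
    case 3 then show ?thesis by (intro exI[of _ 11]) simp
  next
    case 4 then show ?thesis by (intro exI[of _ 13]) simp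
  next
    case 5
    define q where "q = t div 4"
    have q: "4 * q \<le> t" "t \<le> 4 * q + 3" "q \<ge> 17" using 5 unfolding q_def by auto
    \<comment> \<open>Numbers coprime to 6 are at most 4 apart, so four consecutive integers contain
      one.\<close>
    have "\<exists>M. odd M \<and> \<not> 3 dvd M \<and> M \<le> q \<and> q \<le> M + 3" using q(3) by presburger
    then obtain M where M: "odd M" "\<not> 3 dvd M" "M \<le> q" "q \<le> M + 3" by blast
    \<comment> \<open>Since \<open>t \<le> 4 * M + 15\<close>, the bound
      \<open>t \<le> 5 * M\<close> needs \<open>M \<ge> 15\<close>; \<open>q \<ge> 17\<close> gives
      only 14, which parity excludes.\<close>
    then have "M \<noteq> 14" by auto
    then have "t \<le> 5 * M" "4 * M \<le> t" using M(3,4) q by linarith+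
    then show ?thesis using M(1,2) by blast
  qed
qed

text \<open>In the recursive case both \<open>M\<close> and \<open>w = t - 4 * M \<le> M\<close> are
  smaller than \<open>t\<close>; the complement of the ranges is finite and was treated value by
  value.\<close>

lemma kts_all: "kts t"
proof (induction t rule: less_induct)
  case (less t)
  show ?case
  proof (cases "t \<in> {20..25} \<union> {28..35} \<union> {44..65} \<union> {68..}")
    case True
    then obtain M where M: "odd M" "\<not> 3 dvd M" "4 * M \<le> t" "t \<le> 5 * M" using td_parameters by blast
    have "M > 0" using M(1) by (cases M) auto
    then have "kts (4 * M + (t - 4 * M))"
      using M less.IH kts_1 by (intro kts_td) auto
    then show ?thesis using M(3) by simp
  next
    case False
    then have "t \<in> {0, 1, 2, 3, 4, 5, 6, 7, 8, 9, 10, 11, 12, 13, 14, 15, 16, 17, 18, 19, 26, 27,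
        36, 37, 38, 39, 40, 41, 42, 43, 66, 67}"
      by (simp, presburger)
    then show ?thesis using kts_small by (elim insertE emptyE) simp_all
  qed
qed

theorem theorem1p1:
  fixes n r s :: nat
  assumes "odd n"
    and "r \<ge> 1" and "s \<ge> 1"
    and "r + s = (n - 1) div 2"
    and "\<not> (n = 21 \<and> r \<in> {2, 4, 6})"
  shows "(\<exists>P. HW n r s 3 7 P) \<longleftrightarrow> [n = 21] (mod 42)"
proof
  assume "\<exists>P. HW n r s 3 7 P"
  then obtain P where P: "HW n r s 3 7 P" ..
  have dvd: "k dvd n" if "card {F \<in> P. cycle_factor k {..<n} (complete_edges {..<n}) F} \<ge> 1" for k
  proof -
    have "{F \<in> P. cycle_factor k {..<n} (complete_edges {..<n}) F} \<noteq> {}"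
      using that by (metis card.empty not_one_le_zero)
    then obtain F where "cycle_factor k {..<n} (complete_edges {..<n}) F" by blast
    then show ?thesis using cycle_factor_dvd by fastforce
  qed
  have "3 dvd n" "7 dvd n" using dvd[of 3] dvd[of 7] P assms(2,3) unfolding HW_def by auto
  moreover have "coprime (3::nat) 7" by (rule prime_imp_coprime) simp_all
  ultimately have "3 * 7 dvd n" by (rule divides_mult)
  then obtain j where j: "n = 21 * j" by (auto simp: dvd_def)
  then have "odd j" using assms(1) by simp
  then obtain i where "j = 2 * i + 1" by (rule oddE)
  then show "[n = 21] (mod 42)" unfolding j cong_def by (simp add: algebra_simps)
next
  assume "[n = 21] (mod 42)"
  then have "n mod 42 = 21" by (simp add: cong_def)
  then obtain t where n: "n = 42 * t + 21" by (metis mult_div_mod_eq)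
  show "\<exists>P. HW n r s 3 7 P"
  proof (cases "t = 0")
    case True
    then have rs: "n = 21" "r + s = 10" using n assms(4) by auto
    \<comment> \<open>The values 2, 4, 6 are the possible exceptions set aside in the assumptions,
      and \<open>s \<ge> 1\<close> excludes 10.\<close>
    then have "r \<in> {1, 3, 5, 7, 8, 9}" using assms(2,3,5) by (simp, presburger)
    then have "hw {..<21} (complete_edges {..<21::nat}) r (10 - r)" by (intro hw_21) auto
    moreover have "10 - r = s" using rs by simp
    ultimately show ?thesis using hw_HW[of n r s] assms(1,4) rs(1) by simp
  next
    case False
    \<comment> \<open>Here \<open>n = 14 * (3 * t + 1) + 7\<close>, and \<open>t \<noteq> 0\<close>
      gives the at least two classes that the blow-up requires.\<close>
    have "kirkman (3 * t + 1) {..<6 * t + 3}" by (rule kirkman_of_kts[OF kts_all]) simp_all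
    then show ?thesis
      by (rule HW_of_kirkman) (use False assms n in auto)
  qed
qed

end
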